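(* Let $A$ be a simple unital AH-algebra with diagonal maps. If $A$ has mean dimension zero, then for any projections $p$ and $q$ in $A$ such that $\tau(p)>\tau(q)$ for every tracial state $\tau$ of $A$, the projection $q$ is Murray--von Neumann equivalent to a sub-projection of $p$.
   Context: **AH-algebras with diagonal maps.** $A=\varinjlim(A_i,\varphi_i)$ is the inductive limit of a sequence of unital C*-algebras $A_i=\bigoplus_{l=1}^{h_i}A_{i,l}$, $A_{i,l}=p_{i,l}\mathrm{M}_{r_{i,l}}(\mathrm{C}(X_{i,l}))p_{i,l}$, with unital connecting maps $\varphi_{i,j}:A_i\to A_j$, where each $X_{i,l}$ is a connected compact Hausdorff space and $p_{i,l}$ is a projection of rank $n_{i,l}$. It has diagonal maps if for all $i<j$ there is a unitary $U\in A_j$ such that for all $l,k$ the component $A_{i,l}\to A_{j,k}$ of $\mathrm{ad}(U)\circ\varphi_{i,j}$ has the form $f\mapsto\mathrm{diag}(f\circ\lambda_{i,j}^{l,k}(1),\dots,f\circ\lambda_{i,j}^{l,k}(m_{i,j}^{l,k}))$ for continuous maps $\lambda_{i,j}^{l,k}(m):X_{j,k}\to X_{i,l}$. **Mean dimension.** For a finite open cover $\alpha$ of a space $X$ let $\mathrm{ord}(\alpha)=\max_{x\in X}\big(\sum_{U\in\alpha}1_U(x)\big)-1$ and $\mathcal D(\alpha)=\min\{\mathrm{ord}(\beta):\beta\text{ a finite open cover refining }\alpha\}$. Covers $\alpha\vee\beta$ consist of the sets $U\cap V$, $U\in\alpha$, $V\in\beta$. Let $X_i=\bigsqcup_lX_{i,l}$.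 For a finite open cover $\alpha$ of $X_i$, each member of which is contained in a connected component, inducing covers $\alpha_l$ of $X_{i,l}$, put $\varphi_{i,j}^k(\alpha)=\bigvee_{l}\bigvee_{m}(\lambda_{i,j}^{l,k}(m))^{-1}(\alpha_l)$, an open cover of $X_{j,k}$. Set $\gamma_i(A)=\sup_{\alpha}\lim_{j\to\infty}\max_{1\le k\le h_j}\mathcal D(\varphi_{i,j}^k(\alpha))/n_{j,k}$ (the limit exists since the sequence is decreasing in $j$). The mean dimension of $A$ (with respect to the given decomposition) is $\gamma(A)=\lim_i\gamma_i(A)$ (an increasing limit). *)

theory Defs
  imports
    "HOL-Analysis.Analysis"
    "Jordan_Normal_Form.Schur_Decomposition"
    "Jordan_Normal_Form.DL_Rank"
begin

section \<open>Unital C*-algebras\<close>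

text \<open>
  Since \<^class>\<open>real_normed_algebra_1\<close> contains the axiom \<open>norm 1 = 1\<close>, the zero algebra is
  excluded; it is not simple anyway.
\<close>

class unital_cstar_algebra = real_normed_algebra_1 + banach +
  fixes scaleC :: "complex \<Rightarrow> 'a \<Rightarrow> 'a"
    and star :: "'a \<Rightarrow> 'a"
  assumes scaleC_of_real: "scaleC (complex_of_real r) x = scaleR r x"
    and scaleC_add_right: "scaleC c (x + y) = scaleC c x + scaleC c y"
    and scaleC_add_left: "scaleC (c + d) x = scaleC c x + scaleC d x"
    and scaleC_scaleC: "scaleC c (scaleC d x) = scaleC (c * d) x"
    and mult_scaleC_left: "scaleC c x * y = scaleC c (x * y)"
    and mult_scaleC_right: "x * scaleC c y = scaleC c (x * y)"
    and norm_scaleC: "norm (scaleC c x) = cmod c * norm x"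
    and star_star: "star (star x) = x"
    and star_add: "star (x + y) = star x + star y"
    and star_scaleC: "star (scaleC c x) = scaleC (cnj c) (star x)"
    and star_mult: "star (x * y) = star y * star x"
    and cstar_identity: "norm (star x * x) = (norm x)\<^sup>2"

definition is_projection :: "'a::unital_cstar_algebra \<Rightarrow> bool" where
  "is_projection p \<longleftrightarrow> p * p = p \<and> star p = p"

definition subprojection :: "'a::unital_cstar_algebra \<Rightarrow> 'a \<Rightarrow> bool" where
  "subprojection e p \<longleftrightarrow> is_projection e \<and> is_projection p \<and> p * e = e"

definition mvn_equivalent :: "'a::unital_cstar_algebra \<Rightarrow> 'a \<Rightarrow> bool" where
  "mvn_equivalent p q \<longleftrightarrow> (\<exists>v. star v * v = p \<and> v * star v = q)"

definition closed_two_sided_ideal :: "'a::unital_cstar_algebra set \<Rightarrow> bool" where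
  "closed_two_sided_ideal I \<longleftrightarrow>
     closed I \<and> 0 \<in> I \<and>
     (\<forall>x\<in>I. \<forall>y\<in>I. x + y \<in> I) \<and> (\<forall>c. \<forall>x\<in>I. scaleC c x \<in> I) \<and>
     (\<forall>a. \<forall>x\<in>I. a * x \<in> I \<and> x * a \<in> I)"

definition simple_cstar_algebra :: "'a::unital_cstar_algebra itself \<Rightarrow> bool" where
  "simple_cstar_algebra (_ :: 'a itself) \<longleftrightarrow>
     (\<forall>I :: 'a set. closed_two_sided_ideal I \<longrightarrow> I = {0} \<or> I = UNIV)"

definition tracial_state :: "('a::unital_cstar_algebra \<Rightarrow> complex) \<Rightarrow> bool" where
  "tracial_state \<tau> \<longleftrightarrow>
     (\<forall>x y. \<tau> (x + y) = \<tau> x + \<tau> y) \<and> (\<forall>c x. \<tau> (scaleC c x) = c * \<tau> x) \<and>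
     (\<forall>x. \<tau> (star x * x) \<in> \<real> \<and> 0 \<le> Re (\<tau> (star x * x))) \<and>
     \<tau> 1 = 1 \<and> (\<forall>x y. \<tau> (x * y) = \<tau> (y * x))"


section \<open>Homomorphisms and inductive limits\<close>

text \<open>
  The building blocks depend on parameters and are therefore given by a carrier set with
  operations; a type of class \<^class>\<open>unital_cstar_algebra\<close> is viewed in the same way.
\<close>

record 'b star_structure =
  sa_carrier :: "'b set"
  sa_plus :: "'b \<Rightarrow> 'b \<Rightarrow> 'b"
  sa_times :: "'b \<Rightarrow> 'b \<Rightarrow> 'b"
  sa_scale :: "complex \<Rightarrow> 'b \<Rightarrow> 'b"
  sa_star :: "'b \<Rightarrow> 'b"
  sa_one :: 'b
  sa_norm :: "'b \<Rightarrow> real"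

definition type_algebra :: "'a::unital_cstar_algebra star_structure" where
  "type_algebra = \<lparr>sa_carrier = UNIV, sa_plus = (+), sa_times = (*), sa_scale = scaleC,
     sa_star = star, sa_one = 1, sa_norm = norm\<rparr>"

definition unital_star_hom ::
  "'b star_structure \<Rightarrow> 'c star_structure \<Rightarrow> ('b \<Rightarrow> 'c) \<Rightarrow> bool" where
  "unital_star_hom B C f \<longleftrightarrow>
     f \<in> sa_carrier B \<rightarrow> sa_carrier C \<and>
     (\<forall>x\<in>sa_carrier B. \<forall>y\<in>sa_carrier B.
        f (sa_plus B x y) = sa_plus C (f x) (f y) \<and> f (sa_times B x y) = sa_times C (f x) (f y)) \<and>
     (\<forall>c. \<forall>x\<in>sa_carrier B. f (sa_scale B c x) = sa_scale C c (f x)) \<and>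
     (\<forall>x\<in>sa_carrier B. f (sa_star B x) = sa_star C (f x)) \<and>
     f (sa_one B) = sa_one C"

definition inductive_system ::
  "(nat \<Rightarrow> 'b star_structure) \<Rightarrow> (nat \<Rightarrow> nat \<Rightarrow> 'b \<Rightarrow> 'b) \<Rightarrow> bool" where
  "inductive_system B \<phi> \<longleftrightarrow>
     (\<forall>i j. i \<le> j \<longrightarrow> unital_star_hom (B i) (B j) (\<phi> i j)) \<and>
     (\<forall>i. \<forall>a\<in>sa_carrier (B i). \<phi> i i a = a) \<and>
     (\<forall>i j k. \<forall>a\<in>sa_carrier (B i). i \<le> j \<and> j \<le> k \<longrightarrow> \<phi> j k (\<phi> i j a) = \<phi> i k a)"

text \<open>
  The C*-algebraic inductive limit is the completion of the algebraic limit for the seminorm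
  \<open>\<parallel>[a]\<parallel> = lim\<^sub>j \<parallel>\<phi>\<^sub>i\<^sub>,\<^sub>j(a)\<parallel>\<close> (after dividing out its null space).  The predicate
  says that the type \<open>'a\<close>, with the canonical maps \<open>\<psi> i\<close>, is (a copy of) this completion.
\<close>

definition is_inductive_limit ::
  "(nat \<Rightarrow> 'b star_structure) \<Rightarrow> (nat \<Rightarrow> nat \<Rightarrow> 'b \<Rightarrow> 'b) \<Rightarrow>
   (nat \<Rightarrow> 'b \<Rightarrow> 'a::unital_cstar_algebra) \<Rightarrow> bool" where
  "is_inductive_limit B \<phi> \<psi> \<longleftrightarrow>
     inductive_system B \<phi> \<and>
     (\<forall>i. unital_star_hom (B i) type_algebra (\<psi> i)) \<and>
     (\<forall>i j. \<forall>a\<in>sa_carrier (B i). i \<le> j \<longrightarrow> \<psi> j (\<phi> i j a) = \<psi> i a) \<and>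
     (\<forall>i. \<forall>a\<in>sa_carrier (B i). (\<lambda>j. sa_norm (B j) (\<phi> i j a)) \<longlonglongrightarrow> norm (\<psi> i a)) \<and>
     closure (\<Union>i. \<psi> i ` sa_carrier (B i)) = UNIV"


section \<open>Homogeneous building blocks\<close>

definition cvec_norm :: "complex vec \<Rightarrow> real" where
  "cvec_norm v = sqrt (Re (v \<bullet>c v))"

definition mat_opnorm :: "complex mat \<Rightarrow> real" where
  "mat_opnorm M = Sup {cvec_norm (M *\<^sub>v v) | v. v \<in> carrier_vec (dim_col M) \<and> cvec_norm v \<le> 1}"

definition matrix_functions :: "'x topology \<Rightarrow> nat \<Rightarrow> ('x \<Rightarrow> complex mat) set" where
  "matrix_functions T r =
     {f \<in> topspace T \<rightarrow>\<^sub>E carrier_mat r r.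
        \<forall>a<r. \<forall>b<r. continuous_map T euclidean (\<lambda>x. f x $$ (a, b))}"

text \<open>The underlying set of \<open>p M\<^sub>r(C(T)) p\<close>.\<close>

definition corner :: "'x topology \<Rightarrow> nat \<Rightarrow> ('x \<Rightarrow> complex mat) \<Rightarrow> ('x \<Rightarrow> complex mat) set" where
  "corner T r p = (\<lambda>f. \<lambda>x\<in>topspace T. p x * f x * p x) ` matrix_functions T r"

definition matrix_projection :: "'x topology \<Rightarrow> nat \<Rightarrow> nat \<Rightarrow> ('x \<Rightarrow> complex mat) \<Rightarrow> bool" where
  "matrix_projection T r n p \<longleftrightarrow>
     p \<in> matrix_functions T r \<and>
     (\<forall>x\<in>topspace T. p x * p x = p x \<and> mat_adjoint (p x) = p x \<and> vec_space.rank r (p x) = n)"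


section \<open>AH-systems with diagonal maps\<close>

text \<open>
  Indices start at 0: the summands of the \<open>i\<close>-th algebra are those with index \<open>l < summands D i\<close>, and the
  maps \<open>\<lambda>\<^sub>i\<^sub>,\<^sub>j\<^sup>l\<^sup>,\<^sup>k(m)\<close> are \<open>eig D i j l k m\<close> for \<open>m < eigs D i j l k\<close>.  An element of
  the \<open>i\<close>-th algebra maps \<open>l\<close> to a matrix valued function on \<open>base D i l\<close>.
\<close>

type_synonym 'x dsum = "nat \<Rightarrow> 'x \<Rightarrow> complex mat"

record 'x ah_data =
  summands :: "nat \<Rightarrow> nat"
  base :: "nat \<Rightarrow> nat \<Rightarrow> 'x topology"
  msize :: "nat \<Rightarrow> nat \<Rightarrow> nat"
  rk :: "nat \<Rightarrow> nat \<Rightarrow> nat"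
  cproj :: "nat \<Rightarrow> nat \<Rightarrow> 'x \<Rightarrow> complex mat"
  conn :: "nat \<Rightarrow> nat \<Rightarrow> 'x dsum \<Rightarrow> 'x dsum"
  eigs :: "nat \<Rightarrow> nat \<Rightarrow> nat \<Rightarrow> nat \<Rightarrow> nat"
  eig :: "nat \<Rightarrow> nat \<Rightarrow> nat \<Rightarrow> nat \<Rightarrow> nat \<Rightarrow> 'x \<Rightarrow> 'x"

definition block :: "'x ah_data \<Rightarrow> nat \<Rightarrow> nat \<Rightarrow> ('x \<Rightarrow> complex mat) set" where
  "block D i l = corner (base D i l) (msize D i l) (cproj D i l)"

definition pointwise :: "'x ah_data \<Rightarrow> nat \<Rightarrow> (nat \<Rightarrow> 'x \<Rightarrow> complex mat) \<Rightarrow> 'x dsum" where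
  "pointwise D i F = (\<lambda>l\<in>{..<summands D i}. \<lambda>x\<in>topspace (base D i l). F l x)"

definition stage :: "'x ah_data \<Rightarrow> nat \<Rightarrow> 'x dsum star_structure" where
  "stage D i =
     \<lparr>sa_carrier = (\<Pi>\<^sub>E l\<in>{..<summands D i}. block D i l),
      sa_plus = (\<lambda>f g. pointwise D i (\<lambda>l x. f l x + g l x)),
      sa_times = (\<lambda>f g. pointwise D i (\<lambda>l x. f l x * g l x)),
      sa_scale = (\<lambda>c f. pointwise D i (\<lambda>l x. c \<cdot>\<^sub>m f l x)),
      sa_star = (\<lambda>f. pointwise D i (\<lambda>l x. mat_adjoint (f l x))),
      sa_one = pointwise D i (cproj D i),
      sa_norm = (\<lambda>f. Sup {mat_opnorm (f l x) | l x. l < summands D i \<and> x \<in> topspace (base D i l)})\<rparr>"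

definition incl :: "'x ah_data \<Rightarrow> nat \<Rightarrow> nat \<Rightarrow> ('x \<Rightarrow> complex mat) \<Rightarrow> 'x dsum" where
  "incl D i l f =
     pointwise D i (\<lambda>l' x. if l' = l then f x else 0\<^sub>m (msize D i l') (msize D i l'))"

definition ah_building_blocks :: "'x ah_data \<Rightarrow> bool" where
  "ah_building_blocks D \<longleftrightarrow>
     (\<forall>i. 0 < summands D i) \<and>
     (\<forall>i. \<forall>l<summands D i.
        topspace (base D i l) \<noteq> {} \<and> connected_space (base D i l) \<and>
        compact_space (base D i l) \<and> Hausdorff_space (base D i l) \<and>
        0 < rk D i l \<and>
        matrix_projection (base D i l) (msize D i l) (rk D i l) (cproj D i l))"

definition unitary_in :: "'b star_structure \<Rightarrow> 'b \<Rightarrow> bool" where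
  "unitary_in B u \<longleftrightarrow> u \<in> sa_carrier B \<and>
     sa_times B (sa_star B u) u = sa_one B \<and> sa_times B u (sa_star B u) = sa_one B"

text \<open>
  A component from the \<open>l\<close>-th to the \<open>k\<close>-th summand is not unital in general, and the matrices
  \<open>f \<circ> \<lambda>(m)\<close> need not fill the \<open>msize D j k\<close>-square matrices in which the \<open>k\<close>-th summand
  lives.  So the diagonal block \<open>diag (f \<circ> \<lambda>(0), f \<circ> \<lambda>(1), \<dots>)\<close> may be padded by zero blocks of
  sizes \<open>s\<close> and \<open>t\<close>, independent of \<open>f\<close> and \<open>x\<close>.
\<close>

definition has_diagonal_maps :: "'x ah_data \<Rightarrow> bool" where
  "has_diagonal_maps D \<longleftrightarrow>
     (\<forall>i j. i < j \<longrightarrow>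
       (\<forall>l<summands D i. \<forall>k<summands D j. \<forall>m<eigs D i j l k.
          continuous_map (base D j k) (base D i l) (eig D i j l k m)) \<and>
       (\<exists>U. unitary_in (stage D j) U \<and>
         (\<forall>l<summands D i. \<forall>k<summands D j. \<exists>s t. \<forall>f\<in>block D i l. \<forall>x\<in>topspace (base D j k).
            sa_times (stage D j) (sa_times (stage D j) U (conn D i j (incl D i l f)))
              (sa_star (stage D j) U) k x =
            diag_block_mat
              ([0\<^sub>m s s] @ map (\<lambda>m. f (eig D i j l k m x)) [0..<eigs D i j l k] @ [0\<^sub>m t t]))))"

text \<open>\<open>\<psi>\<close> exhibits \<open>'a\<close> as an AH-algebra with diagonal maps, with decomposition \<open>D\<close>.\<close>

definition diagonal_ah_algebra ::
  "'x ah_data \<Rightarrow> (nat \<Rightarrow> 'x dsum \<Rightarrow> 'a::unital_cstar_algebra) \<Rightarrow> bool" where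
  "diagonal_ah_algebra D \<psi> \<longleftrightarrow>
     ah_building_blocks D \<and> is_inductive_limit (stage D) (conn D) \<psi> \<and> has_diagonal_maps D"


section \<open>Mean dimension\<close>

definition finite_open_cover :: "'y topology \<Rightarrow> 'y set set \<Rightarrow> bool" where
  "finite_open_cover T \<alpha> \<longleftrightarrow> finite \<alpha> \<and> (\<forall>U\<in>\<alpha>. openin T U) \<and> \<Union>\<alpha> = topspace T"

text \<open>On a nonempty space the truncated subtraction is harmless.\<close>

definition cover_ord :: "'y topology \<Rightarrow> 'y set set \<Rightarrow> nat" where
  "cover_ord T \<alpha> = Max ((\<lambda>x. \<Sum>U\<in>\<alpha>. indicator U x) ` topspace T) - 1"

definition refines :: "'y set set \<Rightarrow> 'y set set \<Rightarrow> bool" where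
  "refines \<beta> \<alpha> \<longleftrightarrow> (\<forall>V\<in>\<beta>. \<exists>U\<in>\<alpha>. V \<subseteq> U)"

definition cover_dim :: "'y topology \<Rightarrow> 'y set set \<Rightarrow> nat" where
  "cover_dim T \<alpha> = Inf {cover_ord T \<beta> | \<beta>. finite_open_cover T \<beta> \<and> refines \<beta> \<alpha>}"

definition pull_cover :: "'y topology \<Rightarrow> ('y \<Rightarrow> 'z) \<Rightarrow> 'z set set \<Rightarrow> 'y set set" where
  "pull_cover T g \<alpha> = (\<lambda>U. {x \<in> topspace T. g x \<in> U}) ` \<alpha>"

text \<open>The join \<open>\<Or>\<^sub>s\<^sub>\<in>\<^sub>S c s\<close>: all sets \<open>\<Inter>\<^sub>s\<^sub>\<in>\<^sub>S U\<^sub>s\<close> with \<open>U\<^sub>s \<in> c s\<close>.\<close>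

definition join_covers :: "'y topology \<Rightarrow> 's set \<Rightarrow> ('s \<Rightarrow> 'y set set) \<Rightarrow> 'y set set" where
  "join_covers T S c = (\<lambda>V. topspace T \<inter> (\<Inter>s\<in>S. V s)) ` (\<Pi>\<^sub>E s\<in>S. c s)"

definition total_space :: "'x ah_data \<Rightarrow> nat \<Rightarrow> (nat \<times> 'x) topology" where
  "total_space D i = sum_topology (base D i) {..<summands D i}"

definition component_covers :: "'x ah_data \<Rightarrow> nat \<Rightarrow> (nat \<times> 'x) set set set" where
  "component_covers D i =
     {\<alpha>. finite_open_cover (total_space D i) \<alpha> \<and>
         (\<forall>U\<in>\<alpha>. \<exists>C\<in>connected_components_of (total_space D i). U \<subseteq> C)}"

definition induced_cover :: "(nat \<times> 'x) set set \<Rightarrow> nat \<Rightarrow> 'x set set" where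
  "induced_cover \<alpha> l = {V. Pair l ` V \<in> \<alpha>}"

definition push_cover ::
  "'x ah_data \<Rightarrow> nat \<Rightarrow> nat \<Rightarrow> nat \<Rightarrow> (nat \<times> 'x) set set \<Rightarrow> 'x set set" where
  "push_cover D i j k \<alpha> =
     join_covers (base D j k) {(l, m). l < summands D i \<and> m < eigs D i j l k}
       (\<lambda>(l, m). pull_cover (base D j k) (eig D i j l k m) (induced_cover \<alpha> l))"

definition cover_ratio :: "'x ah_data \<Rightarrow> nat \<Rightarrow> (nat \<times> 'x) set set \<Rightarrow> nat \<Rightarrow> real" where
  "cover_ratio D i \<alpha> j =
     Max ((\<lambda>k. real (cover_dim (base D j k) (push_cover D i j k \<alpha>)) / real (rk D j k)) ` {..<summands D j})"

text \<open>
  \<open>has_mean_dimension D \<gamma>\<close> says that the iterated limit defining the mean dimension exists and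
  equals \<open>\<gamma>\<close>, which may be infinite.  Here \<open>c i \<alpha>\<close> is the limit over \<open>j\<close> for the cover \<open>\<alpha>\<close>,
  and \<open>g i\<close> is \<open>\<gamma>\<^sub>i\<close>.  The limits are stated relationally because \<^const>\<open>lim\<close> has an
  unspecified value on divergent sequences.
\<close>

definition has_mean_dimension :: "'x ah_data \<Rightarrow> ereal \<Rightarrow> bool" where
  "has_mean_dimension D \<gamma> \<longleftrightarrow>
     (\<exists>c g. (\<forall>i. \<forall>\<alpha>\<in>component_covers D i. cover_ratio D i \<alpha> \<longlonglongrightarrow> c i \<alpha>) \<and>
            (\<forall>i. g i = (SUP \<alpha>\<in>component_covers D i. ereal (c i \<alpha>))) \<and>
            g \<longlonglongrightarrow> \<gamma>)"

end

theory Submission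
  imports Defs
begin

text \<open>
  Why the theorem holds.  The projections \<open>p\<close> and \<open>q\<close> are approximated by self-adjoint elements
  \<open>a\<close> and \<open>b\<close> of one stage of the inductive system.  At a later stage \<open>j\<close> the images of \<open>a\<close> and
  \<open>b\<close> are matrix valued functions on the base spaces, and they are projections up to a small error.
  Three facts are combined there.

  \<^item> The gap between the traces is uniform.  If at points of arbitrarily late base spaces the
    normalized traces of \<open>a\<close> and \<open>b\<close> were not separated, these normalized traces would accumulate,
    by Tychonoff's theorem, at a tracial state \<open>\<tau>\<close> with \<open>\<tau>(p) \<le> \<tau>(q)\<close>.  So there is
    \<open>\<eta> > 0\<close> such that \<open>tr a - tr b \<ge> \<eta> * rk\<close> at every point of every late stage (\<open>trace_gap\<close>).

  \<^item> The functions essentially live on a space of small dimension.  After conjugation with a unitary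
    the connecting map only composes with the eigenvalue maps.  Therefore the images of \<open>a\<close> and
    \<open>b\<close> vary little on each member of the cover pushed forward from a fine cover \<open>\<alpha>\<close>.  Mean
    dimension zero provides a refinement in which every point lies in at most \<open>d + 1\<close> members,
    where \<open>d \<le> (\<eta> / 4) * rk\<close>.  A partition of unity subordinate to it replaces the two functions
    by projections \<open>E\<close> and \<open>F\<close> that are Lipschitz functions of the barycentric coordinates
    (\<open>nerve_projection\<close>), that is, which factor through the nerve, a complex of dimension \<open>d\<close>.

  \<^item> Over a space of dimension \<open>d\<close>, a projection whose rank exceeds that of \<open>F\<close> by more than half of
    \<open>d\<close> contains a copy of \<open>F\<close>.  Instead of obstruction theory the proof uses one constant matrix
    \<open>M\<close> such that \<open>E(x) * M\<close> is injective on the range of \<open>F(x)\<close> for all \<open>x\<close>.  The matrices for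
    which this fails at some point form a set of too small a dimension: a unit vector in the range of
    \<open>F(x)\<close> costs \<open>2 rk F\<close> real parameters, the point \<open>x\<close> costs \<open>d\<close>, and that \<open>E(x)\<close> kills
    the image is a condition of codimension \<open>2 rk E\<close>.  This dimension count is carried out as a
    count of matrices with entries in a finite grid (\<open>card_bad_set_le\<close>, \<open>general_position\<close>).

  For such \<open>M\<close> the function \<open>E M F\<close>, suitably scaled, is not yet a partial isometry, but the
  Newton-Schulz iteration \<open>w \<mapsto> (3 w - w w\<^sup>* w) / 2\<close> turns it into a continuous function \<open>V\<close> for which
  \<open>V\<^sup>* V\<close> is close to \<open>F\<close> and \<open>E V = V\<close> (\<open>comparison_over_cover\<close>).  Its image \<open>w\<close> in the limit
  algebra satisfies \<open>\<parallel>q - q w\<^sup>* p w q\<parallel> < 1\<close>, and running the same iteration on \<open>p w q\<close> in the limit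
  algebra gives an exact partial isometry from \<open>q\<close> into \<open>p\<close> (\<open>subequivalent_if_almost\<close>).
\<close>

section \<open>Functional calculus by iteration in C*-algebras\<close>

lemma star_zero [simp]: "star (0::'a::unital_cstar_algebra) = 0"
  using star_add[of "0::'a" 0] by simp

lemma star_minus: "star (- x) = - star (x::'a::unital_cstar_algebra)"
  using star_add[of x "- x"] by (simp add: add_eq_0_iff2)

lemma star_diff: "star (x - y) = star x - star (y::'a::unital_cstar_algebra)"
  using star_add[of x "- y"] by (simp add: star_minus)

lemma star_scaleR: "star (r *\<^sub>R x) = r *\<^sub>R star (x::'a::unital_cstar_algebra)"
  using star_scaleC[of "complex_of_real r" x] by (simp add: scaleC_of_real)

lemma star_one [simp]: "star (1::'a::unital_cstar_algebra) = 1"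
  using star_mult[of "star (1::'a)" 1] by (simp add: star_star)

lemma scaleC_minus_one: "scaleC (-1) x = - (x::'a::unital_cstar_algebra)"
  using scaleC_of_real[of "-1" x] by simp

lemma norm_star [simp]: "norm (star x) = norm (x::'a::unital_cstar_algebra)"
proof -
  have *: "norm y \<le> norm (star y)" for y :: 'a
  proof (cases "y = 0")
    case False
    have "norm y * norm y \<le> norm (star y) * norm y"
      using norm_mult_ineq[of "star y" y] cstar_identity[of y] by (simp add: power2_eq_square)
    with False show ?thesis by simp
  qed simp
  show ?thesis using *[of x] *[of "star x"] by (simp add: star_star)
qed

lemma bounded_linear_star: "bounded_linear (star :: 'a::unital_cstar_algebra \<Rightarrow> 'a)"
  by (rule bounded_linear_intro[where K = 1]) (auto simp: star_add star_scaleR)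

lemmas tendsto_star [tendsto_intros] = bounded_linear.tendsto[OF bounded_linear_star]

lemma norm_self_adjoint_square:
  "star x = x \<Longrightarrow> norm (x * x) = (norm (x::'a::unital_cstar_algebra))\<^sup>2"
  using cstar_identity[of x] by simp

lemma is_projectionD:
  assumes "is_projection p" shows "p * p = p" "star p = p"
  using assms by (auto simp: is_projection_def)

lemma is_projection_compl: "is_projection p \<Longrightarrow> is_projection (1 - p)"
  by (simp add: is_projection_def algebra_simps star_diff)

lemma norm_projection_le: "is_projection p \<Longrightarrow> norm p \<le> 1"
  using norm_self_adjoint_square[of p]
  by (cases "norm p = 0") (auto simp: is_projection_def power2_eq_square)

lemma numeral_mult:
  fixes x :: "'a::ring_1"
  shows "2 * x = x + x" "x * 2 = x + x" "3 * x = x + x + x" "x * 3 = x + x + x"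
    "4 * x = x + x + x + x" "x * 4 = x + x + x + x"
proof -
  have n: "(3::'a) = 1 + 1 + 1" "(4::'a) = 1 + 1 + 1 + 1" by simp_all
  show "2 * x = x + x" "x * 2 = x + x" by (simp_all add: mult_2 mult_2_right)
  show "3 * x = x + x + x" "x * 3 = x + x + x" "4 * x = x + x + x + x" "x * 4 = x + x + x + x"
    unfolding n distrib_left distrib_right by simp_all
qed

lemma norm_mult3_le:
  fixes x y z :: "'a::real_normed_algebra"
  shows "norm (x * y * z) \<le> norm x * norm y * norm z"
  by (meson mult_right_mono norm_ge_zero norm_mult_ineq order_trans)

subsection \<open>The polar part of an almost partial isometry\<close>

text \<open>
  The Newton-Schulz step \<open>w \<mapsto> (3 w - w w\<^sup>* w) / 2\<close> of the iteration for the polar part of \<open>w\<close>.  It is a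
  polynomial in \<open>w\<close> and \<open>w\<^sup>*\<close>, so that it preserves continuity of functions and needs no functional calculus.
\<close>

definition ns_step :: "'a::unital_cstar_algebra \<Rightarrow> 'a" where
  "ns_step w = w + (1/2) *\<^sub>R (w - w * (star w * w))"

text \<open>
  With \<open>d = f - w\<^sup>* w\<close> one has \<open>ns_step w = w (1 + d / 2)\<close>, and everything happens in the commutative
  algebra generated by \<open>f\<close> and \<open>d\<close>: the new defect is \<open>f - (f - d) (f + d / 2)\<^sup>2 = (3 d\<^sup>2 + d\<^sup>3) / 4\<close>.
  So a defect of norm at most 1 is squared by each step.
\<close>

lemma ns_step:
  fixes f w :: "'a::unital_cstar_algebra"
  assumes f: "is_projection f" and wf: "w * f = w"
  defines "d \<equiv> f - star w * w"
  shows "ns_step w * f = ns_step w"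
    and "ns_step w = w + (1/2) *\<^sub>R (w * d)"
    and "f - star (ns_step w) * ns_step w = (1/4) *\<^sub>R (d * d * (3 + d))"
proof -
  note ff = is_projectionD[OF f]
  have wf': "f * star w = star w" using wf star_mult[of w f] ff(2) by simp
  show "ns_step w * f = ns_step w"
    by (simp add: ns_step_def algebra_simps wf mult.assoc)
  show eq: "ns_step w = w + (1/2) *\<^sub>R (w * d)"
    by (simp add: ns_step_def d_def algebra_simps wf)
  have N: "star w * w = f - d" by (simp add: d_def)
  have fd: "f * d = d" "d * f = d"
    by (simp_all add: d_def algebra_simps ff wf wf' mult.assoc) (simp add: mult.assoc[symmetric] wf')
  have sd: "star d = d" by (simp add: d_def star_diff star_mult star_star ff)
  have N': "star w * (w * z) = f * z - d * z" for z
    by (simp add: mult.assoc[symmetric] N left_diff_distrib)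
  have "star (ns_step w) * ns_step w =
      (f - d) + (1/2) *\<^sub>R (d - d * d) + ((1/2) *\<^sub>R (d - d * d) + (1/4) *\<^sub>R (d * d - d * (d * d)))"
    unfolding eq by (simp add: star_add star_scaleR star_mult sd distrib_left distrib_right N N' fd mult.assoc
        right_diff_distrib left_diff_distrib scaleR_right_diff_distrib scaleR_add_right)
  also have "\<dots> = f - (1/4) *\<^sub>R (d * d * (3 + d))"
  proof -
    have h: "(1/2) *\<^sub>R (d - d * d) + (1/2) *\<^sub>R (d - d * d) = d - d * d"
      by (metis field_sum_of_halves scaleR_add_left scaleR_one)
    have three: "d * d * (3 + d) = 4 *\<^sub>R (d * d) - (d * d - d * (d * d))"
    proof -
      have "4 *\<^sub>R x = x + x + x + x" for x :: 'a
        using scaleR_left_distrib[of 2 2 x] scaleR_left_distrib[of 1 1 x] by (simp add: add.assoc)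
      then show ?thesis by (simp add: numeral_mult distrib_left mult.assoc)
    qed
    show ?thesis
      unfolding three scaleR_right_diff_distrib using h by (simp add: algebra_simps)
  qed
  finally show "f - star (ns_step w) * ns_step w = (1/4) *\<^sub>R (d * d * (3 + d))" by simp
qed

lemma norm_square_le:
  fixes f w :: "'a::unital_cstar_algebra"
  assumes f: "is_projection f" and "norm (f - star w * w) \<le> 1"
  shows "norm w \<le> 2"
proof -
  have "(norm w)\<^sup>2 = norm (f - (f - star w * w))" by (simp add: cstar_identity)
  also have "\<dots> \<le> 2" using norm_triangle_ineq4[of f "f - star w * w"] norm_projection_le[OF f] assms(2) by linarith
  finally have "(norm w)\<^sup>2 \<le> 2\<^sup>2" by simp
  then show ?thesis by (rule power2_le_imp_le) simp
qed

lemma ns_iterate: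
  fixes f w :: "'a::unital_cstar_algebra"
  assumes f: "is_projection f" and wf: "w * f = w" and k: "norm (f - star w * w) \<le> k" "k \<le> 1"
  defines "v \<equiv> \<lambda>n. (ns_step ^^ n) w"
  shows "v n * f = v n" "norm (f - star (v n) * v n) \<le> k ^ (2 ^ n)" "p * w = w \<Longrightarrow> p * v n = v n"
proof -
  have k0: "0 \<le> k" using k(1) norm_ge_zero order_trans by blast
  have "v n * f = v n \<and> norm (f - star (v n) * v n) \<le> k ^ (2 ^ n)"
  proof (induction n)
    case 0 then show ?case using wf k by (simp add: v_def)
  next
    case (Suc n)
    define d where "d = f - star (v n) * v n"
    have vS: "v (Suc n) = ns_step (v n)" by (simp add: v_def)
    note S = ns_step[OF f conjunct1[OF Suc], folded d_def]
    have d: "norm d \<le> k ^ 2 ^ n" "norm d \<le> 1" using Suc k k0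
      by (auto simp: d_def) (meson power_le_one order_trans)
    have "norm ((1/4) *\<^sub>R (d * d * (3 + d))) \<le> 1/4 * (norm d * norm d * norm (3 + d))"
      using norm_mult3_le[of d d "3 + d"] by simp
    also have "\<dots> \<le> 1/4 * (norm d * norm d * 4)"
      using norm_triangle_ineq[of 3 d] d by (intro mult_left_mono) auto
    also have "\<dots> \<le> k ^ 2 ^ n * k ^ 2 ^ n" using d k0 by (simp add: mult_mono)
    also have "\<dots> = k ^ 2 ^ Suc n" by (simp add: power_add[symmetric] mult_2)
    finally show ?case unfolding vS using S(1,3) by simp
  qed
  then show "v n * f = v n" "norm (f - star (v n) * v n) \<le> k ^ (2 ^ n)" by auto
  assume "p * w = w"
  then show "p * v n = v n"
    by (induction n) (auto simp: v_def ns_step_def distrib_left right_diff_distrib mult.assoc[symmetric])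
qed

text \<open>
  For \<open>u = p w q\<close> the hypothesis says that the defect \<open>q - u\<^sup>* u\<close> has norm \<open>k < 1\<close>.  The iteration started
  at \<open>u\<close> moves by at most \<open>k\<^sup>n\<close> in its \<open>n\<close>-th step, and its limit \<open>V\<close> has defect zero.
\<close>

lemma subequivalent_if_almost:
  fixes p q w :: "'a::unital_cstar_algebra"
  assumes p: "is_projection p" and q: "is_projection q"
    and w: "norm (q - q * star w * p * w * q) < 1"
  shows "\<exists>e. subprojection e p \<and> mvn_equivalent q e"
proof -
  note pq = is_projectionD[OF p] is_projectionD[OF q]
  define u where "u = p * w * q"
  define k where "k = norm (q - star u * u)"
  have "star u * u = q * star w * p * w * q"
    using pq by (metis (no_types) u_def star_mult mult.assoc)
  with w have k: "k < 1" "0 \<le> k" by (auto simp: k_def)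
  have uq: "u * q = u" and pu: "p * u = u" using pq by (metis u_def mult.assoc)+
  define v where "v n = (ns_step ^^ n) u" for n
  have it: "v n * q = v n" "norm (q - star (v n) * v n) \<le> k ^ (2 ^ n)" "p * v n = v n" for n
    using ns_iterate[OF q uq, where k = k and n = n] k pu by (auto simp: v_def k_def)
  have small: "norm (q - star (v n) * v n) \<le> k ^ n" for n
    by (rule order_trans[OF it(2)]) (use k in \<open>simp add: power_decreasing less_imp_le\<close>)
  have step: "norm (v (Suc n) - v n) \<le> k ^ n" for n
  proof -
    have "v (Suc n) - v n = (1/2) *\<^sub>R (v n * (q - star (v n) * v n))"
      using ns_step(2)[OF q it(1)[of n]] by (simp add: v_def)
    moreover have "norm (v n) \<le> 2"
      by (rule norm_square_le[OF q]) (use small[of n] k in \<open>meson power_le_one less_imp_le order_trans\<close>)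
    moreover have "norm (v n * (q - star (v n) * v n)) \<le> 2 * norm (q - star (v n) * v n)"
      by (rule order_trans[OF norm_mult_ineq]) (use \<open>norm (v n) \<le> 2\<close> in \<open>simp add: mult_right_mono\<close>)
    ultimately have "norm (v (Suc n) - v n) \<le> 1/2 * (2 * norm (q - star (v n) * v n))" by simp
    then show ?thesis using small[of n] by simp
  qed
  have "summable (\<lambda>n. v (Suc n) - v n)"
    by (rule summable_comparison_test[OF _ summable_geometric[of k]]) (use step k in auto)
  from summable_LIMSEQ[OF this] obtain S where "(\<lambda>n. v n - v 0) \<longlonglongrightarrow> S"
    by (auto simp: sum_lessThan_telescope)
  from tendsto_add[OF this tendsto_const[of "v 0"]] obtain V where V: "v \<longlonglongrightarrow> V" by auto
  have "(\<lambda>n. q - star (v n) * v n) \<longlonglongrightarrow> q - star V * V" by (intro tendsto_intros V)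
  moreover have "(\<lambda>n. q - star (v n) * v n) \<longlonglongrightarrow> 0"
    by (rule Lim_null_comparison[OF _ LIMSEQ_realpow_zero[of k]]) (use small k in auto)
  ultimately have VV: "star V * V = q" using LIMSEQ_unique by fastforce
  have Vq: "V * q = V"
    using LIMSEQ_unique[OF _ V, of "V * q"] tendsto_mult_right[OF V, of q] it(1) by simp
  have pV: "p * V = V"
    using LIMSEQ_unique[OF _ V, of "p * V"] tendsto_mult_left[OF V, of p] it(3) by simp
  have "is_projection (V * star V)"
    unfolding is_projection_def by (simp add: star_mult star_star) (metis VV Vq mult.assoc)
  moreover have "p * (V * star V) = V * star V" by (simp add: mult.assoc[symmetric] pV)
  ultimately show ?thesis unfolding subprojection_def mvn_equivalent_def using p VV by blast
qed

subsection \<open>Spectral projections\<close>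

text \<open>
  The projection is the limit of \<open>s \<mapsto> 3 s\<^sup>2 - 2 s\<^sup>3\<close>, which has 0 and 1 as superattracting fixed points:
  the defect \<open>D = s - s\<^sup>2\<close> becomes \<open>D\<^sup>2 (3 + 4 D)\<close>.  The bound \<open>1/16\<close> makes each step shrink the defect
  at least by the factor 4.  As a limit of polynomials in \<open>h\<close> without constant term, the projection
  commutes with \<open>h\<close> and has every left unit of \<open>h\<close> as a left unit.
\<close>

lemma spectral_projection:
  fixes h :: "'a::unital_cstar_algebra"
  assumes h: "star h = h" and d: "norm (h - h * h) \<le> 1/16"
  shows "\<exists>e. is_projection e \<and> e * h = h * e \<and> norm (e - h) \<le> 3 * norm (h - h * h) \<and>
             (\<forall>c. c * h = h \<longrightarrow> c * e = e)"
proof -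
  define g where "g s = s + (s - s * s) * (2 * s - 1)" for s :: 'a
  define s where "s n = (g ^^ n) h" for n
  define D where "D n = s n - s n * s n" for n
  let ?d = "norm (h - h * h)"
  have sS: "s (Suc n) = s n + D n * (2 * s n - 1)" for n by (simp add: s_def g_def D_def)
  have s0: "s 0 = h" by (simp add: s_def)
  have two: "2 * x = x + x" "x * 2 = x + x" for x :: 'a by (simp_all add: mult_2 mult_2_right)
  have DS: "D (Suc n) = D n * D n * (3 + 4 * D n)" for n
  proof -
    define t where "t = s n + s n - 1"
    have t2: "2 * s n - 1 = t" by (simp add: t_def two)
    have c: "D n * s n = s n * D n" by (simp add: D_def left_diff_distrib right_diff_distrib mult.assoc)
    have tt: "t * t = 1 - 4 * D n" by (simp add: t_def D_def numeral_mult left_diff_distrib right_diff_distrib distrib_left distrib_right)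
    have sq: "s n * s n = s n - D n" by (simp add: D_def)
    have tD: "t * (D n * z) = D n * (t * z)" for z
      using c by (simp add: t_def left_diff_distrib right_diff_distrib distrib_left distrib_right mult.assoc[symmetric])
    have st: "s n * (D n * t) + D n * (t * s n) = D n * t + D n * (t * t)"
    proof -
      have "s n * (D n * t) + D n * (t * s n) = D n * (s n * t + t * s n)"
        using c by (simp add: mult.assoc[symmetric] distrib_left)
      also have "s n * t + t * s n = t + t * t"
        by (simp add: t_def left_diff_distrib right_diff_distrib distrib_left distrib_right)
      finally show ?thesis by (simp add: distrib_left)
    qed
    have "D (Suc n) = (s n - s n * s n) + D n * t - (s n * (D n * t) + D n * (t * s n)) - D n * (D n * (t * t))"
      unfolding D_def[of "Suc n"] sS t2
      by (simp add: left_diff_distrib right_diff_distrib distrib_left distrib_right tD mult.assoc)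
    also have "\<dots> = D n - D n * (t * t) - D n * (D n * (t * t))" unfolding st D_def[symmetric] by simp
    also have "\<dots> = D n * D n * (3 + 4 * D n)"
      unfolding tt numeral_mult by (simp add: left_diff_distrib right_diff_distrib distrib_left distrib_right mult.assoc numeral_mult)
    finally show ?thesis .
  qed
  have Dle: "norm (D n) \<le> ?d / 4 ^ n" for n
  proof (induction n)
    case (Suc n)
    have n1: "norm (D n) \<le> 1/16"
      using Suc d by (smt (verit) divide_le_eq_1_pos frac_le norm_ge_zero one_le_power zero_less_power div_by_1)
    have "norm (D (Suc n)) \<le> norm (D n) * norm (D n) * norm (3 + 4 * D n)"
      unfolding DS by (rule norm_mult3_le)
    also have "\<dots> \<le> norm (D n) * norm (D n) * 4"
    proof (intro mult_left_mono)
      have "norm (4 * D n) \<le> 4 * norm (D n)" using norm_mult_ineq[of 4 "D n"] by simp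
      then show "norm (3 + 4 * D n) \<le> 4" using norm_triangle_ineq[of 3 "4 * D n"] n1 by simp
    qed auto
    also have "\<dots> \<le> norm (D n) * (1/16) * 4" using n1 by (intro mult_mono) auto
    also have "\<dots> \<le> ?d / 4 ^ Suc n" using Suc by simp
    finally show ?case .
  qed (simp add: D_def s0)
  have ss: "star (s n) = s n" for n
  proof (induction n)
    case (Suc n)
    have "star (D n) = D n" by (simp add: D_def star_diff star_mult Suc)
    moreover have "D n * s n = s n * D n" by (simp add: D_def algebra_simps)
    ultimately show ?case unfolding sS two by (simp add: star_add star_diff star_mult Suc algebra_simps)
  qed (simp add: s0 h)
  have step: "norm (s (Suc n) - s n) \<le> 2 * ?d * (1/4) ^ n" for n
  proof -
    have Dn: "norm (D n) \<le> 1/4"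
      using Dle[of n] d by (smt (verit) divide_le_eq_1_pos frac_le norm_ge_zero one_le_power zero_less_power div_by_1)
    have "(norm (2 * s n - 1))\<^sup>2 = norm ((2 * s n - 1) * (2 * s n - 1))"
      by (rule norm_self_adjoint_square[symmetric]) (simp add: two star_diff star_add ss)
    also have "(2 * s n - 1) * (2 * s n - 1) = 1 - 4 * D n"
      unfolding D_def numeral_mult by (simp add: left_diff_distrib right_diff_distrib distrib_left distrib_right)
    also have "norm \<dots> \<le> 1 + 4 * norm (D n)"
      using norm_triangle_ineq4[of 1 "4 * D n"] norm_mult_ineq[of 4 "D n"] by simp
    also have "\<dots> \<le> 2\<^sup>2" using Dn by simp
    finally have "norm (2 * s n - 1) \<le> 2" by (rule power2_le_imp_le) simp
    then have "norm (D n * (2 * s n - 1)) \<le> norm (D n) * 2"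
      by (meson mult_left_mono norm_ge_zero norm_mult_ineq order_trans)
    also have "\<dots> \<le> 2 * ?d * (1/4) ^ n" using Dle[of n] by (simp add: power_one_over divide_simps)
    finally show ?thesis by (simp add: sS)
  qed
  have sm: "summable (\<lambda>n. 2 * ?d * (1/4::real) ^ n)" by (intro summable_mult summable_geometric) simp
  have sn: "summable (\<lambda>n. norm (s (Suc n) - s n))"
    by (rule summable_comparison_test[OF _ sm]) (use step in auto)
  then have ss1: "summable (\<lambda>n. s (Suc n) - s n)" by (rule summable_norm_cancel)
  define e where "e = h + (\<Sum>n. s (Suc n) - s n)"
  have "(\<lambda>n. \<Sum>k<n. s (Suc k) - s k) \<longlonglongrightarrow> e - h" using summable_LIMSEQ[OF ss1] by (simp add: e_def)
  then have "(\<lambda>n. s n - h) \<longlonglongrightarrow> e - h" by (simp add: sum_lessThan_telescope s0)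
  from tendsto_add[OF this tendsto_const[of h]] have se: "s \<longlonglongrightarrow> e" by simp
  have "(\<lambda>n. norm (D n)) \<longlonglongrightarrow> 0"
  proof (rule Lim_null_comparison)
    show "(\<lambda>n. ?d * (1/4) ^ n) \<longlonglongrightarrow> 0" by (intro tendsto_mult_right_zero LIMSEQ_realpow_zero) auto
    show "\<forall>\<^sub>F n in sequentially. norm (norm (D n)) \<le> ?d * (1/4) ^ n"
      using Dle by (simp add: power_one_over)
  qed
  then have "D \<longlonglongrightarrow> 0" by (rule tendsto_norm_zero_cancel)
  moreover have "D \<longlonglongrightarrow> e - e * e" unfolding D_def by (intro tendsto_intros se)
  ultimately have "e - e * e = 0" using LIMSEQ_unique by blast
  moreover have "s \<longlonglongrightarrow> star e" using tendsto_star[OF se] ss by simp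
  then have "star e = e" using LIMSEQ_unique se by blast
  ultimately have pe: "is_projection e" by (simp add: is_projection_def)
  have "s n * h = h * s n" for n
  proof (induction n)
    case (Suc n)
    have "s n * s n * h = h * (s n * s n)" by (metis Suc mult.assoc)
    then have Dh: "D n * h = h * D n" by (simp add: D_def left_diff_distrib right_diff_distrib Suc)
    then have "D n * s n * h = h * (D n * s n)" by (metis Suc mult.assoc)
    with Dh Suc show ?case unfolding sS two
      by (simp only: distrib_left distrib_right left_diff_distrib right_diff_distrib mult_1_right)
  qed (simp add: s0)
  then have comm: "e * h = h * e"
    using LIMSEQ_unique[OF tendsto_mult_left[OF se, of h]] tendsto_mult_right[OF se, of h] by simp
  have "norm (e - h) \<le> (\<Sum>n. norm (s (Suc n) - s n))" unfolding e_def using summable_norm[OF sn] by simp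
  also have "\<dots> \<le> (\<Sum>n. 2 * ?d * (1/4) ^ n)" by (rule suminf_le[OF _ sn sm]) (rule step)
  also have "\<dots> = 2 * ?d * (4/3)" by (subst suminf_mult) (auto simp: suminf_geometric summable_geometric)
  also have "\<dots> \<le> 3 * ?d" by simp
  finally have dist: "norm (e - h) \<le> 3 * ?d" .
  have "c * e = e" if c: "c * h = h" for c
  proof -
    have "c * s n = s n" for n
      by (induction n) (auto simp: s0 c sS D_def distrib_left right_diff_distrib mult.assoc[symmetric])
    then show ?thesis using LIMSEQ_unique[OF tendsto_mult_left[OF se, of c]] se by simp
  qed
  with pe comm dist show ?thesis by blast
qed

text \<open>
  The corner \<open>e (h - h') (1 - e')\<close> controls \<open>z = e (1 - e')\<close>, since \<open>h\<close> is close to 1 on the range of \<open>e\<close>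
  and \<open>h'\<close> is close to 0 on the kernel of \<open>e'\<close>.
\<close>

lemma spectral_projection_half:
  fixes e e' h h' :: "'a::unital_cstar_algebra"
  assumes e: "is_projection e" "e * h = h * e" "norm (e - h) \<le> 1/4"
    and e': "is_projection e'" "e' * h' = h' * e'" "norm (e' - h') \<le> 1/4"
  shows "norm (e * (1 - e')) \<le> 2 * norm (h - h')"
proof -
  define z where "z = e * (1 - e')"
  have ez: "e * z = z" and ze: "z * e' = 0"
    using e(1) e'(1) by (simp_all add: z_def is_projection_def mult.assoc[symmetric] algebra_simps)
  have "e * (h - h') * (1 - e') = h * z - z * h'"
    using e(2) e'(2) by (simp add: z_def algebra_simps mult.assoc)
  also have "\<dots> = z - (e - h) * z - z * (h' - e')" using ez ze by (simp add: algebra_simps)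
  finally have "z = e * (h - h') * (1 - e') + (e - h) * z + z * (h' - e')" by simp
  then have "norm z \<le> norm (e * (h - h') * (1 - e')) + norm ((e - h) * z) + norm (z * (h' - e'))"
    by (metis norm_triangle_ineq norm_triangle_mono order_refl)
  moreover have "norm (e * (h - h') * (1 - e')) \<le> 1 * norm (h - h') * 1"
    by (rule order_trans[OF norm_mult3_le])
       (use norm_projection_le[OF e(1)] norm_projection_le[OF is_projection_compl[OF e'(1)]] in
         \<open>intro mult_mono; simp\<close>)
  moreover have "norm ((e - h) * z) \<le> 1/4 * norm z"
    by (rule order_trans[OF norm_mult_ineq]) (use e(3) in \<open>intro mult_mono; simp\<close>)
  moreover have "norm (z * (h' - e')) \<le> norm z * (1/4)"
    by (rule order_trans[OF norm_mult_ineq]) (use e'(3) in \<open>intro mult_mono; simp add: norm_minus_commute\<close>)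
  ultimately show ?thesis unfolding z_def by linarith
qed

lemma spectral_projection_lipschitz:
  fixes e e' h h' :: "'a::unital_cstar_algebra"
  assumes e: "is_projection e" "e * h = h * e" "norm (e - h) \<le> 1/4"
    and e': "is_projection e'" "e' * h' = h' * e'" "norm (e' - h') \<le> 1/4"
  shows "norm (e - e') \<le> 4 * norm (h - h')"
proof -
  have "e - e' = e * (1 - e') - star (e' * (1 - e))"
    using is_projectionD[OF e(1)] is_projectionD[OF e'(1)] by (simp add: star_mult star_diff algebra_simps)
  then have "norm (e - e') \<le> norm (e * (1 - e')) + norm (e' * (1 - e))"
    by (metis norm_triangle_ineq4 norm_star)
  with spectral_projection_half[OF e e'] spectral_projection_half[OF e' e]
  show ?thesis by (simp add: norm_minus_commute)
qed

section \<open>The operator norm of complex matrices\<close>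

lemma cvec_norm_L2: "cvec_norm v = L2_set (\<lambda>i. cmod (v $ i)) {..<dim_vec v}"
proof -
  have "v \<bullet>c v = of_real (\<Sum>i<dim_vec v. (cmod (v $ i))\<^sup>2)"
    by (auto simp: scalar_prod_def complex_norm_square[symmetric] lessThan_atLeast0 intro!: sum.cong)
  then show ?thesis by (simp add: cvec_norm_def L2_set_def)
qed

lemma cscalar_prod_self: "v \<bullet>c v = of_real ((cvec_norm v)\<^sup>2)"
proof -
  have "v \<bullet>c v = of_real (\<Sum>i<dim_vec v. (cmod (v $ i))\<^sup>2)"
    by (auto simp: scalar_prod_def complex_norm_square[symmetric] lessThan_atLeast0 intro!: sum.cong)
  then show ?thesis by (simp add: cvec_norm_def sum_nonneg)
qed

lemma cvec_norm_nonneg [simp]: "0 \<le> cvec_norm v"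
  by (simp add: cvec_norm_L2)

lemma cvec_norm_zero [simp]: "cvec_norm (0\<^sub>v n) = 0"
  by (simp add: cvec_norm_L2 L2_set_def)

lemma cvec_norm_smult: "cvec_norm (c \<cdot>\<^sub>v v) = cmod c * cvec_norm v"
proof -
  have "L2_set (\<lambda>i. cmod ((c \<cdot>\<^sub>v v) $ i)) {..<dim_vec v} = L2_set (\<lambda>i. cmod c * cmod (v $ i)) {..<dim_vec v}"
    by (rule L2_set_cong) (auto simp: norm_mult)
  then show ?thesis by (simp add: cvec_norm_L2 L2_set_right_distrib)
qed

lemma cvec_norm_triangle:
  assumes "v \<in> carrier_vec n" "w \<in> carrier_vec n"
  shows "cvec_norm (v + w) \<le> cvec_norm v + cvec_norm w"
proof -
  have "L2_set (\<lambda>i. cmod ((v + w) $ i)) {..<n} \<le> L2_set (\<lambda>i. cmod (v $ i) + cmod (w $ i)) {..<n}"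
    by (rule L2_set_mono) (use assms in \<open>auto intro: norm_triangle_ineq\<close>)
  also have "\<dots> \<le> L2_set (\<lambda>i. cmod (v $ i)) {..<n} + L2_set (\<lambda>i. cmod (w $ i)) {..<n}"
    by (rule L2_set_triangle_ineq)
  finally show ?thesis using assms by (simp add: cvec_norm_L2)
qed

lemma cvec_norm_triangle_minus:
  assumes "v \<in> carrier_vec n" "w \<in> carrier_vec n"
  shows "cvec_norm (v - w) \<le> cvec_norm v + cvec_norm w"
proof -
  have "v - w = v + (-1) \<cdot>\<^sub>v w" using assms by auto
  moreover have "cvec_norm ((-1) \<cdot>\<^sub>v w) = cvec_norm w" by (simp add: cvec_norm_smult)
  ultimately show ?thesis using cvec_norm_triangle[of v n "(-1) \<cdot>\<^sub>v w"] assms by simp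
qed

lemma cmod_index_le_cvec_norm: "i < dim_vec v \<Longrightarrow> cmod (v $ i) \<le> cvec_norm v"
  unfolding cvec_norm_L2 by (rule member_le_L2_set[of _ _ "\<lambda>i. cmod (v $ i)"]) auto

lemma cvec_norm_le_sum: "cvec_norm v \<le> (\<Sum>i<dim_vec v. cmod (v $ i))"
  by (simp add: cvec_norm_L2 L2_set_le_sum)

lemma cvec_norm_eq_0: "v \<in> carrier_vec n \<Longrightarrow> cvec_norm v = 0 \<Longrightarrow> v = 0\<^sub>v n"
  using cmod_index_le_cvec_norm[of _ v] by (intro eq_vecI) auto

lemma cauchy_schwarz_cvec:
  assumes "v \<in> carrier_vec n" "w \<in> carrier_vec n"
  shows "cmod (v \<bullet>c w) \<le> cvec_norm v * cvec_norm w"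
proof -
  have "cmod (v \<bullet>c w) \<le> (\<Sum>i<n. cmod (v $ i) * cmod (w $ i))"
    using assms by (auto simp: scalar_prod_def lessThan_atLeast0 norm_mult intro!: order_trans[OF norm_sum] sum_mono)
  also have "\<dots> \<le> L2_set (\<lambda>i. cmod (v $ i)) {..<n} * L2_set (\<lambda>i. cmod (w $ i)) {..<n}"
    using L2_set_mult_ineq[of "\<lambda>i. cmod (v $ i)" "\<lambda>i. cmod (w $ i)" "{..<n}"] by simp
  finally show ?thesis using assms by (simp add: cvec_norm_L2)
qed

lemma mult_mat_vec_index:
  "A \<in> carrier_mat n m \<Longrightarrow> v \<in> carrier_vec m \<Longrightarrow> i < n \<Longrightarrow> (A *\<^sub>v v) $ i = (\<Sum>j<m. A $$ (i, j) * v $ j)"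
  by (auto simp: scalar_prod_def lessThan_atLeast0 intro!: sum.cong)

lemma mult_mat_index:
  "A \<in> carrier_mat n m \<Longrightarrow> B \<in> carrier_mat m k \<Longrightarrow> i < n \<Longrightarrow> j < k \<Longrightarrow>
   (A * B) $$ (i, j) = (\<Sum>l<m. A $$ (i, l) * B $$ (l, j))"
  by (auto simp: scalar_prod_def lessThan_atLeast0 intro!: sum.cong)

lemma mat_adjoint_carrier [simp]:
  "A \<in> carrier_mat n m \<Longrightarrow> mat_adjoint A \<in> carrier_mat m n"
  by (auto simp: mat_adjoint_def mat_of_rows_def)

lemma mat_adjoint_index [simp]:
  "i < dim_col A \<Longrightarrow> j < dim_row A \<Longrightarrow> mat_adjoint A $$ (i, j) = cnj (A $$ (j, i))" for A :: "complex mat"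
  by (auto simp: mat_adjoint_def mat_of_rows_def)

lemma mat_adjoint_dim [simp]:
  "dim_row (mat_adjoint A) = dim_col A" "dim_col (mat_adjoint A) = dim_row A"
  by (auto simp: mat_adjoint_def mat_of_rows_def)

lemma mat_adjoint_mat_adjoint [simp]: "mat_adjoint (mat_adjoint A) = A" for A :: "complex mat"
  by (intro eq_matI) auto

lemma mat_adjoint_mult_mat:
  fixes A B :: "complex mat"
  assumes "A \<in> carrier_mat n m" "B \<in> carrier_mat m k"
  shows "mat_adjoint (A * B) = mat_adjoint B * mat_adjoint A"
proof (rule eq_matI)
  fix i j assume *: "i < dim_row (mat_adjoint B * mat_adjoint A)" "j < dim_col (mat_adjoint B * mat_adjoint A)"
  then have ij: "i < k" "j < n" using assms by auto
  have "(mat_adjoint B * mat_adjoint A) $$ (i, j) = (\<Sum>l<m. mat_adjoint B $$ (i, l) * mat_adjoint A $$ (l, j))"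
    by (rule mult_mat_index) (use assms ij in auto)
  also have "\<dots> = (\<Sum>l<m. cnj (A $$ (j, l) * B $$ (l, i)))"
    using assms ij by (intro sum.cong) auto
  also have "\<dots> = mat_adjoint (A * B) $$ (i, j)"
    using assms ij mult_mat_index[OF assms ij(2,1)] by simp
  finally show "mat_adjoint (A * B) $$ (i, j) = (mat_adjoint B * mat_adjoint A) $$ (i, j)" by simp
qed (use assms in auto)

lemma cscalar_prod_adjoint:
  fixes A :: "complex mat"
  assumes "A \<in> carrier_mat n m" "v \<in> carrier_vec m" "w \<in> carrier_vec n"
  shows "(A *\<^sub>v v) \<bullet>c w = v \<bullet>c (mat_adjoint A *\<^sub>v w)"
proof -
  have "(A *\<^sub>v v) \<bullet>c w = (\<Sum>i<n. (\<Sum>j<m. A $$ (i, j) * v $ j) * cnj (w $ i))"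
    using assms by (auto simp: scalar_prod_def lessThan_atLeast0 intro!: sum.cong)
  also have "\<dots> = (\<Sum>j<m. \<Sum>i<n. A $$ (i, j) * v $ j * cnj (w $ i))"
    by (subst sum.swap) (simp add: sum_distrib_right)
  also have "\<dots> = (\<Sum>j<m. v $ j * cnj (\<Sum>i<n. mat_adjoint A $$ (j, i) * w $ i))"
    using assms by (auto simp: sum_distrib_left intro!: sum.cong)
  also have "\<dots> = (\<Sum>j<m. v $ j * cnj ((mat_adjoint A *\<^sub>v w) $ j))"
    using assms by (intro sum.cong) (auto simp del: index_mult_mat_vec simp: mult_mat_vec_index[of _ m n])
  also have "\<dots> = v \<bullet>c (mat_adjoint A *\<^sub>v w)"
    using assms by (auto simp del: index_mult_mat_vec simp: scalar_prod_def[of v] lessThan_atLeast0 intro!: sum.cong)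
  finally show ?thesis .
qed

lemma cvec_norm_mult_mat_vec_raw:
  assumes A: "A \<in> carrier_mat n m" and v: "v \<in> carrier_vec m"
  shows "cvec_norm (A *\<^sub>v v) \<le> (\<Sum>i<n. \<Sum>j<m. cmod (A $$ (i, j))) * cvec_norm v"
proof -
  have "cvec_norm (A *\<^sub>v v) \<le> (\<Sum>i<n. cmod ((A *\<^sub>v v) $ i))"
    using cvec_norm_le_sum[of "A *\<^sub>v v"] A by simp
  also have "\<dots> \<le> (\<Sum>i<n. \<Sum>j<m. cmod (A $$ (i, j)) * cvec_norm v)"
  proof (rule sum_mono)
    fix i assume "i \<in> {..<n}"
    then have "cmod ((A *\<^sub>v v) $ i) \<le> (\<Sum>j<m. cmod (A $$ (i, j)) * cmod (v $ j))"
      using A v by (simp add: mult_mat_vec_index[of _ n m] norm_mult[symmetric] del: index_mult_mat_vec)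
        (rule norm_sum)
    also have "\<dots> \<le> (\<Sum>j<m. cmod (A $$ (i, j)) * cvec_norm v)"
      using v by (intro sum_mono mult_left_mono cmod_index_le_cvec_norm) auto
    finally show "cmod ((A *\<^sub>v v) $ i) \<le> (\<Sum>j<m. cmod (A $$ (i, j)) * cvec_norm v)" .
  qed
  finally show ?thesis by (simp add: sum_distrib_right)
qed

lemma bdd_above_opnorm:
  assumes "A \<in> carrier_mat n m"
  shows "bdd_above {cvec_norm (A *\<^sub>v v) | v. v \<in> carrier_vec (dim_col A) \<and> cvec_norm v \<le> 1}"
proof (rule bdd_aboveI)
  fix x assume "x \<in> {cvec_norm (A *\<^sub>v v) | v. v \<in> carrier_vec (dim_col A) \<and> cvec_norm v \<le> 1}"
  then obtain v where v: "x = cvec_norm (A *\<^sub>v v)" "v \<in> carrier_vec m" "cvec_norm v \<le> 1" using assms by auto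
  have "x \<le> (\<Sum>i<n. \<Sum>j<m. cmod (A $$ (i, j))) * cvec_norm v"
    unfolding v(1) by (rule cvec_norm_mult_mat_vec_raw[OF assms v(2)])
  also have "\<dots> \<le> (\<Sum>i<n. \<Sum>j<m. cmod (A $$ (i, j))) * 1"
    by (intro mult_left_mono v sum_nonneg) auto
  finally show "x \<le> (\<Sum>i<n. \<Sum>j<m. cmod (A $$ (i, j))) * 1" .
qed

lemma mat_opnorm_nonneg:
  assumes "A \<in> carrier_mat n m" shows "0 \<le> mat_opnorm A"
  unfolding mat_opnorm_def
  by (rule cSup_upper2[OF _ _ bdd_above_opnorm[OF assms], of "cvec_norm (A *\<^sub>v 0\<^sub>v (dim_col A))"])
     (auto intro!: exI[of _ "0\<^sub>v (dim_col A)"])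

lemma cvec_norm_mult_mat_vec:
  assumes A: "A \<in> carrier_mat n m" and v: "v \<in> carrier_vec m"
  shows "cvec_norm (A *\<^sub>v v) \<le> mat_opnorm A * cvec_norm v"
proof (cases "cvec_norm v = 0")
  case True
  then show ?thesis using cvec_norm_mult_mat_vec_raw[OF A v] by simp
next
  case False
  define c where "c = cvec_norm v"
  have c: "c > 0" using False cvec_norm_nonneg[of v] unfolding c_def by linarith
  let ?w = "of_real (1/c) \<cdot>\<^sub>v v"
  have w: "?w \<in> carrier_vec m" "cvec_norm ?w = 1" using v c
    by (auto simp: cvec_norm_smult norm_divide) (simp add: c_def)
  have "cvec_norm (A *\<^sub>v ?w) \<le> mat_opnorm A"
    unfolding mat_opnorm_def by (rule cSup_upper[OF _ bdd_above_opnorm[OF A]]) (use w A in auto)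
  also have "A *\<^sub>v ?w = of_real (1/c) \<cdot>\<^sub>v (A *\<^sub>v v)" using A v by (simp add: mult_mat_vec)
  finally show ?thesis using c by (simp add: cvec_norm_smult norm_divide field_simps c_def)
qed

lemma mat_opnorm_le:
  assumes "A \<in> carrier_mat n m" "0 \<le> K"
    and "\<And>v. v \<in> carrier_vec m \<Longrightarrow> cvec_norm (A *\<^sub>v v) \<le> K * cvec_norm v"
  shows "mat_opnorm A \<le> K"
  unfolding mat_opnorm_def
proof (rule cSup_least)
  have "cvec_norm (A *\<^sub>v 0\<^sub>v m) \<in> {cvec_norm (A *\<^sub>v v) | v. v \<in> carrier_vec (dim_col A) \<and> cvec_norm v \<le> 1}"
    using assms(1) by auto
  then show "{cvec_norm (A *\<^sub>v v) | v. v \<in> carrier_vec (dim_col A) \<and> cvec_norm v \<le> 1} \<noteq> {}" by blast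
  fix x assume "x \<in> {cvec_norm (A *\<^sub>v v) | v. v \<in> carrier_vec (dim_col A) \<and> cvec_norm v \<le> 1}"
  then obtain v where "x = cvec_norm (A *\<^sub>v v)" "v \<in> carrier_vec m" "cvec_norm v \<le> 1" using assms(1) by auto
  with assms(3)[of v] mult_left_mono[of "cvec_norm v" 1 K] assms(2) show "x \<le> K" by simp
qed

lemma mat_opnorm_le_sum:
  assumes "A \<in> carrier_mat n m" shows "mat_opnorm A \<le> (\<Sum>i<n. \<Sum>j<m. cmod (A $$ (i, j)))"
  by (rule mat_opnorm_le[OF assms _ cvec_norm_mult_mat_vec_raw[OF assms]]) (auto intro!: sum_nonneg)

text \<open>
  Together with the preceding bound by the sum of all entries this shows that convergence in operator norm is
  convergence of the entries.
\<close>

lemma cmod_index_le_mat_opnorm: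
  assumes A: "A \<in> carrier_mat n m" and "i < n" "j < m"
  shows "cmod (A $$ (i, j)) \<le> mat_opnorm A"
proof -
  have "cmod (A $$ (i, j)) = cmod ((A *\<^sub>v unit_vec m j) $ i)" using assms by simp
  also have "\<dots> \<le> cvec_norm (A *\<^sub>v unit_vec m j)" by (rule cmod_index_le_cvec_norm) (use assms in simp)
  also have "\<dots> \<le> mat_opnorm A * cvec_norm (unit_vec m j :: complex vec)"
    by (rule cvec_norm_mult_mat_vec[OF A]) simp
  also have "cvec_norm (unit_vec m j :: complex vec) = 1"
  proof -
    have "(\<Sum>i<m. (cmod (unit_vec m j $ i :: complex))\<^sup>2) = (\<Sum>i<m. if i = j then 1 else 0)"
      using assms by (intro sum.cong) (auto simp: unit_vec_def)
    then show ?thesis using assms by (simp add: cvec_norm_L2 L2_set_def)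
  qed
  finally show ?thesis by simp
qed

lemma mat_opnorm_triangle:
  assumes A: "A \<in> carrier_mat n m" and B: "B \<in> carrier_mat n m"
  shows "mat_opnorm (A + B) \<le> mat_opnorm A + mat_opnorm B"
proof (rule mat_opnorm_le)
  fix v :: "complex vec" assume v: "v \<in> carrier_vec m"
  have "cvec_norm ((A + B) *\<^sub>v v) \<le> cvec_norm (A *\<^sub>v v) + cvec_norm (B *\<^sub>v v)"
    unfolding add_mult_distrib_mat_vec[OF A B v] by (rule cvec_norm_triangle[of _ n]) (use A B v in auto)
  also have "\<dots> \<le> (mat_opnorm A + mat_opnorm B) * cvec_norm v"
    using cvec_norm_mult_mat_vec[OF A v] cvec_norm_mult_mat_vec[OF B v] by (simp add: distrib_right)
  finally show "cvec_norm ((A + B) *\<^sub>v v) \<le> (mat_opnorm A + mat_opnorm B) * cvec_norm v" .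
qed (use A B mat_opnorm_nonneg[OF A] mat_opnorm_nonneg[OF B] in auto)

lemma mat_opnorm_mult:
  assumes A: "A \<in> carrier_mat n m" and B: "B \<in> carrier_mat m k"
  shows "mat_opnorm (A * B) \<le> mat_opnorm A * mat_opnorm B"
proof (rule mat_opnorm_le)
  fix v :: "complex vec" assume v: "v \<in> carrier_vec k"
  have Bv: "B *\<^sub>v v \<in> carrier_vec m" using B v by simp
  have "cvec_norm ((A * B) *\<^sub>v v) \<le> mat_opnorm A * cvec_norm (B *\<^sub>v v)"
    unfolding assoc_mult_mat_vec[OF A B v] by (rule cvec_norm_mult_mat_vec[OF A Bv])
  also have "\<dots> \<le> mat_opnorm A * (mat_opnorm B * cvec_norm v)"
    by (intro mult_left_mono cvec_norm_mult_mat_vec[OF B v] mat_opnorm_nonneg[OF A])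
  finally show "cvec_norm ((A * B) *\<^sub>v v) \<le> mat_opnorm A * mat_opnorm B * cvec_norm v" by simp
qed (use A B mat_opnorm_nonneg[OF A] mat_opnorm_nonneg[OF B] in auto)

lemma mat_opnorm_zero [simp]: "mat_opnorm (0\<^sub>m n m) = 0"
  using mat_opnorm_le_sum[of "0\<^sub>m n m" n m] mat_opnorm_nonneg[of "0\<^sub>m n m" n m] by simp

lemma mat_opnorm_eq_0: "A \<in> carrier_mat n m \<Longrightarrow> mat_opnorm A = 0 \<Longrightarrow> A = 0\<^sub>m n m"
  using cmod_index_le_mat_opnorm[of A n m] by (intro eq_matI) force+

lemma mat_opnorm_one_le: "mat_opnorm (1\<^sub>m n) \<le> 1"
  by (rule mat_opnorm_le[of _ n n]) auto

lemma mat_opnorm_one: "0 < n \<Longrightarrow> mat_opnorm (1\<^sub>m n) = 1"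
  using mat_opnorm_one_le[of n] cmod_index_le_mat_opnorm[of "1\<^sub>m n" n n 0 0] by simp

lemma smult_mult_mat_vec:
  fixes A :: "complex mat"
  assumes "A \<in> carrier_mat n m" "v \<in> carrier_vec m"
  shows "(c \<cdot>\<^sub>m A) *\<^sub>v v = c \<cdot>\<^sub>v (A *\<^sub>v v)"
proof (rule eq_vecI)
  fix i assume "i < dim_vec (c \<cdot>\<^sub>v (A *\<^sub>v v))"
  then have i: "i < n" using assms by simp
  have "((c \<cdot>\<^sub>m A) *\<^sub>v v) $ i = (\<Sum>j<m. (c \<cdot>\<^sub>m A) $$ (i, j) * v $ j)"
    by (rule mult_mat_vec_index) (use assms i in auto)
  also have "\<dots> = c * (\<Sum>j<m. A $$ (i, j) * v $ j)"
    using assms i by (auto simp: sum_distrib_left intro!: sum.cong)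
  also have "\<dots> = (c \<cdot>\<^sub>v (A *\<^sub>v v)) $ i" using mult_mat_vec_index[OF assms i] assms i by simp
  finally show "((c \<cdot>\<^sub>m A) *\<^sub>v v) $ i = (c \<cdot>\<^sub>v (A *\<^sub>v v)) $ i" .
qed (use assms in auto)

lemma mat_opnorm_smult:
  assumes A: "A \<in> carrier_mat n m"
  shows "mat_opnorm (c \<cdot>\<^sub>m A) = cmod c * mat_opnorm A"
proof -
  have le: "mat_opnorm (c \<cdot>\<^sub>m B) \<le> cmod c * mat_opnorm B" if B: "B \<in> carrier_mat n m" for c B
    by (rule mat_opnorm_le[of _ n m])
       (use B mat_opnorm_nonneg[OF B] cvec_norm_mult_mat_vec[OF B] in
         \<open>auto simp: smult_mult_mat_vec[OF B] cvec_norm_smult mult.assoc intro!: mult_left_mono\<close>)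
  show ?thesis
  proof (cases "c = 0")
    case True
    then have "c \<cdot>\<^sub>m A = 0\<^sub>m n m" using A by (intro eq_matI) auto
    then show ?thesis using True by simp
  next
    case False
    have "mat_opnorm ((1/c) \<cdot>\<^sub>m (c \<cdot>\<^sub>m A)) \<le> cmod (1/c) * mat_opnorm (c \<cdot>\<^sub>m A)"
      by (rule le) (use A in auto)
    moreover have "(1/c) \<cdot>\<^sub>m (c \<cdot>\<^sub>m A) = A" using False A by (intro eq_matI) auto
    ultimately show ?thesis using le[OF A, of c] False by (simp add: norm_divide field_simps)
  qed
qed

text \<open>
  The bound \<open>\<parallel>B v\<parallel>\<^sup>2 = \<langle>v, B\<^sup>* B v\<rangle> \<le> \<parallel>B\<^sup>* B\<parallel> \<parallel>v\<parallel>\<^sup>2\<close> gives one half of the C*-identity; combined with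
  submultiplicativity it forces \<open>\<parallel>B\<parallel> \<le> \<parallel>B\<^sup>*\<parallel>\<close>, and the rest follows by symmetry.
\<close>

lemma mat_opnorm_cstar:
  assumes A: "A \<in> carrier_mat n m"
  shows "mat_opnorm (mat_adjoint A * A) = (mat_opnorm A)\<^sup>2"
    and "mat_opnorm (mat_adjoint A) = mat_opnorm A"
proof -
  have AA: "mat_adjoint B * B \<in> carrier_mat k k" if "B \<in> carrier_mat l k" for B :: "complex mat" and l k
    using that by (meson mat_adjoint_carrier mult_carrier_mat)
  have sq: "(mat_opnorm B)\<^sup>2 \<le> mat_opnorm (mat_adjoint B * B)" if B: "B \<in> carrier_mat l k" for B l k
  proof -
    let ?s = "sqrt (mat_opnorm (mat_adjoint B * B))"
    have nn: "0 \<le> mat_opnorm (mat_adjoint B * B)" by (rule mat_opnorm_nonneg[OF AA[OF B]])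
    have "mat_opnorm B \<le> ?s"
    proof (rule mat_opnorm_le[OF B])
      fix v :: "complex vec" assume v: "v \<in> carrier_vec k"
      have Bv: "B *\<^sub>v v \<in> carrier_vec l" using B v by simp
      have "of_real ((cvec_norm (B *\<^sub>v v))\<^sup>2) = v \<bullet>c (mat_adjoint B *\<^sub>v (B *\<^sub>v v))"
        unfolding cscalar_prod_self[symmetric] by (rule cscalar_prod_adjoint[OF B v Bv])
      also have "mat_adjoint B *\<^sub>v (B *\<^sub>v v) = (mat_adjoint B * B) *\<^sub>v v"
        by (rule assoc_mult_mat_vec[symmetric, of _ k l _ k]) (use B v in auto)
      finally have "(cvec_norm (B *\<^sub>v v))\<^sup>2 = cmod (v \<bullet>c ((mat_adjoint B * B) *\<^sub>v v))"
        by (metis abs_of_nonneg norm_of_real zero_le_power2)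
      also have "\<dots> \<le> cvec_norm v * cvec_norm ((mat_adjoint B * B) *\<^sub>v v)"
        by (rule cauchy_schwarz_cvec) (use AA[OF B] v in auto)
      also have "\<dots> \<le> cvec_norm v * (mat_opnorm (mat_adjoint B * B) * cvec_norm v)"
        by (intro mult_left_mono cvec_norm_mult_mat_vec[OF AA[OF B] v]) simp
      also have "\<dots> = (?s * cvec_norm v)\<^sup>2" using nn by (simp add: power_mult_distrib power2_eq_square)
      finally show "cvec_norm (B *\<^sub>v v) \<le> ?s * cvec_norm v" by (rule power2_le_imp_le) (use nn in simp)
    qed (use nn in simp)
    then have "(mat_opnorm B)\<^sup>2 \<le> ?s\<^sup>2" by (intro power_mono mat_opnorm_nonneg[OF B])
    then show ?thesis using nn by simp
  qed
  have le: "mat_opnorm B \<le> mat_opnorm (mat_adjoint B)" if B: "B \<in> carrier_mat l k" for B l k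
  proof (cases "mat_opnorm B = 0")
    case True then show ?thesis using mat_opnorm_nonneg[OF mat_adjoint_carrier[OF B]] by simp
  next
    case False
    have "mat_opnorm B * mat_opnorm B \<le> mat_opnorm (mat_adjoint B) * mat_opnorm B"
      using sq[OF B] mat_opnorm_mult[OF mat_adjoint_carrier[OF B] B] by (simp add: power2_eq_square)
    then show ?thesis using False mat_opnorm_nonneg[OF B] by simp
  qed
  show *: "mat_opnorm (mat_adjoint A) = mat_opnorm A"
    using le[OF A] le[OF mat_adjoint_carrier[OF A]] by simp
  show "mat_opnorm (mat_adjoint A * A) = (mat_opnorm A)\<^sup>2"
    using sq[OF A] mat_opnorm_mult[OF mat_adjoint_carrier[OF A] A] * by (simp add: power2_eq_square)
qed

section \<open>The C*-algebra of all bounded sequences of square matrices\<close>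

text \<open>
  The sizes of the matrices vary with the stage and the summand, whereas the lemmas on C*-algebras speak
  about one type.  All matrix algebras are therefore embedded, as direct factors, in one C*-algebra: the
  \<open>\<ell>\<^sup>\<infinity>\<close>-product of the algebras of \<open>r \<times> r\<close> matrices over all \<open>r\<close>.
\<close>

definition bounded_family :: "(nat \<Rightarrow> complex mat) \<Rightarrow> bool" where
  "bounded_family F \<longleftrightarrow> (\<forall>r. F r \<in> carrier_mat r r) \<and> (\<exists>K. \<forall>r. mat_opnorm (F r) \<le> K)"

typedef bmat = "{F. bounded_family F}"
  morphisms entry Bmat
  by (rule exI[of _ "\<lambda>r. 0\<^sub>m r r"]) (auto simp: bounded_family_def intro!: exI[of _ 0])

lemma bounded_family_entry: "bounded_family (entry x)"
  using entry[of x] by simp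

lemma entry_carrier [simp]: "entry x r \<in> carrier_mat r r"
  using bounded_family_entry[of x] by (simp add: bounded_family_def)

lemma entry_dim [simp]: "dim_row (entry x r) = r" "dim_col (entry x r) = r"
  using entry_carrier[of x r] by (auto simp del: entry_carrier)

lemma bmat_eqI: "(\<And>r. entry x r = entry y r) \<Longrightarrow> x = y"
  by (simp add: entry_inject[symmetric] fun_eq_iff)

lemma entry_Bmat: "bounded_family F \<Longrightarrow> entry (Bmat F) = F"
  by (simp add: Bmat_inverse)

lemma bounded_familyI:
  "(\<And>r. F r \<in> carrier_mat r r) \<Longrightarrow> (\<And>r. mat_opnorm (F r) \<le> K) \<Longrightarrow> bounded_family F"
  by (auto simp: bounded_family_def)

instantiation bmat :: real_normed_algebra_1
begin

definition "0 = Bmat (\<lambda>r. 0\<^sub>m r r)"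
definition "1 = Bmat (\<lambda>r. 1\<^sub>m r)"
definition "x + y = Bmat (\<lambda>r. entry x r + entry y r)"
definition "- x = Bmat (\<lambda>r. complex_of_real (-1) \<cdot>\<^sub>m entry x r)"
definition "x - y = x + - (y :: bmat)"
definition "x * y = Bmat (\<lambda>r. entry x r * entry y r)"
definition "a *\<^sub>R x = Bmat (\<lambda>r. complex_of_real a \<cdot>\<^sub>m entry x r)"
definition "norm x = (SUP r. mat_opnorm (entry x r))"
definition "dist x y = norm (x - (y :: bmat))"
definition "sgn x = inverse (norm x) *\<^sub>R (x :: bmat)"
definition "uniformity = (INF e\<in>{0 <..}. principal {(x, y). dist x (y :: bmat) < e})"
definition "open (U :: bmat set) \<longleftrightarrow> (\<forall>x\<in>U. \<forall>\<^sub>F (x', y) in uniformity. x' = x \<longrightarrow> y \<in> U)"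

lemma bdd_above_entry: "bdd_above (range (\<lambda>r. mat_opnorm (entry x r)))"
  using bounded_family_entry[of x] by (auto simp: bounded_family_def intro: bdd_aboveI2)

lemma opnorm_entry_le: "mat_opnorm (entry x r) \<le> norm x"
  unfolding norm_bmat_def by (rule cSUP_upper[OF _ bdd_above_entry]) simp

lemma norm_bmat_le: "(\<And>r. mat_opnorm (entry x r) \<le> K) \<Longrightarrow> norm x \<le> K"
  unfolding norm_bmat_def by (rule cSUP_least) auto

lemma entry_zero [simp]: "entry 0 r = 0\<^sub>m r r"
  unfolding zero_bmat_def by (subst entry_Bmat) (auto intro!: bounded_familyI[of _ 0])

lemma entry_one [simp]: "entry 1 r = 1\<^sub>m r"
  unfolding one_bmat_def by (subst entry_Bmat) (auto intro!: bounded_familyI[of _ 1] mat_opnorm_one_le)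

lemma entry_plus [simp]: "entry (x + y) r = entry x r + entry y r"
  unfolding plus_bmat_def
  by (subst entry_Bmat)
     (auto intro!: bounded_familyI[of _ "norm x + norm y"] order_trans[OF mat_opnorm_triangle[of _ r r for r]]
        add_mono opnorm_entry_le)

lemma entry_scaleR [simp]: "entry (a *\<^sub>R x) r = complex_of_real a \<cdot>\<^sub>m entry x r"
  unfolding scaleR_bmat_def
  by (subst entry_Bmat)
     (auto intro!: bounded_familyI[of _ "\<bar>a\<bar> * norm x"] mult_left_mono opnorm_entry_le
        simp: mat_opnorm_smult[OF entry_carrier])

lemma uminus_bmat: "- x = (-1) *\<^sub>R (x :: bmat)"
  unfolding uminus_bmat_def scaleR_bmat_def by simp

lemma entry_uminus [simp]: "entry (- x) r = - entry x r"
  unfolding uminus_bmat by (intro eq_matI) auto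

lemma entry_minus [simp]: "entry (x - y) r = entry x r - entry y r"
  unfolding minus_bmat_def by (intro eq_matI) auto

lemma entry_times [simp]: "entry (x * y) r = entry x r * entry y r"
  unfolding times_bmat_def
proof (subst entry_Bmat)
  show "bounded_family (\<lambda>r. entry x r * entry y r)"
  proof (rule bounded_familyI)
    show "entry x r * entry y r \<in> carrier_mat r r" for r by (rule mult_carrier_mat) auto
    have "0 \<le> norm x" using opnorm_entry_le[of x 0] mat_opnorm_nonneg[OF entry_carrier, of x 0] by simp
    then show "mat_opnorm (entry x r * entry y r) \<le> norm x * norm y" for r
      using mat_opnorm_mult[of "entry x r" r r "entry y r" r]
      by (rule_tac order_trans) (auto intro!: mult_mono opnorm_entry_le mat_opnorm_nonneg[OF entry_carrier])
  qed
qed simp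

instance
proof
  fix x y z :: bmat and a b :: real
  show "dist x y = norm (x - y)" by (rule dist_bmat_def)
  show "sgn x = inverse (norm x) *\<^sub>R x" by (rule sgn_bmat_def)
  show "uniformity = (INF e\<in>{0 <..}. principal {(x, y). dist x (y :: bmat) < e})" by (rule uniformity_bmat_def)
  show "open U \<longleftrightarrow> (\<forall>x\<in>U. \<forall>\<^sub>F (x', y) in uniformity. x' = x \<longrightarrow> y \<in> U)" for U :: "bmat set"
    by (rule open_bmat_def)
  show "x + y + z = x + (y + z)" by (rule bmat_eqI) (auto intro!: eq_matI)
  show "x + y = y + x" by (rule bmat_eqI) (auto intro!: eq_matI)
  show "0 + x = x" by (rule bmat_eqI) auto
  show "- x + x = 0" by (rule bmat_eqI) (auto intro!: eq_matI)
  show "x - y = x + - y" by (rule minus_bmat_def)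
  show "x * y * z = x * (y * z)" by (rule bmat_eqI) (auto intro!: assoc_mult_mat[of _ r r _ r _ r for r])
  show "(x + y) * z = x * z + y * z" by (rule bmat_eqI) (auto intro!: add_mult_distrib_mat[of _ r r _ _ r for r])
  show "x * (y + z) = x * y + x * z" by (rule bmat_eqI) (auto intro!: mult_add_distrib_mat[of _ r r _ r for r])
  show "1 * x = x" by (rule bmat_eqI) auto
  show "x * 1 = x" by (rule bmat_eqI) auto
  have "entry 0 1 \<noteq> entry 1 1" by (auto simp: mat_eq_iff)
  then show "0 \<noteq> (1 :: bmat)" by metis
  show "a *\<^sub>R (x + y) = a *\<^sub>R x + a *\<^sub>R y" by (rule bmat_eqI) (auto intro!: eq_matI simp: algebra_simps)
  show "(a + b) *\<^sub>R x = a *\<^sub>R x + b *\<^sub>R x" by (rule bmat_eqI) (auto intro!: eq_matI simp: algebra_simps)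
  show "a *\<^sub>R b *\<^sub>R x = (a * b) *\<^sub>R x" by (rule bmat_eqI) (auto intro!: eq_matI)
  show "1 *\<^sub>R x = x" by (rule bmat_eqI) (auto intro!: eq_matI)
  show "a *\<^sub>R x * y = a *\<^sub>R (x * y)" by (rule bmat_eqI) (simp add: mult_smult_assoc_mat[OF entry_carrier entry_carrier])
  show "x * a *\<^sub>R y = a *\<^sub>R (x * y)" by (rule bmat_eqI) (simp add: mult_smult_distrib[OF entry_carrier entry_carrier])
  have nn: "0 \<le> norm x" for x :: bmat
    using opnorm_entry_le[of x 0] mat_opnorm_nonneg[OF entry_carrier, of x 0] by simp
  show "(norm x = 0) = (x = 0)"
  proof
    assume *: "norm x = 0"
    have "mat_opnorm (entry x r) = 0" for r
      using * opnorm_entry_le[of x r] mat_opnorm_nonneg[OF entry_carrier, of x r] by simp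
    then show "x = 0" by (intro bmat_eqI) (simp add: mat_opnorm_eq_0[OF entry_carrier])
  next
    assume "x = 0"
    then show "norm x = 0" using norm_bmat_le[of x 0] nn[of x] by simp
  qed
  show "norm (x + y) \<le> norm x + norm y"
    by (rule norm_bmat_le)
       (auto intro!: order_trans[OF mat_opnorm_triangle[of _ r r for r]] add_mono opnorm_entry_le)
  have le: "norm (a *\<^sub>R x) \<le> \<bar>a\<bar> * norm x" for a and x :: bmat
    by (rule norm_bmat_le) (auto simp: mat_opnorm_smult[OF entry_carrier] intro!: mult_left_mono opnorm_entry_le)
  show "norm (a *\<^sub>R x) = \<bar>a\<bar> * norm x"
  proof (cases "a = 0")
    case True
    then show ?thesis using le[of a x] nn[of "a *\<^sub>R x"] by simp
  next
    case False
    have "x = (1/a) *\<^sub>R (a *\<^sub>R x)" using False by (intro bmat_eqI eq_matI) auto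
    then have "norm x \<le> \<bar>1/a\<bar> * norm (a *\<^sub>R x)" using le[of "1/a" "a *\<^sub>R x"] by simp
    then show ?thesis using le[of a x] False by (simp add: field_simps)
  qed
  show "norm (x * y) \<le> norm x * norm y"
    by (rule norm_bmat_le)
       (auto intro!: order_trans[OF mat_opnorm_mult[of _ r r _ r for r]] mult_mono opnorm_entry_le nn
          mat_opnorm_nonneg[OF entry_carrier])
  have "norm (1::bmat) \<le> 1" by (rule norm_bmat_le) (auto intro: mat_opnorm_one_le)
  then show "norm (1::bmat) = 1" using opnorm_entry_le[of "1::bmat" 1] by (simp add: mat_opnorm_one)
qed

end

instance bmat :: banach
proof
  fix X :: "nat \<Rightarrow> bmat" assume X: "Cauchy X"
  have ent: "cmod (entry x r $$ (i, j) - entry y r $$ (i, j)) \<le> norm (x - y)" if "i < r" "j < r" for x y r i j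
    using cmod_index_le_mat_opnorm[of "entry (x - y) r" r r i j] opnorm_entry_le[of "x - y" r] that
    by (auto simp: minus_carrier_mat)
  have C: "Cauchy (\<lambda>n. entry (X n) r $$ (i, j))" if "i < r" "j < r" for r i j
    unfolding Cauchy_altdef2 dist_norm
  proof (intro allI impI)
    fix e :: real assume "e > 0"
    with X obtain N where "\<forall>n\<ge>N. norm (X n - X N) < e" unfolding Cauchy_altdef2 dist_norm by blast
    then show "\<exists>N. \<forall>n\<ge>N. cmod (entry (X n) r $$ (i, j) - entry (X N) r $$ (i, j)) < e"
      using ent[OF that] le_less_trans by meson
  qed
  define L where "L r = mat r r (\<lambda>(i, j). lim (\<lambda>n. entry (X n) r $$ (i, j)))" for r
  have L: "(\<lambda>n. entry (X n) r $$ (i, j)) \<longlonglongrightarrow> L r $$ (i, j)" if "i < r" "j < r" for r i j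
    using C[OF that] that by (simp add: L_def Cauchy_convergent_iff convergent_LIMSEQ_iff)
  have Lc: "L r \<in> carrier_mat r r" for r by (simp add: L_def)
  have key: "mat_opnorm (L r - entry (X n) r) \<le> e" if N: "\<forall>m\<ge>N. norm (X m - X n) \<le> e" for r n N e
  proof (rule field_le_epsilon)
    fix d :: real assume d: "d > 0"
    have "(\<lambda>m. cmod (L r $$ (i, j) - entry (X m) r $$ (i, j))) \<longlonglongrightarrow> 0" if "i < r" "j < r" for i j
      using tendsto_norm[OF tendsto_diff[OF tendsto_const[of "L r $$ (i, j)"] L[OF that]]] by simp
    then have "(\<lambda>m. \<Sum>i<r. \<Sum>j<r. cmod ((L r - entry (X m) r) $$ (i, j))) \<longlonglongrightarrow> (\<Sum>i<r. \<Sum>j<r. 0)"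
      using Lc by (intro tendsto_sum) auto
    then have "(\<lambda>m. \<Sum>i<r. \<Sum>j<r. cmod ((L r - entry (X m) r) $$ (i, j))) \<longlonglongrightarrow> 0" by simp
    from order_tendstoD(2)[OF this d] have "\<forall>\<^sub>F m in sequentially. (\<Sum>i<r. \<Sum>j<r. cmod ((L r - entry (X m) r) $$ (i, j))) < d" .
    then obtain m where m: "m \<ge> N" "(\<Sum>i<r. \<Sum>j<r. cmod ((L r - entry (X m) r) $$ (i, j))) < d"
      unfolding eventually_sequentially by (meson linorder_le_cases)
    have "L r - entry (X n) r = (L r - entry (X m) r) + entry (X m - X n) r"
      using Lc[of r] by (intro eq_matI) auto
    also have "mat_opnorm \<dots> \<le> mat_opnorm (L r - entry (X m) r) + mat_opnorm (entry (X m - X n) r)"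
      by (rule mat_opnorm_triangle[of _ r r]) (use Lc in \<open>auto intro: minus_carrier_mat\<close>)
    also have "\<dots> \<le> d + e"
      using m mat_opnorm_le_sum[of "L r - entry (X m) r" r r] opnorm_entry_le[of "X m - X n" r] N
      by (smt (verit) Lc entry_carrier minus_carrier_mat)
    finally show "mat_opnorm (L r - entry (X n) r) \<le> e + d" by simp
  qed
  obtain N1 where N1: "\<forall>m\<ge>N1. norm (X m - X N1) \<le> 1"
    using X[unfolded Cauchy_altdef2 dist_norm, rule_format, of 1] by (auto intro: less_imp_le)
  have bL: "bounded_family L"
  proof (rule bounded_familyI[OF Lc])
    fix r
    have "L r = (L r - entry (X N1) r) + entry (X N1) r" using Lc[of r] by (intro eq_matI) auto
    then have "mat_opnorm (L r) \<le> mat_opnorm (L r - entry (X N1) r) + mat_opnorm (entry (X N1) r)"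
      using mat_opnorm_triangle[of "L r - entry (X N1) r" r r "entry (X N1) r"] by (simp add: minus_carrier_mat)
    then show "mat_opnorm (L r) \<le> 1 + norm (X N1)" using key[OF N1, of r] opnorm_entry_le[of "X N1" r] by simp
  qed
  have "X \<longlonglongrightarrow> Bmat L"
    unfolding tendsto_iff dist_norm eventually_sequentially
  proof (intro allI impI)
    fix e :: real assume e: "e > 0"
    obtain N where N: "\<forall>m\<ge>N. \<forall>n\<ge>N. norm (X m - X n) < e/2"
      using X e unfolding Cauchy_def dist_norm by (meson half_gt_zero)
    have "norm (X n - Bmat L) \<le> e/2" if "n \<ge> N" for n
    proof -
      have "norm (Bmat L - X n) \<le> e/2"
        by (rule norm_bmat_le) (use key[of N n "e/2"] N that in \<open>auto simp: entry_Bmat[OF bL] less_imp_le\<close>)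
      then show ?thesis by (simp add: norm_minus_commute)
    qed
    then show "\<exists>N. \<forall>n\<ge>N. norm (X n - Bmat L) < e"
      using e by (intro exI[of _ N]) (smt (verit) field_sum_of_halves)
  qed
  then show "convergent X" by (auto simp: convergent_def)
qed

instantiation bmat :: unital_cstar_algebra
begin

definition "scaleC c x = Bmat (\<lambda>r. c \<cdot>\<^sub>m entry x r)"
definition "star x = Bmat (\<lambda>r. mat_adjoint (entry x r))"

lemma entry_scaleC [simp]: "entry (scaleC c x) r = c \<cdot>\<^sub>m entry x r"
  unfolding scaleC_bmat_def
  by (subst entry_Bmat)
     (auto intro!: bounded_familyI[of _ "cmod c * norm x"] mult_left_mono opnorm_entry_le
        simp: mat_opnorm_smult[OF entry_carrier])

lemma entry_star [simp]: "entry (star x) r = mat_adjoint (entry x r)"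
  unfolding star_bmat_def
  by (subst entry_Bmat)
     (auto intro!: bounded_familyI[of _ "norm x"] opnorm_entry_le simp: mat_opnorm_cstar[OF entry_carrier])

instance
proof
  fix x y :: bmat and c d :: complex and r :: real
  show "scaleC (complex_of_real r) x = r *\<^sub>R x" by (rule bmat_eqI) auto
  show "scaleC c (x + y) = scaleC c x + scaleC c y" by (rule bmat_eqI) (auto intro!: eq_matI simp: algebra_simps)
  show "scaleC (c + d) x = scaleC c x + scaleC d x" by (rule bmat_eqI) (auto intro!: eq_matI simp: algebra_simps)
  show "scaleC c (scaleC d x) = scaleC (c * d) x" by (rule bmat_eqI) (auto intro!: eq_matI)
  show "scaleC c x * y = scaleC c (x * y)" by (rule bmat_eqI) (simp add: mult_smult_assoc_mat[OF entry_carrier entry_carrier])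
  show "x * scaleC c y = scaleC c (x * y)" by (rule bmat_eqI) (simp add: mult_smult_distrib[OF entry_carrier entry_carrier])
  have le: "norm (scaleC c x) \<le> cmod c * norm x" for c and x :: bmat
    by (rule norm_bmat_le) (auto simp: mat_opnorm_smult[OF entry_carrier] intro!: mult_left_mono opnorm_entry_le)
  show "norm (scaleC c x) = cmod c * norm x"
  proof (cases "c = 0")
    case True
    then show ?thesis using le[of c x] norm_ge_zero[of "scaleC c x"] by simp
  next
    case False
    have "x = scaleC (1/c) (scaleC c x)" using False by (intro bmat_eqI eq_matI) auto
    then have "norm x \<le> cmod (1/c) * norm (scaleC c x)" using le[of "1/c" "scaleC c x"] by simp
    then show ?thesis using le[of c x] False by (simp add: field_simps norm_divide)
  qed
  show "star (star x) = x" by (rule bmat_eqI) auto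
  show "star (x + y) = star x + star y" by (rule bmat_eqI) (auto intro!: eq_matI)
  show "star (scaleC c x) = scaleC (cnj c) (star x)" by (rule bmat_eqI) (auto intro!: eq_matI)
  show "star (x * y) = star y * star x" by (rule bmat_eqI) (simp add: mat_adjoint_mult_mat[OF entry_carrier entry_carrier])
  have en: "mat_opnorm (entry (star x * x) r) = (mat_opnorm (entry x r))\<^sup>2" for r
    by (simp add: mat_opnorm_cstar[OF entry_carrier])
  show "norm (star x * x) = (norm x)\<^sup>2"
  proof (rule antisym)
    show "norm (star x * x) \<le> (norm x)\<^sup>2"
      by (rule norm_bmat_le) (auto simp: en[simplified] intro!: power_mono opnorm_entry_le mat_opnorm_nonneg[OF entry_carrier])
    have "norm x \<le> sqrt (norm (star x * x))"
    proof (rule norm_bmat_le)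
      fix r
      show "mat_opnorm (entry x r) \<le> sqrt (norm (star x * x))"
        using opnorm_entry_le[of "star x * x" r] unfolding en by (rule real_le_rsqrt)
    qed
    then show "(norm x)\<^sup>2 \<le> norm (star x * x)"
      by (metis norm_ge_zero power_mono real_sqrt_pow2)
  qed
qed

end

definition emb :: "nat \<Rightarrow> complex mat \<Rightarrow> bmat" where
  "emb r M = Bmat (\<lambda>s. if s = r then M else 0\<^sub>m s s)"

lemma entry_emb:
  assumes "M \<in> carrier_mat r r"
  shows "entry (emb r M) s = (if s = r then M else 0\<^sub>m s s)"
  unfolding emb_def using mat_opnorm_nonneg[OF assms]
  by (subst entry_Bmat) (auto intro!: bounded_familyI[of _ "mat_opnorm M"] assms)

lemma entry_emb_same [simp]: "M \<in> carrier_mat r r \<Longrightarrow> entry (emb r M) r = M"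
  by (simp add: entry_emb)

lemma norm_emb: "M \<in> carrier_mat r r \<Longrightarrow> norm (emb r M) = mat_opnorm M"
  by (rule antisym) (auto intro!: norm_bmat_le simp: entry_emb mat_opnorm_nonneg
      intro: order_trans[OF _ opnorm_entry_le[of "emb r M" r]])

lemma emb_add: "M \<in> carrier_mat r r \<Longrightarrow> N \<in> carrier_mat r r \<Longrightarrow> emb r (M + N) = emb r M + emb r N"
  by (rule bmat_eqI) (auto simp: entry_emb)

lemma emb_diff: "M \<in> carrier_mat r r \<Longrightarrow> N \<in> carrier_mat r r \<Longrightarrow> emb r (M - N) = emb r M - emb r N"
  by (rule bmat_eqI) (auto simp: entry_emb minus_carrier_mat)

lemma emb_mult: "M \<in> carrier_mat r r \<Longrightarrow> N \<in> carrier_mat r r \<Longrightarrow> emb r (M * N) = emb r M * emb r N"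
  by (rule bmat_eqI) (auto simp: entry_emb mult_carrier_mat[of _ r r])

lemma emb_adjoint: "M \<in> carrier_mat r r \<Longrightarrow> emb r (mat_adjoint M) = star (emb r M)"
  by (rule bmat_eqI) (auto simp: entry_emb intro!: eq_matI)

lemma emb_smult: "M \<in> carrier_mat r r \<Longrightarrow> emb r (c \<cdot>\<^sub>m M) = scaleC c (emb r M)"
  by (rule bmat_eqI) (auto simp: entry_emb)

lemma emb_entry: "emb r (1\<^sub>m r) * x = x \<Longrightarrow> emb r (entry x r) = x"
proof (rule bmat_eqI)
  fix s assume "emb r (1\<^sub>m r) * x = x"
  then have "entry (emb r (1\<^sub>m r)) s * entry x s = entry x s" by (metis entry_times)
  then show "entry (emb r (entry x r)) s = entry x s"
    by (cases "s = r") (auto simp: entry_emb)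
qed

section \<open>Traces and projections of matrices\<close>

definition act :: "nat \<Rightarrow> bmat \<Rightarrow> complex vec \<Rightarrow> complex vec" where
  "act r x v = entry x r *\<^sub>v v"

lemma act_carrier [simp]: "act r x v \<in> carrier_vec r"
  unfolding act_def carrier_vec_def by simp

lemma dim_act [simp]: "dim_vec (act r x v) = r"
  by (simp add: act_def)

lemma act_mult: "v \<in> carrier_vec r \<Longrightarrow> act r (x * y) v = act r x (act r y v)"
  by (simp add: act_def assoc_mult_mat_vec[of _ r r _ r])

lemma act_add: "v \<in> carrier_vec r \<Longrightarrow> act r (x + y) v = act r x v + act r y v"
  by (simp add: act_def add_mult_distrib_mat_vec[of _ r r])

lemma act_diff: "v \<in> carrier_vec r \<Longrightarrow> act r (x - y) v = act r x v - act r y v"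
  by (simp add: act_def minus_mult_distrib_mat_vec[of _ r r])

lemma act_vec_add: "v \<in> carrier_vec r \<Longrightarrow> w \<in> carrier_vec r \<Longrightarrow> act r x (v + w) = act r x v + act r x w"
  by (simp add: act_def mult_add_distrib_mat_vec[of _ r r])

lemma act_vec_diff: "v \<in> carrier_vec r \<Longrightarrow> w \<in> carrier_vec r \<Longrightarrow> act r x (v - w) = act r x v - act r x w"
  by (simp add: act_def mult_minus_distrib_mat_vec[of _ r r])

lemma act_smult: "v \<in> carrier_vec r \<Longrightarrow> act r x (c \<cdot>\<^sub>v v) = c \<cdot>\<^sub>v act r x v"
  by (simp add: act_def mult_mat_vec[of _ r r])

lemma act_one [simp]: "v \<in> carrier_vec r \<Longrightarrow> act r 1 v = v"
  by (simp add: act_def)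

lemma act_star: "v \<in> carrier_vec r \<Longrightarrow> w \<in> carrier_vec r \<Longrightarrow> act r x v \<bullet>c w = v \<bullet>c act r (star x) w"
  by (simp add: act_def cscalar_prod_adjoint[of _ r r])

lemma cvec_norm_act: "v \<in> carrier_vec r \<Longrightarrow> cvec_norm (act r x v) \<le> norm x * cvec_norm v"
  unfolding act_def
  by (rule order_trans[OF cvec_norm_mult_mat_vec[of _ r r]]) (auto intro!: mult_right_mono opnorm_entry_le)

lemma act_index: "v \<in> carrier_vec r \<Longrightarrow> k < r \<Longrightarrow> act r x v $ k = (\<Sum>l<r. entry x r $$ (k, l) * v $ l)"
  unfolding act_def by (rule mult_mat_vec_index) auto

definition tr :: "nat \<Rightarrow> bmat \<Rightarrow> complex" where
  "tr r x = (\<Sum>i<r. entry x r $$ (i, i))"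

lemma tr_add: "tr r (x + y) = tr r x + tr r y"
  by (simp add: tr_def sum.distrib)

lemma tr_diff: "tr r (x - y) = tr r x - tr r y"
  by (simp add: tr_def sum_subtractf)

lemma tr_scaleC: "tr r (scaleC c x) = c * tr r x"
  by (simp add: tr_def sum_distrib_left)

lemma tr_one: "tr r 1 = of_nat r"
  by (simp add: tr_def)

lemma tr_mult: "tr r (x * y) = (\<Sum>i<r. \<Sum>j<r. entry x r $$ (i, j) * entry y r $$ (j, i))"
  unfolding tr_def by (intro sum.cong) (simp_all add: mult_mat_index[OF entry_carrier entry_carrier] del: index_mult_mat(1))

lemma tr_comm: "tr r (x * y) = tr r (y * x)"
  unfolding tr_mult by (subst sum.swap) (simp add: mult.commute)

text \<open>
  The trace of \<open>x\<^sup>* x\<close> is the squared Hilbert-Schmidt norm; this is the source of all positivity of traces.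
\<close>

lemma tr_star_mult: "tr r (star x * x) = of_real (\<Sum>i<r. \<Sum>j<r. (cmod (entry x r $$ (j, i)))\<^sup>2)"
  unfolding tr_mult by (auto intro!: sum.cong simp: complex_norm_square[symmetric] mult.commute[of "cnj _"])

lemma tr_star_mult_ge_0: "0 \<le> Re (tr r (star x * x))"
  unfolding tr_star_mult by (auto intro!: sum_nonneg)

lemma tr_projection_ge_0: "is_projection p \<Longrightarrow> 0 \<le> Re (tr r p)"
  using tr_star_mult_ge_0[of r p] by (simp add: is_projection_def)

definition outer :: "nat \<Rightarrow> complex vec \<Rightarrow> complex mat" where
  "outer r u = mat r r (\<lambda>(k, l). u $ k * cnj (u $ l))"

lemma outer_carrier [simp]: "outer r u \<in> carrier_mat r r"
  by (simp add: outer_def)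

text \<open>
  Spectral theorem for projections, without eigenvalues: any column of \<open>P\<close>, normalized, is a vector \<open>\<xi>\<close> fixed
  by \<open>P\<close>, and \<open>P - \<xi> \<xi>\<^sup>*\<close> is again a projection whose trace is smaller by one.  As traces of projections are
  nonnegative, this stops, and it shows at the same time that the trace is a natural number.
\<close>

lemma projection_decomposition:
  assumes P: "is_projection P"
  shows "\<exists>a u. (\<forall>i. u i \<in> carrier_vec r \<and> cvec_norm (u i) \<le> 1) \<and> tr r P = of_nat a \<and>
    (\<forall>k<r. \<forall>l<r. entry P r $$ (k, l) = (\<Sum>i<a. u i $ k * cnj (u i $ l)))"
proof -
  have "is_projection P \<Longrightarrow> Re (tr r P) < real n \<Longrightarrow>
    \<exists>a u. (\<forall>i. u i \<in> carrier_vec r \<and> cvec_norm (u i) \<le> 1) \<and> tr r P = of_nat a \<and>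
    (\<forall>k<r. \<forall>l<r. entry P r $$ (k, l) = (\<Sum>i<a. u i $ k * cnj (u i $ l)))" for n P
  proof (induction n arbitrary: P)
    case 0 then show ?case using tr_projection_ge_0[of P r] by simp
  next
    case (Suc n)
    note PP = is_projectionD[OF Suc.prems(1)]
    show ?case
    proof (cases "entry P r = 0\<^sub>m r r")
      case True
      then show ?thesis
        by (intro exI[of _ 0] exI[of _ "\<lambda>_. 0\<^sub>v r"]) (auto simp: tr_def)
    next
      case False
      then obtain k j where kj: "k < r" "j < r" "entry P r $$ (k, j) \<noteq> 0"
        by (metis entry_dim eq_matI index_zero_mat(1) index_zero_mat(2) index_zero_mat(3))
      define v where "v = act r P (unit_vec r j)"
      have v: "v \<in> carrier_vec r" by (simp add: v_def)
      have "v $ k = entry P r $$ (k, j)" using kj by (simp add: v_def act_def)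
      with kj have nv: "cvec_norm v > 0"
        using cmod_index_le_cvec_norm[of k v] v by (metis carrier_vecD norm_le_zero_iff not_le order_less_le_trans zero_less_norm_iff)
      define \<xi> where "\<xi> = of_real (1 / cvec_norm v) \<cdot>\<^sub>v v"
      have \<xi>: "\<xi> \<in> carrier_vec r" "cvec_norm \<xi> = 1" using nv v by (auto simp: \<xi>_def cvec_norm_smult norm_divide)
      have "act r P v = v" by (simp add: v_def act_mult[symmetric] PP)
      then have P\<xi>: "act r P \<xi> = \<xi>" using v by (simp add: \<xi>_def act_smult)
      define X where "X = emb r (outer r \<xi>)"
      have eX: "entry X r = outer r \<xi>" by (simp add: X_def)
      have Xs: "star X = X" unfolding X_def emb_adjoint[OF outer_carrier, symmetric]
        by (rule arg_cong[where f = "emb r"], rule eq_matI) (auto simp: outer_def)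
      have PX: "P * X = X"
      proof (rule bmat_eqI)
        fix s
        show "entry (P * X) s = entry X s"
        proof (cases "s = r")
          case True
          have "(\<Sum>l<r. entry P r $$ (i, l) * (\<xi> $ l * cnj (\<xi> $ j))) = \<xi> $ i * cnj (\<xi> $ j)" if "i < r" for i j
            using act_index[OF \<xi>(1) that, of P] unfolding P\<xi> by (simp add: sum_distrib_right mult.assoc)
          then have "entry P r * outer r \<xi> = outer r \<xi>"
            by (intro eq_matI) (auto simp: outer_def mult_mat_index[of _ r r _ r] simp del: index_mult_mat(1))
          then show ?thesis by (simp add: True eX)
        qed (simp add: X_def entry_emb)
      qed
      have XP: "X * P = X" using arg_cong[OF PX, of star] by (simp add: star_mult Xs PP)
      have un: "(\<Sum>l<r. cnj (\<xi> $ l) * \<xi> $ l) = 1"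
      proof -
        have "\<xi> \<bullet>c \<xi> = (\<Sum>l<r. \<xi> $ l * cnj (\<xi> $ l))" using \<xi>(1) by (simp add: scalar_prod_def lessThan_atLeast0)
        then show ?thesis using cscalar_prod_self[of \<xi>] \<xi>(2) by (simp add: mult.commute)
      qed
      have XX: "X * X = X"
      proof -
        have "(\<Sum>l<r. \<xi> $ i * cnj (\<xi> $ l) * (\<xi> $ l * cnj (\<xi> $ j))) = \<xi> $ i * cnj (\<xi> $ j)" for i j
        proof -
          have "(\<Sum>l<r. \<xi> $ i * cnj (\<xi> $ l) * (\<xi> $ l * cnj (\<xi> $ j))) = \<xi> $ i * (\<Sum>l<r. cnj (\<xi> $ l) * \<xi> $ l) * cnj (\<xi> $ j)"
            by (simp add: sum_distrib_left sum_distrib_right mult.assoc)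
          then show ?thesis by (simp add: un)
        qed
        then have "outer r \<xi> * outer r \<xi> = outer r \<xi>"
          by (intro eq_matI) (auto simp: outer_def mult_mat_index[of _ r r _ r] simp del: index_mult_mat(1))
        then show ?thesis unfolding X_def emb_mult[OF outer_carrier outer_carrier, symmetric] by simp
      qed
      have Q: "is_projection (P - X)"
        by (simp add: is_projection_def star_diff PP Xs left_diff_distrib right_diff_distrib PX XP XX)
      have trX: "tr r X = 1" using un by (simp add: tr_def eX outer_def mult.commute)
      have "Re (tr r (P - X)) < real n" using Suc.prems(2) trX by (simp add: tr_diff)
      from Suc.IH[OF Q this] obtain a u where u: "\<And>i. u i \<in> carrier_vec r \<and> cvec_norm (u i) \<le> 1"
        "tr r (P - X) = of_nat a"
        "\<And>k l. k < r \<Longrightarrow> l < r \<Longrightarrow> entry (P - X) r $$ (k, l) = (\<Sum>i<a. u i $ k * cnj (u i $ l))" by blast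
      show ?thesis
      proof (intro exI[of _ "Suc a"] exI[of _ "\<lambda>i. if i < a then u i else \<xi>"] conjI allI impI)
        fix i show "(if i < a then u i else \<xi>) \<in> carrier_vec r" "cvec_norm (if i < a then u i else \<xi>) \<le> 1"
          using u(1) \<xi> by auto
        show "tr r P = of_nat (Suc a)" using u(2) trX by (simp add: tr_diff algebra_simps)
        fix k l assume "k < r" "l < r"
        then show "entry P r $$ (k, l) = (\<Sum>i<Suc a. (if i < a then u i else \<xi>) $ k * cnj ((if i < a then u i else \<xi>) $ l))"
          using u(3)[of k l] by (simp add: eX outer_def algebra_simps)
      qed
    qed
  qed
  from this[OF P] show ?thesis using reals_Archimedean2 by blast
qed

lemma projection_act_index:
  assumes "\<forall>k<r. \<forall>l<r. entry P r $$ (k, l) = (\<Sum>i<a. u i $ k * cnj (u i $ l))"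
    and u: "\<And>i. u i \<in> carrier_vec r" and v: "v \<in> carrier_vec r" and k: "k < r"
  shows "act r P v $ k = (\<Sum>i<a. (v \<bullet>c u i) * u i $ k)"
proof -
  have "act r P v $ k = (\<Sum>l<r. \<Sum>i<a. u i $ k * cnj (u i $ l) * v $ l)"
    using assms(1) k by (simp add: act_index[OF v k] sum_distrib_right)
  also have "\<dots> = (\<Sum>i<a. \<Sum>l<r. u i $ k * cnj (u i $ l) * v $ l)" by (rule sum.swap)
  also have "\<dots> = (\<Sum>i<a. (v \<bullet>c u i) * u i $ k)"
    using carrier_vecD[OF u]
    by (auto intro!: sum.cong simp: scalar_prod_def lessThan_atLeast0 sum_distrib_left sum_distrib_right)
  finally show ?thesis .
qed

lemma rank_sum_outer_le:
  assumes "A \<in> carrier_mat r r" "\<forall>k<r. \<forall>l<r. A $$ (k, l) = (\<Sum>i<a. u i $ k * cnj (u i $ l))"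
  shows "vec_space.rank r A \<le> a"
  using assms
proof (induction a arbitrary: A)
  case 0
  then have "A = 0\<^sub>m r r" by (intro eq_matI) auto
  then show ?case by (simp add: vec_space.rank_0I)
next
  case (Suc a)
  define B where "B = mat r r (\<lambda>(k, l). \<Sum>i<a. u i $ k * cnj (u i $ l))"
  have "A = B + outer r (u a)" using Suc.prems by (intro eq_matI) (auto simp: B_def outer_def)
  then have "vec_space.rank r A \<le> vec_space.rank r B + vec_space.rank r (outer r (u a))"
    using vec_space.rank_subadditive[of B r r "outer r (u a)"] by (simp add: B_def)
  also have "vec_space.rank r B \<le> a" by (rule Suc.IH) (auto simp: B_def)
  also have "vec_space.rank r (outer r (u a)) \<le> 1"
    by (rule vec_space.rank_le_1_product_entries[where f = "\<lambda>k. u a $ k" and g = "\<lambda>l. cnj (u a $ l)"])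
       (auto simp: outer_def)
  finally show ?case by simp
qed

lemma rank_identity_mat: "vec_space.rank r (1\<^sub>m r :: complex mat) = r"
  using vec_space.det_rank_iff[of "1\<^sub>m r :: complex mat" r] by simp

text \<open>
  The decomposition bounds the rank of \<open>P\<close> by the trace of \<open>P\<close>, and likewise for \<open>1 - P\<close>.  The two traces
  add up to \<open>r\<close>, and the two ranks to at least \<open>r\<close>, so both bounds are equalities.
\<close>

lemma trace_eq_rank:
  assumes P: "is_projection P"
  shows "tr r P = of_nat (vec_space.rank r (entry P r))"
proof -
  obtain a u where a: "tr r P = of_nat a"
    "\<forall>k<r. \<forall>l<r. entry P r $$ (k, l) = (\<Sum>i<a. u i $ k * cnj (u i $ l))"
    using projection_decomposition[OF P, of r] by blast
  obtain b w where b: "tr r (1 - P) = of_nat b"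
    "\<forall>k<r. \<forall>l<r. entry (1 - P) r $$ (k, l) = (\<Sum>i<b. w i $ k * cnj (w i $ l))"
    using projection_decomposition[OF is_projection_compl[OF P], of r] by blast
  have "of_nat a + of_nat b = (of_nat r :: complex)" using a(1) b(1) by (simp add: tr_diff tr_one algebra_simps)
  then have ab: "a + b = r" by (metis of_nat_add of_nat_eq_iff)
  have "1\<^sub>m r = entry P r + entry (1 - P) r" by (intro eq_matI) auto
  then have "r \<le> vec_space.rank r (entry P r) + vec_space.rank r (entry (1 - P) r)"
    using vec_space.rank_subadditive[of "entry P r" r r "entry (1 - P) r"]
    by (metis rank_identity_mat entry_carrier)
  moreover have "vec_space.rank r (entry P r) \<le> a" "vec_space.rank r (entry (1 - P) r) \<le> b"
    using rank_sum_outer_le[OF entry_carrier a(2)] rank_sum_outer_le[OF entry_carrier b(2)] by auto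
  ultimately have "vec_space.rank r (entry P r) = a" using ab by linarith
  then show ?thesis using a by simp
qed

lemma projection_decomposition':
  assumes P: "is_projection P"
  shows "\<exists>u. (\<forall>i. u i \<in> carrier_vec r \<and> cvec_norm (u i) \<le> 1) \<and>
    (\<forall>v\<in>carrier_vec r. \<forall>k<r. act r P v $ k = (\<Sum>i<vec_space.rank r (entry P r). (v \<bullet>c u i) * u i $ k))"
proof -
  obtain a u where a: "\<forall>i. u i \<in> carrier_vec r \<and> cvec_norm (u i) \<le> 1" "tr r P = of_nat a"
    "\<forall>k<r. \<forall>l<r. entry P r $$ (k, l) = (\<Sum>i<a. u i $ k * cnj (u i $ l))"
    using projection_decomposition[OF P, of r] by blast
  have "a = vec_space.rank r (entry P r)" using a(2) trace_eq_rank[OF P, of r] by simp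
  with a(1) projection_act_index[OF a(3)] show ?thesis by (intro exI[of _ u]) auto
qed

text \<open>
  In contrast to the obvious bound \<open>r * \<parallel>x\<parallel>\<close> only the rank of \<open>c\<close> enters; this keeps all
  trace estimates independent of the size of the matrices in which a corner is realized.
\<close>

lemma norm_tr_corner_le:
  assumes c: "is_projection c"
  shows "cmod (tr r (c * x)) \<le> Re (tr r c) * norm x"
proof -
  obtain a u where a: "\<forall>i. u i \<in> carrier_vec r \<and> cvec_norm (u i) \<le> 1" "tr r c = of_nat a"
    "\<forall>k<r. \<forall>l<r. entry c r $$ (k, l) = (\<Sum>i<a. u i $ k * cnj (u i $ l))"
    using projection_decomposition[OF c, of r] by blast
  have "tr r (c * x) = (\<Sum>i<r. \<Sum>j<r. \<Sum>m<a. entry x r $$ (j, i) * u m $ i * cnj (u m $ j))"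
    unfolding tr_mult using a(3) by (intro sum.cong refl) (auto simp: sum_distrib_right intro!: sum.cong)
  also have "\<dots> = (\<Sum>i<r. \<Sum>m<a. \<Sum>j<r. entry x r $$ (j, i) * u m $ i * cnj (u m $ j))"
    by (intro sum.cong refl sum.swap)
  also have "\<dots> = (\<Sum>m<a. \<Sum>i<r. \<Sum>j<r. entry x r $$ (j, i) * u m $ i * cnj (u m $ j))"
    by (rule sum.swap)
  also have "\<dots> = (\<Sum>m<a. act r x (u m) \<bullet>c u m)"
  proof (rule sum.cong)
    fix m assume "m \<in> {..<a}"
    have um: "u m \<in> carrier_vec r" using a by blast
    have "act r x (u m) \<bullet>c u m = (\<Sum>j<r. \<Sum>i<r. entry x r $$ (j, i) * u m $ i * cnj (u m $ j))"
      using um by (auto simp: scalar_prod_def lessThan_atLeast0 act_index[OF um, unfolded lessThan_atLeast0] sum_distrib_right intro!: sum.cong)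
    then show "(\<Sum>i<r. \<Sum>j<r. entry x r $$ (j, i) * u m $ i * cnj (u m $ j)) = act r x (u m) \<bullet>c u m"
      by (subst sum.swap) simp
  qed simp
  also have "cmod \<dots> \<le> (\<Sum>m<a. norm x)"
  proof (rule sum_norm_le)
    fix m
    have um: "u m \<in> carrier_vec r" "cvec_norm (u m) \<le> 1" using a by auto
    have "cmod (act r x (u m) \<bullet>c u m) \<le> cvec_norm (act r x (u m)) * cvec_norm (u m)"
      by (rule cauchy_schwarz_cvec[of _ r]) (use um in auto)
    also have "\<dots> \<le> (norm x * cvec_norm (u m)) * cvec_norm (u m)"
      by (intro mult_right_mono cvec_norm_act um) simp
    also have "\<dots> \<le> norm x * 1 * 1" using um by (intro mult_mono) auto
    finally show "cmod (act r x (u m) \<bullet>c u m) \<le> norm x" by simp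
  qed
  finally show ?thesis using a(2) by simp
qed

section \<open>A matrix in general position to a family of pairs of projections\<close>

subsection \<open>Rounding to a grid\<close>

definition round_grid :: "nat \<Rightarrow> complex \<Rightarrow> int \<times> int" where
  "round_grid N z = (\<lfloor>real N * Re z\<rfloor>, \<lfloor>real N * Im z\<rfloor>)"

definition unround_grid :: "nat \<Rightarrow> int \<times> int \<Rightarrow> complex" where
  "unround_grid N p = Complex (real_of_int (fst p) / N) (real_of_int (snd p) / N)"

lemma dist_unround_round:
  assumes "0 < N" shows "cmod (unround_grid N (round_grid N z) - z) \<le> 2 / N"
proof -
  have *: "\<bar>of_int \<lfloor>real N * x\<rfloor> / N - x\<bar> \<le> 1 / N" for x
  proof -
    have "of_int \<lfloor>real N * x\<rfloor> / N - x = (of_int \<lfloor>real N * x\<rfloor> - real N * x) / N"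
      using assms by (simp add: field_simps)
    moreover have "\<bar>of_int \<lfloor>real N * x\<rfloor> - real N * x\<bar> \<le> 1" by linarith
    ultimately show ?thesis using assms by (simp add: abs_divide divide_right_mono)
  qed
  have "cmod (unround_grid N (round_grid N z) - z) \<le> \<bar>Re (unround_grid N (round_grid N z) - z)\<bar> + \<bar>Im (unround_grid N (round_grid N z) - z)\<bar>"
    by (rule cmod_le)
  also have "\<dots> \<le> 1 / N + 1 / N"
    using *[of "Re z"] *[of "Im z"] by (intro add_mono) (auto simp: unround_grid_def round_grid_def)
  finally show ?thesis by simp
qed

lemma dist_le_if_round_eq:
  assumes "0 < N" "round_grid N z = round_grid N w" shows "cmod (z - w) \<le> 4 / N"
proof -
  have "cmod (z - w) \<le> cmod (unround_grid N (round_grid N z) - z) + cmod (unround_grid N (round_grid N w) - w)"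
    using norm_triangle_ineq4[of "unround_grid N (round_grid N w) - w" "unround_grid N (round_grid N w) - z"] by (simp add: assms(2))
  with dist_unround_round[OF assms(1), of z] dist_unround_round[OF assms(1), of w] show ?thesis by simp
qed

definition grid_box :: "nat \<Rightarrow> (int \<times> int) set" where
  "grid_box K = {- int K..int K} \<times> {- int K..int K}"

lemma finite_grid_box [simp]: "finite (grid_box K)"
  by (simp add: grid_box_def)

lemma card_grid_box: "card (grid_box K) = (2 * K + 1)\<^sup>2"
proof -
  have "nat (2 * int K + 1) = 2 * K + 1" by simp
  then show ?thesis by (simp add: grid_box_def card_cartesian_product power2_eq_square)
qed

lemma round_in_box:
  assumes "cmod z \<le> real R" shows "round_grid N z \<in> grid_box (R * N)"
proof -
  have *: "\<bar>x\<bar> \<le> real R \<Longrightarrow> \<lfloor>real N * x\<rfloor> \<in> {- int (R * N)..int (R * N)}" for x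
  proof -
    assume x: "\<bar>x\<bar> \<le> real R"
    then have "real N * x \<le> real N * real R" "real N * - x \<le> real N * real R"
      by (intro mult_left_mono; simp)+
    then have "of_int (- int (R * N)) \<le> real N * x" "real N * x \<le> of_int (int (R * N))"
      by (simp_all add: mult.commute)
    then show ?thesis by (metis atLeastAtMost_iff floor_mono floor_of_int)
  qed
  have "\<bar>Re z\<bar> \<le> real R" "\<bar>Im z\<bar> \<le> real R" using assms abs_Re_le_cmod abs_Im_le_cmod order_trans by blast+
  then show ?thesis using *[of "Re z"] *[of "Im z"] by (auto simp: round_grid_def grid_box_def)
qed

text \<open>
  A number known up to an error less than \<open>q\<close> is determined by its residue modulo \<open>q\<close>.  In the count
  below this converts an approximate description into an exact one at the cost of a bounded factor.
\<close>

lemma eq_if_mod_eq_close: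
  fixes a b :: nat
  assumes "a mod q = b mod q" "\<bar>real a - real b\<bar> < real q"
  shows "a = b"
proof -
  have "int q dvd int a - int b" using assms(1) by (metis mod_eq_dvd_iff zmod_int)
  moreover have "\<bar>int a - int b\<bar> < int q" using assms(2) by linarith
  ultimately have "int a - int b = 0" using dvd_imp_le_int[of "int a - int b" "int q"] by linarith
  then show ?thesis by simp
qed

subsection \<open>Matrices with grid entries\<close>

text \<open>
  An element of \<open>grid r N\<close> stores, for each position, the numerators of the real and the imaginary part of an
  entry with denominator \<open>N\<close>.  The entries range over \<open>N\<^sup>2\<close> points of the unit square, so that counting
  powers of \<open>N\<close> counts real parameters.
\<close>

definition grid :: "nat \<Rightarrow> nat \<Rightarrow> (nat \<times> nat \<Rightarrow> nat \<times> nat) set" where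
  "grid r N = (\<Pi>\<^sub>E ij\<in>{..<r} \<times> {..<r}. {..<N} \<times> {..<N})"

definition grid_mat :: "nat \<Rightarrow> nat \<Rightarrow> (nat \<times> nat \<Rightarrow> nat \<times> nat) \<Rightarrow> complex mat" where
  "grid_mat r N g = mat r r (\<lambda>ij. Complex (real (fst (g ij)) / N) (real (snd (g ij)) / N))"

lemma gmat_carrier [simp]: "grid_mat r N g \<in> carrier_mat r r"
  by (simp add: grid_mat_def)

lemma gmat_dim [simp]: "dim_row (grid_mat r N g) = r" "dim_col (grid_mat r N g) = r"
  by (simp_all add: grid_mat_def)

lemma col_gmat_carrier [simp]: "col (grid_mat r N g) c \<in> carrier_vec r"
  using col_dim[of "grid_mat r N g" c] by simp

lemma card_grid: "card (grid r N) = N ^ (2 * r * r)"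
proof -
  have "card (grid r N) = (N * N) ^ (r * r)" by (simp add: grid_def card_PiE card_cartesian_product)
  also have "\<dots> = N ^ (2 * r * r)" by (simp add: power2_eq_square[symmetric] power_mult[symmetric] mult.assoc)
  finally show ?thesis .
qed

lemma finite_grid [simp]: "finite (grid r N)"
  by (simp add: grid_def finite_PiE)

lemma cmod_gmat:
  assumes "g \<in> grid r N" "i < r" "j < r" shows "cmod (grid_mat r N g $$ (i, j)) \<le> 2"
proof -
  have "g (i, j) \<in> {..<N} \<times> {..<N}" using assms by (auto simp: grid_def PiE_iff)
  then have "fst (g (i, j)) < N" "snd (g (i, j)) < N" by auto
  then have "real (fst (g (i, j))) / N \<le> 1" "real (snd (g (i, j))) / N \<le> 1" by (simp_all add: divide_le_eq)
  then show ?thesis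
    using cmod_le[of "grid_mat r N g $$ (i, j)"] assms by (simp add: grid_mat_def)
qed

lemma opnorm_gmat: "g \<in> grid r N \<Longrightarrow> mat_opnorm (grid_mat r N g) \<le> 2 * real r * real r"
proof -
  assume g: "g \<in> grid r N"
  have "mat_opnorm (grid_mat r N g) \<le> (\<Sum>i<r. \<Sum>j<r. cmod (grid_mat r N g $$ (i, j)))" by (rule mat_opnorm_le_sum) simp
  also have "\<dots> \<le> (\<Sum>i<r. \<Sum>j<r. 2)" by (intro sum_mono cmod_gmat[OF g]) auto
  finally show ?thesis by (simp add: mult.commute mult.left_commute)
qed

lemma cvec_norm_bound:
  assumes "\<And>k. k < dim_vec v \<Longrightarrow> cmod (v $ k) \<le> b"
  shows "cvec_norm v \<le> real (dim_vec v) * b"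
proof -
  have "cvec_norm v \<le> (\<Sum>i<dim_vec v. cmod (v $ i))" by (rule cvec_norm_le_sum)
  also have "\<dots> \<le> (\<Sum>i<dim_vec v. b)" by (rule sum_mono) (use assms in auto)
  finally show ?thesis by simp
qed

lemma cvec_norm_triangle3:
  assumes "v \<in> carrier_vec n" "w \<in> carrier_vec n" "u \<in> carrier_vec n"
  shows "cvec_norm (v - w) \<le> cvec_norm (v - u) + cvec_norm (u - w)"
proof -
  have "v - w = (v - u) + (u - w)" using assms by (intro eq_vecI) auto
  then show ?thesis using cvec_norm_triangle[of "v - u" n "u - w"] assms by (simp add: minus_carrier_vec)
qed

text \<open>
  This is how one column of a matrix can be recovered from the other columns and an approximate value at
  \<open>x\<close>, provided that the coordinate \<open>x $ c\<close> is not small.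
\<close>

lemma column_difference:
  fixes M M' :: "complex mat"
  assumes M: "M \<in> carrier_mat r r" "M' \<in> carrier_mat r r" and x: "x \<in> carrier_vec r"
    and c: "c < r" and diff: "\<And>i j. i < r \<Longrightarrow> j < r \<Longrightarrow> j \<noteq> c \<Longrightarrow> M $$ (i, j) = M' $$ (i, j)"
  shows "M *\<^sub>v x - M' *\<^sub>v x = x $ c \<cdot>\<^sub>v (col M c - col M' c)"
proof (rule eq_vecI)
  fix i assume "i < dim_vec (x $ c \<cdot>\<^sub>v (col M c - col M' c))"
  then have i: "i < r" using M by simp
  have "(M *\<^sub>v x - M' *\<^sub>v x) $ i = (\<Sum>j<r. M $$ (i, j) * x $ j) - (\<Sum>j<r. M' $$ (i, j) * x $ j)"
    using M x i mult_mat_vec_index[OF M(1) x i] mult_mat_vec_index[OF M(2) x i] by simp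
  also have "\<dots> = (\<Sum>j<r. (M $$ (i, j) - M' $$ (i, j)) * x $ j)"
    by (simp add: sum_subtractf left_diff_distrib)
  also have "\<dots> = (\<Sum>j<r. if j = c then (M $$ (i, c) - M' $$ (i, c)) * x $ c else 0)"
    using diff i by (intro sum.cong) auto
  also have "\<dots> = (M $$ (i, c) - M' $$ (i, c)) * x $ c" using c by simp
  finally show "(M *\<^sub>v x - M' *\<^sub>v x) $ i = (x $ c \<cdot>\<^sub>v (col M c - col M' c)) $ i"
    using M i c by (simp add: mult.commute)
qed (use M in auto)

subsection \<open>Counting\<close>

text \<open>
  The grid matrices that fail to be quantitatively injective somewhere: some unit vector in the range of
  \<open>f x\<close> is almost killed by \<open>e x\<close> after applying the matrix.
\<close>

definition bad_set :: "nat \<Rightarrow> nat \<Rightarrow> 'x set \<Rightarrow> ('x \<Rightarrow> bmat) \<Rightarrow> ('x \<Rightarrow> bmat) \<Rightarrow> (nat \<times> nat \<Rightarrow> nat \<times> nat) set" where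
  "bad_set r N X e f = {g \<in> grid r N. \<exists>x\<in>X. \<exists>\<xi>\<in>carrier_vec r. cvec_norm \<xi> = 1 \<and> act r (f x) \<xi> = \<xi> \<and>
     cvec_norm (act r (e x) (grid_mat r N g *\<^sub>v \<xi>)) < 1 / N}"

lemma power_pair_le:
  fixes N m r R :: nat
  assumes "1 \<le> N" "m \<le> r" shows "((2 * (R * N) + 1)\<^sup>2) ^ m \<le> (2 * R + 1) ^ (2 * r) * N ^ (2 * m)"
proof -
  have "2 * (R * N) + 1 \<le> (2 * R + 1) * N" using assms(1) by (simp add: algebra_simps)
  then have "((2 * (R * N) + 1)\<^sup>2) ^ m \<le> (((2 * R + 1) * N)\<^sup>2) ^ m" by (intro power_mono) auto
  also have "\<dots> = (2 * R + 1) ^ (2 * m) * N ^ (2 * m)"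
    by (simp only: power_mult[symmetric] power_mult_distrib)
  also have "\<dots> \<le> (2 * R + 1) ^ (2 * r) * N ^ (2 * m)"
    using assms(2) by (intro mult_right_mono power_increasing) auto
  finally show ?thesis .
qed

lemma rank_projection_le: "is_projection P \<Longrightarrow> vec_space.rank r (entry P r) \<le> r"
  by (rule vec_space.rank_le_nc[OF entry_carrier])

lemma rank_complement:
  assumes P: "is_projection P"
  shows "vec_space.rank r (entry (1 - P) r) = r - vec_space.rank r (entry P r)"
proof -
  have "of_nat r = (of_nat (vec_space.rank r (entry (1 - P) r)) + of_nat (vec_space.rank r (entry P r)) :: complex)"
    using trace_eq_rank[OF P, of r] trace_eq_rank[OF is_projection_compl[OF P], of r]
    by (simp only: tr_diff tr_one) (simp add: algebra_simps)
  then show ?thesis by (metis add_diff_cancel_right' of_nat_add of_nat_eq_iff)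
qed

text \<open>
  The dimension count behind general position.  The hypothesis on \<open>\<kappa>\<close> says that \<open>card (\<kappa> ` X)\<close> points form a
  \<open>1/N\<close>-net for the pair of families, so a bad matrix \<open>M\<close> satisfies, up to errors of order \<open>1/N\<close>, an equation
  \<open>e M v = 0\<close> with a net point and a rounded vector \<open>v\<close> in the range of \<open>f\<close>.  Let \<open>a\<close> and \<open>b\<close> be
  the ranks of \<open>e\<close> and \<open>f\<close>, and choose a coordinate \<open>c\<close> in which \<open>v\<close> is large.  Then \<open>M\<close> is determined by

  \<^item> the net point,
  \<^item> the coordinate \<open>c\<close>, with \<open>r\<close> choices,
  \<^item> the vector \<open>v\<close>, with about \<open>N\<close> to the power \<open>2 b\<close> choices,
  \<^item> the columns other than \<open>c\<close>, with \<open>N\<close> to the power \<open>2 r (r - 1)\<close> choices,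
  \<^item> the part of column \<open>c\<close> in the kernel of \<open>e\<close>, with about \<open>N\<close> to the power \<open>2 (r - a)\<close> choices,
  \<^item> bounded additional information, which removes the remaining error.

  The part of column \<open>c\<close> in the range of \<open>e\<close> is determined, up to an error of order \<open>1/N\<close>, by the approximate
  equation.  Since \<open>2 b + D + 1 \<le> 2 a\<close>, this leaves fewer than \<open>N\<close> to the power \<open>2 r\<^sup>2 - D\<close> choices for each
  net point, up to a constant.  The numbers \<open>q\<close> and \<open>N\<close> only have to exceed the explicit error bounds.
\<close>

lemma card_bad_set_le:
  fixes e f :: "'x \<Rightarrow> bmat" and \<kappa> :: "'x \<Rightarrow> 'k" and L :: real
  assumes r: "0 < r" and N: "1 \<le> N" and L: "0 \<le> L"
    and pe: "\<And>x. x \<in> X \<Longrightarrow> is_projection (e x)" and pf: "\<And>x. x \<in> X \<Longrightarrow> is_projection (f x)"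
    and rank: "\<And>x. x \<in> X \<Longrightarrow> 2 * vec_space.rank r (entry (f x) r) + D + 1 \<le> 2 * vec_space.rank r (entry (e x) r)"
    and fin: "finite (\<kappa> ` X)"
    and \<kappa>: "\<And>x y. x \<in> X \<Longrightarrow> y \<in> X \<Longrightarrow> \<kappa> x = \<kappa> y \<Longrightarrow> norm (e x - e y) \<le> L / N \<and> norm (f x - f y) \<le> L / N"
    and q: "(4 * real r * (2 * real r * real r * (L + 2 * real r * real r) + 2 * real r * real r * L + 1) + 4 * real r * real r) < real q"
    and large: "2 * (L + 2 * real r * real r) \<le> real N"
  shows "card (bad_set r N X e f) * N ^ (D + 1) \<le>
    card (\<kappa> ` X) * (r * (3 ^ (2 * r) * (4 * r + 1) ^ (2 * r) * q ^ (2 * r))) * N ^ (2 * r * r)"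
proof -
  define S where "S = \<kappa> ` X"
  define rep where "rep s = (SOME x. x \<in> X \<and> \<kappa> x = s)" for s
  have rep: "rep (\<kappa> x) \<in> X" "\<kappa> (rep (\<kappa> x)) = \<kappa> x" if "x \<in> X" for x
    using someI[of "\<lambda>y. y \<in> X \<and> \<kappa> y = \<kappa> x" x] that by (auto simp: rep_def)
  have repS: "s \<in> S \<Longrightarrow> rep s \<in> X" for s using rep by (auto simp: S_def)
  define a where "a s = vec_space.rank r (entry (e (rep s)) r)" for s
  define b where "b s = vec_space.rank r (entry (f (rep s)) r)" for s
  have ar: "s \<in> S \<Longrightarrow> a s \<le> r" and br: "s \<in> S \<Longrightarrow> b s \<le> r" for s
    using rank_projection_le pe pf repS by (auto simp: a_def b_def)
  have "\<forall>s\<in>S. \<exists>u. (\<forall>i. u i \<in> carrier_vec r \<and> cvec_norm (u i) \<le> 1) \<and>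
    (\<forall>v\<in>carrier_vec r. \<forall>k<r. act r (f (rep s)) v $ k = (\<Sum>i<b s. (v \<bullet>c u i) * u i $ k))"
    using projection_decomposition' pf repS by (auto simp: b_def)
  then obtain u where u: "\<And>s i. s \<in> S \<Longrightarrow> u s i \<in> carrier_vec r" "\<And>s i. s \<in> S \<Longrightarrow> cvec_norm (u s i) \<le> 1"
    "\<And>s v k. s \<in> S \<Longrightarrow> v \<in> carrier_vec r \<Longrightarrow> k < r \<Longrightarrow> act r (f (rep s)) v $ k = (\<Sum>i<b s. (v \<bullet>c u s i) * u s i $ k)"
    unfolding bchoice_iff by blast
  have "\<forall>s\<in>S. \<exists>u. (\<forall>i. u i \<in> carrier_vec r \<and> cvec_norm (u i) \<le> 1) \<and>
    (\<forall>v\<in>carrier_vec r. \<forall>k<r. act r (1 - e (rep s)) v $ k = (\<Sum>i<r - a s. (v \<bullet>c u i) * u i $ k))"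
    using projection_decomposition'[OF is_projection_compl[OF pe[OF repS]]] rank_complement[OF pe[OF repS]]
    by (auto simp: a_def)
  then obtain z where z: "\<And>s i. s \<in> S \<Longrightarrow> z s i \<in> carrier_vec r" "\<And>s i. s \<in> S \<Longrightarrow> cvec_norm (z s i) \<le> 1"
    "\<And>s v k. s \<in> S \<Longrightarrow> v \<in> carrier_vec r \<Longrightarrow> k < r \<Longrightarrow> act r (1 - e (rep s)) v $ k = (\<Sum>i<r - a s. (v \<bullet>c z s i) * z s i $ k)"
    unfolding bchoice_iff by blast
  define vc where "vc s t = vec r (\<lambda>k. \<Sum>i<b s. unround_grid N (t i) * u s i $ k)" for s t
  have vc [simp]: "vc s t \<in> carrier_vec r" "dim_vec (vc s t) = r" for s t by (simp_all add: vc_def)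
  define G where "G = 2 * real r * real r"
  define K1 where "K1 = L + 2 * real r * real r"
  define K2 where "K2 = G * K1 + G * L + 1"
  have K: "0 \<le> G" "0 \<le> K1" "0 \<le> K2" using L by (auto simp: G_def K1_def K2_def)
  \<comment> \<open>A pivot: a coordinate carrying at least the average share of the norm.\<close>
  define pc where "pc v = (SOME c. c < r \<and> cvec_norm v \<le> real r * cmod (v $ c))" for v :: "complex vec"
  have pc: "pc v < r \<and> cvec_norm v \<le> real r * cmod (v $ pc v)" if "v \<in> carrier_vec r" for v
    unfolding pc_def
  proof (rule someI_ex, rule ccontr)
    assume "\<not> (\<exists>c<r. cvec_norm v \<le> real r * cmod (v $ c))"
    then have "cmod (v $ c) < cvec_norm v / real r" if "c < r" for c
      using that r by (auto simp: field_simps not_le)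
    then have "(\<Sum>c<r. cmod (v $ c)) < (\<Sum>c<r. cvec_norm v / real r)"
      using r by (intro sum_strict_mono) auto
    then show False using cvec_norm_le_sum[of v] that r by simp
  qed
  \<comment> \<open>For every bad matrix a net point and a rounded vector that witness this.\<close>
  have witness: "\<exists>s t. s \<in> S \<and> t \<in> (\<Pi>\<^sub>E i\<in>{..<b s}. grid_box (1 * N)) \<and> 1/2 \<le> cvec_norm (vc s t) \<and>
      cvec_norm (act r (e (rep s)) (grid_mat r N g *\<^sub>v vc s t)) \<le> K2 / N" if g: "g \<in> bad_set r N X e f" for g
  proof -
    let ?M = "grid_mat r N g"
    from g obtain x \<xi> where gg: "g \<in> grid r N" and x: "x \<in> X" and \<xi>: "\<xi> \<in> carrier_vec r" "cvec_norm \<xi> = 1"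
      "act r (f x) \<xi> = \<xi>" "cvec_norm (act r (e x) (?M *\<^sub>v \<xi>)) < 1 / N"
      by (auto simp: bad_set_def)
    define s where "s = \<kappa> x"
    have s: "s \<in> S" using x by (simp add: s_def S_def)
    have near: "norm (e (rep s) - e x) \<le> L / N" "norm (f (rep s) - f x) \<le> L / N"
      using \<kappa>[OF rep(1)[OF x] x rep(2)[OF x]] by (auto simp: s_def)
    define t where "t = (\<lambda>i\<in>{..<b s}. round_grid N (\<xi> \<bullet>c u s i))"
    have t: "t \<in> (\<Pi>\<^sub>E i\<in>{..<b s}. grid_box (1 * N))"
    proof -
      have "round_grid N (\<xi> \<bullet>c u s i) \<in> grid_box (1 * N)" for i
      proof (rule round_in_box)
        have "cmod (\<xi> \<bullet>c u s i) \<le> cvec_norm \<xi> * cvec_norm (u s i)"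
          by (rule cauchy_schwarz_cvec[OF \<xi>(1) u(1)[OF s]])
        then show "cmod (\<xi> \<bullet>c u s i) \<le> real 1" using u(2)[OF s, of i] \<xi> by simp
      qed
      then show ?thesis by (auto simp: t_def)
    qed
    have d1: "cvec_norm (vc s t - act r (f (rep s)) \<xi>) \<le> real r * (2 * real r / N)"
    proof -
      have "cmod ((vc s t - act r (f (rep s)) \<xi>) $ k) \<le> 2 * real r / N" if k: "k < r" for k
      proof -
        have "(vc s t - act r (f (rep s)) \<xi>) $ k = (\<Sum>i<b s. (unround_grid N (t i) - \<xi> \<bullet>c u s i) * u s i $ k)"
          using k u(3)[OF s \<xi>(1) k] by (simp add: vc_def left_diff_distrib sum_subtractf)
        also have "cmod \<dots> \<le> (\<Sum>i<b s. 2 / N)"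
        proof (rule sum_norm_le)
          fix i assume i: "i \<in> {..<b s}"
          have "cmod (u s i $ k) \<le> 1"
            using cmod_index_le_cvec_norm[of k "u s i"] u(1,2)[OF s, of i] k by (auto intro: order_trans)
          moreover have "cmod (unround_grid N (t i) - \<xi> \<bullet>c u s i) \<le> 2 / N"
            using dist_unround_round[of N "\<xi> \<bullet>c u s i"] N i by (simp add: t_def)
          ultimately show "cmod ((unround_grid N (t i) - \<xi> \<bullet>c u s i) * u s i $ k) \<le> 2 / N"
            unfolding norm_mult using N by (metis mult.right_neutral mult_mono norm_ge_zero order_trans)
        qed
        also have "\<dots> \<le> 2 * real r / N" using br[OF s] by (simp add: divide_right_mono)
        finally show ?thesis .
      qed
      then show ?thesis using cvec_norm_bound[of "vc s t - act r (f (rep s)) \<xi>" "2 * real r / N"] by simp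
    qed
    have d2: "cvec_norm (act r (f (rep s)) \<xi> - \<xi>) \<le> L / N"
    proof -
      have "act r (f (rep s)) \<xi> - \<xi> = act r (f (rep s) - f x) \<xi>" using \<xi> by (simp add: act_diff)
      then show ?thesis using cvec_norm_act[OF \<xi>(1), of "f (rep s) - f x"] near(2) \<xi>(2) by simp
    qed
    have d3: "cvec_norm (vc s t - \<xi>) \<le> K1 / N"
      using cvec_norm_triangle3[of "vc s t" r \<xi> "act r (f (rep s)) \<xi>"] d1 d2 \<xi>(1)
      by (simp add: K1_def add_divide_distrib mult.assoc mult.left_commute)
    have "1 \<le> cvec_norm (\<xi> - vc s t) + cvec_norm (vc s t)"
    proof -
      have "\<xi> = (\<xi> - vc s t) + vc s t"
        using carrier_vecD[OF \<xi>(1)] by (intro eq_vecI) simp_all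
      then show ?thesis
        using cvec_norm_triangle[of "\<xi> - vc s t" r "vc s t"] \<xi>(1,2) by (simp add: minus_carrier_vec)
    qed
    moreover have "cvec_norm (\<xi> - vc s t) = cvec_norm (vc s t - \<xi>)"
    proof -
      have "\<xi> - vc s t = (-1) \<cdot>\<^sub>v (vc s t - \<xi>)"
        using carrier_vecD[OF \<xi>(1)] by (intro eq_vecI) simp_all
      then show ?thesis by (simp add: cvec_norm_smult)
    qed
    moreover have "K1 / N \<le> 1/2" using large N by (simp add: K1_def field_simps)
    ultimately have half: "1/2 \<le> cvec_norm (vc s t)" using d3 by linarith
    have M\<xi>: "?M *\<^sub>v \<xi> \<in> carrier_vec r" "?M *\<^sub>v vc s t \<in> carrier_vec r" 
      using \<xi>(1) vc mult_mat_vec_carrier[OF gmat_carrier] by blast+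
    have Mop: "cvec_norm (?M *\<^sub>v v) \<le> G * cvec_norm v" if "v \<in> carrier_vec r" for v
      unfolding G_def
      by (rule order_trans[OF cvec_norm_mult_mat_vec[OF gmat_carrier that] mult_right_mono[OF opnorm_gmat[OF gg]]]) simp
    have "act r (e (rep s)) (?M *\<^sub>v vc s t) =
        act r (e (rep s)) (?M *\<^sub>v (vc s t - \<xi>)) + (act r (e (rep s) - e x) (?M *\<^sub>v \<xi>) + act r (e x) (?M *\<^sub>v \<xi>))"
      using \<xi>(1) M\<xi> by (intro eq_vecI) (auto simp: act_diff mult_minus_distrib_mat_vec[OF gmat_carrier vc(1) \<xi>(1)] act_vec_diff)
    then have tri: "cvec_norm (act r (e (rep s)) (?M *\<^sub>v vc s t)) \<le> cvec_norm (act r (e (rep s)) (?M *\<^sub>v (vc s t - \<xi>))) +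
        (cvec_norm (act r (e (rep s) - e x) (?M *\<^sub>v \<xi>)) + cvec_norm (act r (e x) (?M *\<^sub>v \<xi>)))"
      using cvec_norm_triangle[of "act r (e (rep s)) (?M *\<^sub>v (vc s t - \<xi>))" r
          "act r (e (rep s) - e x) (?M *\<^sub>v \<xi>) + act r (e x) (?M *\<^sub>v \<xi>)"]
        cvec_norm_triangle[of "act r (e (rep s) - e x) (?M *\<^sub>v \<xi>)" r "act r (e x) (?M *\<^sub>v \<xi>)"]
      by simp
    have wv: "vc s t - \<xi> \<in> carrier_vec r" using \<xi>(1) by simp
    have "cvec_norm (?M *\<^sub>v (vc s t - \<xi>)) \<le> G * (K1 / N)"
      by (rule order_trans[OF Mop[OF wv] mult_left_mono[OF d3 K(1)]])
    then have "norm (e (rep s)) * cvec_norm (?M *\<^sub>v (vc s t - \<xi>)) \<le> 1 * (G * (K1 / N))"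
      using norm_projection_le[OF pe[OF repS[OF s]]] by (intro mult_mono) auto
    then have t1: "cvec_norm (act r (e (rep s)) (?M *\<^sub>v (vc s t - \<xi>))) \<le> G * (K1 / N)"
      using cvec_norm_act[of "?M *\<^sub>v (vc s t - \<xi>)" r "e (rep s)"] mult_mat_vec_carrier[OF gmat_carrier wv] by simp
    have "cvec_norm (?M *\<^sub>v \<xi>) \<le> G" using Mop[OF \<xi>(1)] \<xi>(2) by simp
    then have "norm (e (rep s) - e x) * cvec_norm (?M *\<^sub>v \<xi>) \<le> (L / N) * G"
      using near(1) L by (intro mult_mono) auto
    then have t2: "cvec_norm (act r (e (rep s) - e x) (?M *\<^sub>v \<xi>)) \<le> (L / N) * G"
      using cvec_norm_act[OF M\<xi>(1), of "e (rep s) - e x"] by simp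
    have "G * (K1 / N) + ((L / N) * G + 1 / N) = K2 / N"
      by (simp add: K2_def add_divide_distrib mult.commute)
    then have "cvec_norm (act r (e (rep s)) (?M *\<^sub>v vc s t)) \<le> K2 / N" using tri t1 t2 \<xi>(4) by linarith
    with s t half show ?thesis by blast
  qed
  then obtain sw tw where w: "\<And>g. g \<in> bad_set r N X e f \<Longrightarrow> sw g \<in> S"
    "\<And>g. g \<in> bad_set r N X e f \<Longrightarrow> tw g \<in> (\<Pi>\<^sub>E i\<in>{..<b (sw g)}. grid_box (1 * N))"
    "\<And>g. g \<in> bad_set r N X e f \<Longrightarrow> 1/2 \<le> cvec_norm (vc (sw g) (tw g))"
    "\<And>g. g \<in> bad_set r N X e f \<Longrightarrow> cvec_norm (act r (e (rep (sw g))) (grid_mat r N g *\<^sub>v vc (sw g) (tw g))) \<le> K2 / N"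
    by metis
  define cw where "cw g = pc (vc (sw g) (tw g))" for g
  have cw: "cw g < r" for g using pc[of "vc (sw g) (tw g)"] by (simp add: cw_def)
  \<comment> \<open>The components of the key: the columns other than \<open>cw g\<close>, the rounded coordinates of the column
    \<open>cw g\<close> in the kernel of the projection, and the residues of its numerators.\<close>
  define off where "off g = restrict g ({..<r} \<times> ({..<r} - {cw g}))" for g
  define prj where "prj g = (\<lambda>i\<in>{..<r - a (sw g)}. round_grid N (col (grid_mat r N g) (cw g) \<bullet>c z (sw g) i))" for g
  define rho where "rho g = (\<lambda>i\<in>{..<r}. (fst (g (i, cw g)) mod q, snd (g (i, cw g)) mod q))" for g
  define key where "key g = (sw g, cw g, tw g, off g, prj g, rho g)" for g
  have "0 \<le> 4 * real r * K2 + 4 * real r * real r" using K by simp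
  then have q0: "0 < q" using q unfolding K2_def K1_def G_def by linarith
  define Key where "Key = (SIGMA s:S. SIGMA c:{..<r}. (\<Pi>\<^sub>E i\<in>{..<b s}. grid_box (1 * N)) \<times>
      (\<Pi>\<^sub>E ij\<in>{..<r} \<times> ({..<r} - {c}). {..<N} \<times> {..<N}) \<times> (\<Pi>\<^sub>E i\<in>{..<r - a s}. grid_box (2 * r * N)) \<times>
      (\<Pi>\<^sub>E i\<in>{..<r}. {..<q} \<times> {..<q}))"
  have gr: "g \<in> bad_set r N X e f \<Longrightarrow> g \<in> grid r N" for g by (simp add: bad_set_def)
  have colbound: "cmod (col (grid_mat r N g) c \<bullet>c z s i) \<le> real (2 * r)" if "g \<in> grid r N" "c < r" "s \<in> S" for g c s i
  proof -
    have "cvec_norm (col (grid_mat r N g) c) \<le> real (dim_vec (col (grid_mat r N g) c)) * 2"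
      by (rule cvec_norm_bound) (use that cmod_gmat[OF that(1)] in \<open>auto simp: grid_mat_def\<close>)
    then have *: "cvec_norm (col (grid_mat r N g) c) \<le> real (2 * r)" by (simp add: grid_mat_def)
    have "cmod (col (grid_mat r N g) c \<bullet>c z s i) \<le> cvec_norm (col (grid_mat r N g) c) * cvec_norm (z s i)"
      by (rule cauchy_schwarz_cvec[of _ r]) (use z(1) that in auto)
    also have "\<dots> \<le> real (2 * r) * 1" using * z(2)[OF that(3)] by (intro mult_mono) auto
    finally show ?thesis by simp
  qed
  have keyK: "key ` bad_set r N X e f \<subseteq> Key"
  proof
    fix k assume "k \<in> key ` bad_set r N X e f"
    then obtain g where g: "g \<in> bad_set r N X e f" "k = key g" by blast
    have "off g \<in> (\<Pi>\<^sub>E ij\<in>{..<r} \<times> ({..<r} - {cw g}). {..<N} \<times> {..<N})"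
      using gr[OF g(1)] unfolding off_def grid_def by (auto simp: PiE_iff restrict_def extensional_def)
    moreover have "prj g \<in> (\<Pi>\<^sub>E i\<in>{..<r - a (sw g)}. grid_box (2 * r * N))"
      unfolding prj_def using round_in_box[OF colbound[OF gr[OF g(1)] cw w(1)[OF g(1)]]] by auto
    moreover have "rho g \<in> (\<Pi>\<^sub>E i\<in>{..<r}. {..<q} \<times> {..<q})" unfolding rho_def using q0 by auto
    ultimately show "k \<in> Key" using g w(1,2) cw by (auto simp: key_def Key_def)
  qed
  have inj: "inj_on key (bad_set r N X e f)"
  proof (rule inj_onI)
    fix g g' assume g: "g \<in> bad_set r N X e f" and g': "g' \<in> bad_set r N X e f" and "key g = key g'"
    then have eq: "sw g' = sw g" "cw g' = cw g" "tw g' = tw g" "off g = off g'" "prj g = prj g'" "rho g = rho g'"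
      by (auto simp: key_def)
    define s where "s = sw g"
    define c where "c = cw g"
    define v where "v = vc (sw g) (tw g)"
    have s: "s \<in> S" using w(1)[OF g] by (simp add: s_def)
    have c: "c < r" using cw by (simp add: c_def)
    have v: "v \<in> carrier_vec r" by (simp add: v_def)
    have vcc: "1 / (2 * real r) \<le> cmod (v $ c)"
    proof -
      have "cvec_norm v \<le> real r * cmod (v $ c)" using pc[OF v] by (simp add: c_def cw_def v_def)
      then show ?thesis using w(3)[OF g] r by (simp add: v_def field_simps)
    qed
    let ?M = "grid_mat r N g" and ?M' = "grid_mat r N g'"
    define \<mu> where "\<mu> = col ?M c - col ?M' c"
    have \<mu>: "\<mu> \<in> carrier_vec r" by (simp add: \<mu>_def)
    have offg: "g (i, j) = g' (i, j)" if "i < r" "j < r" "j \<noteq> c" for i j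
      using fun_cong[OF eq(4), of "(i, j)"] that by (simp add: off_def eq c_def)
    have diff: "?M *\<^sub>v v - ?M' *\<^sub>v v = v $ c \<cdot>\<^sub>v \<mu>"
      unfolding \<mu>_def by (rule column_difference[OF _ _ v c]) (auto simp: grid_mat_def offg)
    have Mv: "?M *\<^sub>v v \<in> carrier_vec r" "?M' *\<^sub>v v \<in> carrier_vec r"
      using v mult_mat_vec_carrier[OF gmat_carrier] by blast+
    have "cmod (v $ c) * cvec_norm (act r (e (rep s)) \<mu>) = cvec_norm (act r (e (rep s)) (v $ c \<cdot>\<^sub>v \<mu>))"
      using \<mu> by (simp add: act_smult cvec_norm_smult)
    also have "\<dots> = cvec_norm (act r (e (rep s)) (?M *\<^sub>v v) - act r (e (rep s)) (?M' *\<^sub>v v))"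
      unfolding diff[symmetric] using Mv by (simp add: act_vec_diff)
    also have "\<dots> \<le> cvec_norm (act r (e (rep s)) (?M *\<^sub>v v)) + cvec_norm (act r (e (rep s)) (?M' *\<^sub>v v))"
      by (rule cvec_norm_triangle_minus[of _ r]) auto
    also have "\<dots> \<le> K2 / N + K2 / N" using w(4)[OF g] w(4)[OF g'] by (simp add: s_def v_def eq)
    finally have "1 / (2 * real r) * cvec_norm (act r (e (rep s)) \<mu>) \<le> 2 * K2 / N"
      using mult_right_mono[OF vcc, of "cvec_norm (act r (e (rep s)) \<mu>)"] by simp
    then have e1: "cvec_norm (act r (e (rep s)) \<mu>) \<le> 4 * real r * K2 / N" using r by (simp add: field_simps)
    have e2: "cvec_norm (act r (1 - e (rep s)) \<mu>) \<le> real r * (4 * real r / N)"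
    proof -
      have "cmod (act r (1 - e (rep s)) \<mu> $ k) \<le> 4 * real r / N" if k: "k < r" for k
      proof -
        have "act r (1 - e (rep s)) \<mu> $ k = (\<Sum>i<r - a s. (\<mu> \<bullet>c z s i) * z s i $ k)" by (rule z(3)[OF s \<mu> k])
        also have "cmod \<dots> \<le> (\<Sum>i<r - a s. 4 / N)"
        proof (rule sum_norm_le)
          fix i assume i: "i \<in> {..<r - a s}"
          have "cmod (z s i $ k) \<le> 1"
            using cmod_index_le_cvec_norm[of k "z s i"] z(1,2)[OF s, of i] k by (auto intro: order_trans)
          moreover have "\<mu> \<bullet>c z s i = col ?M c \<bullet>c z s i - col ?M' c \<bullet>c z s i"
            unfolding \<mu>_def by (rule minus_scalar_prod_distrib[of _ r]) (use z(1)[OF s, of i] in auto)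
          moreover have "round_grid N (col ?M c \<bullet>c z s i) = round_grid N (col ?M' c \<bullet>c z s i)"
            using fun_cong[OF eq(5), of i] i by (simp add: prj_def eq s_def c_def)
          ultimately have "cmod (\<mu> \<bullet>c z s i) \<le> 4 / N" "cmod (z s i $ k) \<le> 1" using dist_le_if_round_eq[of N] N by auto
          then show "cmod ((\<mu> \<bullet>c z s i) * z s i $ k) \<le> 4 / N"
            unfolding norm_mult by (metis mult.right_neutral mult_mono norm_ge_zero order_trans)
        qed
        also have "\<dots> \<le> 4 * real r / N" by (simp add: divide_right_mono)
        finally show ?thesis .
      qed
      then show ?thesis using cvec_norm_bound[of "act r (1 - e (rep s)) \<mu>" "4 * real r / N"] by simp
    qed
    have "\<mu> = act r (e (rep s)) \<mu> + act r (1 - e (rep s)) \<mu>"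
      unfolding act_add[OF \<mu>, symmetric] using \<mu> by simp
    then have "cvec_norm \<mu> \<le> cvec_norm (act r (e (rep s)) \<mu>) + cvec_norm (act r (1 - e (rep s)) \<mu>)"
      using cvec_norm_triangle[of "act r (e (rep s)) \<mu>" r "act r (1 - e (rep s)) \<mu>"] by simp
    also have "\<dots> \<le> (4 * real r * K2 + 4 * real r * real r) / N"
      using e1 e2 by (simp add: add_divide_distrib mult.commute mult.left_commute)
    finally have \<mu>le: "cvec_norm \<mu> \<le> (4 * real r * K2 + 4 * real r * real r) / N" .
    have qq: "4 * real r * K2 + 4 * real r * real r < real q"
      using q by (simp add: K2_def K1_def G_def)
    have colg: "g (i, c) = g' (i, c)" if i: "i < r" for i
    proof -
      have \<mu>i: "\<mu> $ i = Complex ((real (fst (g (i, c))) - real (fst (g' (i, c)))) / N) ((real (snd (g (i, c))) - real (snd (g' (i, c)))) / N)"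
        using i c by (simp add: \<mu>_def grid_mat_def complex_eq_iff diff_divide_distrib)
      have "cmod (\<mu> $ i) \<le> (4 * real r * K2 + 4 * real r * real r) / N"
        using cmod_index_le_cvec_norm[of i \<mu>] \<mu> i \<mu>le by simp
      then have "\<bar>(real (fst (g (i, c))) - real (fst (g' (i, c)))) / N\<bar> \<le> (4 * real r * K2 + 4 * real r * real r) / N"
        "\<bar>(real (snd (g (i, c))) - real (snd (g' (i, c)))) / N\<bar> \<le> (4 * real r * K2 + 4 * real r * real r) / N"
        using abs_Re_le_cmod[of "\<mu> $ i"] abs_Im_le_cmod[of "\<mu> $ i"] unfolding \<mu>i by auto
      then have cl: "\<bar>real (fst (g (i, c))) - real (fst (g' (i, c)))\<bar> < real q" "\<bar>real (snd (g (i, c))) - real (snd (g' (i, c)))\<bar> < real q"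
        using N qq by (auto simp: abs_divide divide_le_cancel)
      have md: "fst (g (i, c)) mod q = fst (g' (i, c)) mod q" "snd (g (i, c)) mod q = snd (g' (i, c)) mod q"
        using fun_cong[OF eq(6), of i] i by (auto simp: rho_def eq c_def)
      have "fst (g (i, c)) = fst (g' (i, c))" "snd (g (i, c)) = snd (g' (i, c))"
        using eq_if_mod_eq_close[OF md(1) cl(1)] eq_if_mod_eq_close[OF md(2) cl(2)] by auto
      then show ?thesis by (rule prod_eqI)
    qed
    show "g = g'"
    proof
      fix ij :: "nat \<times> nat"
      show "g ij = g' ij"
      proof (cases "ij \<in> {..<r} \<times> {..<r}")
        case True
        then obtain i j where ij: "ij = (i, j)" "i < r" "j < r" by auto
        show ?thesis unfolding ij(1) using offg[OF ij(2,3)] colg[OF ij(2)] by (cases "j = c") simp_all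
      next
        case False
        then show ?thesis
          using PiE_arb[OF gr[OF g, unfolded grid_def] False] PiE_arb[OF gr[OF g', unfolded grid_def] False] by simp
      qed
    qed
  qed
  have S: "finite S" using fin by (simp add: S_def)
  let ?C = "3 ^ (2 * r) * (4 * r + 1) ^ (2 * r) * q ^ (2 * r)"
  have finKey: "finite Key" unfolding Key_def by (intro finite_SigmaI finite_PiE finite_cartesian_product S) auto
  have "card (bad_set r N X e f) \<le> card Key" by (rule card_inj_on_le[OF inj keyK finKey])
  also have "card Key = (\<Sum>s\<in>S. \<Sum>c<r. ((2 * (1 * N) + 1)\<^sup>2) ^ b s * ((N * N) ^ (r * (r - 1)) *
       (((2 * (2 * r * N) + 1)\<^sup>2) ^ (r - a s) * (q * q) ^ r)))"
  proof -
    define B where "B s c = (\<Pi>\<^sub>E i\<in>{..<b s}. grid_box (1 * N)) \<times>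
      (\<Pi>\<^sub>E ij\<in>{..<r} \<times> ({..<r} - {c}). {..<N} \<times> {..<N}) \<times> (\<Pi>\<^sub>E i\<in>{..<r - a s}. grid_box (2 * r * N)) \<times>
      (\<Pi>\<^sub>E i\<in>{..<r}. {..<q} \<times> {..<q})" for s c
    have fc: "finite (B s c)" for s c
      unfolding B_def by (intro finite_PiE finite_cartesian_product) auto
    have cc: "card (B s c) = ((2 * (1 * N) + 1)\<^sup>2) ^ b s * ((N * N) ^ (r * (r - 1)) *
       (((2 * (2 * r * N) + 1)\<^sup>2) ^ (r - a s) * (q * q) ^ r))" if "c < r" for s c
      unfolding B_def using that by (simp add: card_cartesian_product card_PiE card_grid_box)
    have c2: "card (SIGMA c:{..<r}. B s c) = (\<Sum>c<r. card (B s c))" for s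
      by (rule card_SigmaI) (auto simp: fc)
    have "card Key = card (SIGMA s:S. SIGMA c:{..<r}. B s c)" by (simp add: Key_def B_def)
    also have "\<dots> = (\<Sum>s\<in>S. card (SIGMA c:{..<r}. B s c))"
      by (rule card_SigmaI[OF S]) (intro ballI finite_SigmaI fc finite_lessThan)
    finally show ?thesis unfolding c2 using cc by simp
  qed
  finally have c1: "card (bad_set r N X e f) \<le> (\<Sum>s\<in>S. \<Sum>c<r. ((2 * (1 * N) + 1)\<^sup>2) ^ b s * ((N * N) ^ (r * (r - 1)) *
       (((2 * (2 * r * N) + 1)\<^sup>2) ^ (r - a s) * (q * q) ^ r)))" .
  have le_term: "((2 * (1 * N) + 1)\<^sup>2) ^ b s * ((N * N) ^ (r * (r - 1)) *
       (((2 * (2 * r * N) + 1)\<^sup>2) ^ (r - a s) * (q * q) ^ r)) * N ^ (D + 1) \<le> ?C * N ^ (2 * r * r)" if s: "s \<in> S" for s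
  proof -
    have "((2 * (1 * N) + 1)\<^sup>2) ^ b s \<le> (2 * 1 + 1) ^ (2 * r) * N ^ (2 * b s)"
      by (rule power_pair_le[OF N br[OF s]])
    moreover have "((2 * (2 * r * N) + 1)\<^sup>2) ^ (r - a s) \<le> (2 * (2 * r) + 1) ^ (2 * r) * N ^ (2 * (r - a s))"
      by (rule power_pair_le[OF N]) simp
    ultimately have "((2 * (1 * N) + 1)\<^sup>2) ^ b s * ((N * N) ^ (r * (r - 1)) *
       (((2 * (2 * r * N) + 1)\<^sup>2) ^ (r - a s) * (q * q) ^ r)) * N ^ (D + 1) \<le>
       ((2 * 1 + 1) ^ (2 * r) * N ^ (2 * b s)) * ((N * N) ^ (r * (r - 1)) *
       (((2 * (2 * r) + 1) ^ (2 * r) * N ^ (2 * (r - a s))) * (q * q) ^ r)) * N ^ (D + 1)"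
      by (intro mult_mono) auto
    also have "\<dots> = ?C * (N ^ (2 * b s) * N ^ (2 * (r * (r - 1))) * N ^ (2 * (r - a s)) * N ^ (D + 1))"
    proof -
      have "(q * q) ^ r = q ^ (2 * r)" "(N * N) ^ (r * (r - 1)) = N ^ (2 * (r * (r - 1)))"
        by (simp_all only: power2_eq_square[symmetric] power_mult[symmetric])
      then show ?thesis by (simp add: mult_ac)
    qed
    also have "N ^ (2 * b s) * N ^ (2 * (r * (r - 1))) * N ^ (2 * (r - a s)) * N ^ (D + 1) =
        N ^ (2 * b s + 2 * (r * (r - 1)) + 2 * (r - a s) + (D + 1))" by (simp add: power_add)
    also have "\<dots> \<le> N ^ (2 * r * r)"
    proof (rule power_increasing[OF _ N])
      have "2 * b s + D + 1 \<le> 2 * a s" using rank[OF repS[OF s]] by (simp add: a_def b_def)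
      moreover have "r * (r - 1) + r = r * r" using r by (cases r) auto
      ultimately show "2 * b s + 2 * (r * (r - 1)) + 2 * (r - a s) + (D + 1) \<le> 2 * r * r"
        using ar[OF s] by simp
    qed
    finally show ?thesis by simp
  qed
  have "card (bad_set r N X e f) * N ^ (D + 1) \<le> (\<Sum>s\<in>S. \<Sum>c<r. ((2 * (1 * N) + 1)\<^sup>2) ^ b s * ((N * N) ^ (r * (r - 1)) *
       (((2 * (2 * r * N) + 1)\<^sup>2) ^ (r - a s) * (q * q) ^ r))) * N ^ (D + 1)"
    by (rule mult_right_mono[OF c1]) simp
  also have "\<dots> \<le> (\<Sum>s\<in>S. \<Sum>c<r. ?C * N ^ (2 * r * r))"
    unfolding sum_distrib_right by (intro sum_mono le_term)
  finally show ?thesis by (simp add: S_def mult_ac)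
qed

text \<open>
  If \<open>X\<close> has at most \<open>C N\<^sup>D\<close> classes at scale \<open>1/N\<close>, then the fraction of bad grid matrices is at most
  a constant times \<open>1/N\<close>, where the constant does not depend on \<open>N\<close>.  So for large \<open>N\<close> some matrix is not bad.
  The rank condition is the usual one, \<open>2 (rk e - rk f) > D\<close>, for real dimension \<open>D\<close>.
\<close>

theorem general_position:
  fixes e f :: "'x \<Rightarrow> bmat" and \<kappa> :: "nat \<Rightarrow> 'x \<Rightarrow> 'k" and L :: real
  assumes L: "0 \<le> L"
    and pe: "\<And>x. x \<in> X \<Longrightarrow> is_projection (e x)" and pf: "\<And>x. x \<in> X \<Longrightarrow> is_projection (f x)"
    and rank: "\<And>x. x \<in> X \<Longrightarrow> 2 * vec_space.rank r (entry (f x) r) + D + 1 \<le> 2 * vec_space.rank r (entry (e x) r)"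
    and fin: "\<And>N. 1 \<le> N \<Longrightarrow> finite (\<kappa> N ` X)" and card: "\<And>N. 1 \<le> N \<Longrightarrow> card (\<kappa> N ` X) \<le> C * N ^ D"
    and \<kappa>: "\<And>N x y. 1 \<le> N \<Longrightarrow> x \<in> X \<Longrightarrow> y \<in> X \<Longrightarrow> \<kappa> N x = \<kappa> N y \<Longrightarrow>
        norm (e x - e y) \<le> L / N \<and> norm (f x - f y) \<le> L / N"
  shows "\<exists>M\<in>carrier_mat r r. \<exists>c>0. \<forall>x\<in>X. \<forall>\<xi>\<in>carrier_vec r. act r (f x) \<xi> = \<xi> \<longrightarrow>
    c * cvec_norm \<xi> \<le> cvec_norm (act r (e x) (M *\<^sub>v \<xi>))"
proof (cases "r = 0")
  case True
  then show ?thesis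
    by (intro bexI[of _ "1\<^sub>m r"] exI[of _ 1]) (auto simp: cvec_norm_L2)
next
  case False
  then have r: "0 < r" by simp
  obtain q :: nat where q: "4 * real r * (2 * real r * real r * (L + 2 * real r * real r) + 2 * real r * real r * L + 1) + 4 * real r * real r < real q"
    using reals_Archimedean2 by blast
  define B where "B = r * (3 ^ (2 * r) * (4 * r + 1) ^ (2 * r) * q ^ (2 * r))"
  obtain N1 :: nat where N1: "2 * (L + 2 * real r * real r) \<le> real N1" using real_arch_simple by blast
  define N where "N = max (max 1 N1) (C * B + 1)"
  have N: "1 \<le> N" "2 * (L + 2 * real r * real r) \<le> real N" "C * B < N" using N1 by (auto simp: N_def)
  have "card (bad_set r N X e f) * N ^ (D + 1) \<le> card (\<kappa> N ` X) * B * N ^ (2 * r * r)"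
    unfolding B_def
    by (rule card_bad_set_le[OF r N(1) L pe pf rank fin[OF N(1)] \<kappa>[OF N(1)] q N(2)])
  also have "\<dots> \<le> (C * N ^ D) * B * N ^ (2 * r * r)" using card[OF N(1)] by (intro mult_right_mono) auto
  also have "\<dots> < N ^ (D + 1) * N ^ (2 * r * r)"
  proof -
    have "C * B * (N ^ D * N ^ (2 * r * r)) < N * (N ^ D * N ^ (2 * r * r))"
      using N by (intro mult_strict_right_mono) auto
    then show ?thesis by (simp add: mult_ac)
  qed
  finally have "card (bad_set r N X e f) < card (grid r N)"
    unfolding card_grid by (simp add: mult.commute[of _ "N ^ (D + 1)"] del: power_Suc)
  then obtain g where g: "g \<in> grid r N" "g \<notin> bad_set r N X e f"
  proof -
    have "bad_set r N X e f \<noteq> grid r N" "bad_set r N X e f \<subseteq> grid r N"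
      using \<open>card (bad_set r N X e f) < card (grid r N)\<close> by (auto simp: bad_set_def)
    then show ?thesis using that by blast
  qed
  show ?thesis
  proof (intro bexI[of _ "grid_mat r N g"] exI[of _ "1 / N"] conjI ballI impI)
    show "0 < 1 / real N" using N by simp
    fix x \<xi> assume x: "x \<in> X" "\<xi> \<in> carrier_vec r" "act r (f x) \<xi> = \<xi>"
    show "1 / real N * cvec_norm \<xi> \<le> cvec_norm (act r (e x) (grid_mat r N g *\<^sub>v \<xi>))"
    proof (cases "cvec_norm \<xi> = 0")
      case False
      define n where "n = cvec_norm \<xi>"
      have n: "n > 0" using False cvec_norm_nonneg[of \<xi>] unfolding n_def by linarith
      let ?w = "of_real (1 / n) \<cdot>\<^sub>v \<xi>"
      have "cvec_norm ?w = 1" using n by (simp add: cvec_norm_smult norm_divide) (simp add: n_def)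
      moreover have "act r (f x) ?w = ?w" using x by (simp add: act_smult)
      moreover have "?w \<in> carrier_vec r" using x by simp
      ultimately have "1 / N \<le> cvec_norm (act r (e x) (grid_mat r N g *\<^sub>v ?w))"
        using g x(1) by (auto simp: bad_set_def not_less)
      also have "act r (e x) (grid_mat r N g *\<^sub>v ?w) = of_real (1 / n) \<cdot>\<^sub>v act r (e x) (grid_mat r N g *\<^sub>v \<xi>)"
      proof -
        have "grid_mat r N g *\<^sub>v \<xi> \<in> carrier_vec r" using x(2) mult_mat_vec_carrier[OF gmat_carrier] by blast
        then show ?thesis by (simp add: mult_mat_vec[OF gmat_carrier x(2)] act_smult)
      qed
      finally show ?thesis using n by (simp add: cvec_norm_smult norm_divide field_simps n_def)
    qed simp
  qed simp
qed

section \<open>Comparison over a space with a cover of small order\<close>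

subsection \<open>Partitions of unity\<close>

text \<open>
  A compact Hausdorff space is completely regular, so each point has a bump function supported in a member of the
  cover.  Finitely many of them have positive sum; they are grouped by members and normalized.
\<close>

lemma partition_of_unity:
  assumes T: "compact_space T" "Hausdorff_space T" and \<beta>: "finite_open_cover T \<beta>"
  shows "\<exists>\<phi> :: 'x set \<Rightarrow> 'x \<Rightarrow> real. (\<forall>U\<in>\<beta>. continuous_map T euclideanreal (\<phi> U)) \<and>
    (\<forall>U\<in>\<beta>. \<forall>x\<in>topspace T. 0 \<le> \<phi> U x \<and> (\<phi> U x \<noteq> 0 \<longrightarrow> x \<in> U)) \<and> (\<forall>x\<in>topspace T. (\<Sum>U\<in>\<beta>. \<phi> U x) = 1)"
proof -
  have fin: "finite \<beta>" and op: "\<And>U. U \<in> \<beta> \<Longrightarrow> openin T U" and cov: "\<Union>\<beta> = topspace T"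
    using \<beta> by (auto simp: finite_open_cover_def)
  have cr: "completely_regular_space T"
    using T by (simp add: compact_Hausdorff_or_regular_imp_normal_space normal_imp_completely_regular_space_A Hausdorff_imp_t1_space)
  have "\<exists>U g. U \<in> \<beta> \<and> continuous_map T euclideanreal g \<and> 0 < g x \<and> (\<forall>y\<in>topspace T. 0 \<le> g y \<and> (g y \<noteq> 0 \<longrightarrow> y \<in> U))"
    if x: "x \<in> topspace T" for x
  proof -
    obtain U where U: "U \<in> \<beta>" "x \<in> U" using cov x by blast
    have "closedin T (topspace T - U)" "x \<in> topspace T - (topspace T - U)" using op[OF U(1)] U x by auto
    then obtain f :: "'x \<Rightarrow> real" where f: "continuous_map T (top_of_set {0..1}) f" "f x = 0" "f ` (topspace T - U) \<subseteq> {1}"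
      using cr unfolding completely_regular_space_def by meson
    have f': "continuous_map T euclideanreal f" "\<And>y. y \<in> topspace T \<Longrightarrow> f y \<le> 1"
      using f(1) by (auto simp: continuous_map_in_subtopology)
    have "continuous_map T euclideanreal (\<lambda>y. 1 - f y)" by (intro continuous_intros f')
    then show ?thesis using U f f'(2) by (intro exI[of _ U] exI[of _ "\<lambda>y. 1 - f y"]) force
  qed
  then obtain Us g where g: "\<And>x. x \<in> topspace T \<Longrightarrow> Us x \<in> \<beta>"
    "\<And>x. x \<in> topspace T \<Longrightarrow> continuous_map T euclideanreal (g x)" "\<And>x. x \<in> topspace T \<Longrightarrow> 0 < g x x"
    "\<And>x y. x \<in> topspace T \<Longrightarrow> y \<in> topspace T \<Longrightarrow> 0 \<le> g x y \<and> (g x y \<noteq> (0::real) \<longrightarrow> y \<in> Us x)"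
    by metis
  define W where "W x = {y \<in> topspace T. 0 < g x y}" for x
  have "openin T (W x)" if "x \<in> topspace T" for x
    using openin_continuous_map_preimage[OF g(2)[OF that], of "{0<..}"] by (simp add: W_def)
  moreover have "topspace T \<subseteq> \<Union>(W ` topspace T)" using g(3) by (auto simp: W_def)
  ultimately obtain \<F> where "finite \<F>" "\<F> \<subseteq> W ` topspace T" "topspace T \<subseteq> \<Union>\<F>"
    using T(1) unfolding compact_space_alt by (metis (no_types, lifting) imageE)
  then obtain F where F: "finite F" "F \<subseteq> topspace T" "topspace T \<subseteq> \<Union>(W ` F)"
    by (metis finite_subset_image)
  define s where "s y = (\<Sum>x\<in>F. g x y)" for y
  have s: "0 < s y" if y: "y \<in> topspace T" for y
  proof -
    obtain x where x: "x \<in> F" "0 < g x y" using F(3) y by (auto simp: W_def)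
    then have "g x y \<le> s y" unfolding s_def
      by (intro member_le_sum) (use F g(4) y in auto)
    with x show ?thesis by simp
  qed
  define \<phi> where "\<phi> U y = (\<Sum>x\<in>{x\<in>F. Us x = U}. g x y) / s y" for U y
  show ?thesis
  proof (intro exI[of _ \<phi>] conjI ballI impI)
    fix U assume U: "U \<in> \<beta>"
    have "continuous_map T euclideanreal s" unfolding s_def
      by (intro continuous_map_sum) (use F g(2) in auto)
    moreover have "continuous_map T euclideanreal (\<lambda>y. \<Sum>x\<in>{x\<in>F. Us x = U}. g x y)"
      by (intro continuous_map_sum) (use F g(2) in auto)
    ultimately show "continuous_map T euclideanreal (\<phi> U)"
      unfolding \<phi>_def by (intro continuous_map_real_divide) (use s in force)+
    fix y assume y: "y \<in> topspace T"
    show "0 \<le> \<phi> U y" unfolding \<phi>_def using F g(4) y s[OF y] by (intro divide_nonneg_pos sum_nonneg) auto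
    assume "\<phi> U y \<noteq> 0"
    then have "(\<Sum>x\<in>{x\<in>F. Us x = U}. g x y) \<noteq> 0" by (auto simp: \<phi>_def)
    then obtain x where "x \<in> F" "Us x = U" "g x y \<noteq> 0" by (metis (mono_tags, lifting) mem_Collect_eq sum.neutral)
    then show "y \<in> U" using g(4)[of x y] F y by auto
  next
    fix y assume y: "y \<in> topspace T"
    have "(\<Sum>U\<in>\<beta>. \<Sum>x\<in>{x\<in>F. Us x = U}. g x y) = s y"
      unfolding s_def by (rule sum.group) (use F g(1) fin in auto)
    then show "(\<Sum>U\<in>\<beta>. \<phi> U y) = 1" unfolding \<phi>_def sum_divide_distrib[symmetric] using s[OF y] by simp
  qed
qed

subsection \<open>Counting grid points of the nerve\<close>

text \<open>
  This set contains the barycentric coordinates of the points of the nerve, multiplied by \<open>N\<close> and rounded down,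
  where \<open>m\<close> bounds the number of members of the cover through a point.
\<close>

definition sparse_functions :: "'u set \<Rightarrow> nat \<Rightarrow> nat \<Rightarrow> ('u \<Rightarrow> nat) set" where
  "sparse_functions \<beta> m N = {k \<in> \<beta> \<rightarrow>\<^sub>E {..N}. card {U \<in> \<beta>. k U \<noteq> 0} \<le> m}"

text \<open>
  The number of supports is at most \<open>2 ^ card \<beta>\<close>, independent of \<open>N\<close>, and on each support there are at most
  \<open>(N + 1) ^ m\<close> functions.
\<close>

lemma card_sparse_functions_le:
  assumes fin: "finite \<beta>" and N: "1 \<le> N"
  shows "card (sparse_functions \<beta> m N) \<le> (2 ^ card \<beta> * 2 ^ m) * N ^ m"
proof -
  define S where "S = {\<sigma> \<in> Pow \<beta>. card \<sigma> \<le> m}"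
  define R where "R \<sigma> = (\<lambda>k. \<lambda>U\<in>\<beta>. if U \<in> \<sigma> then k U else 0) ` (\<sigma> \<rightarrow>\<^sub>E {..N})" for \<sigma> :: "'a set"
  have finS: "finite S" using fin by (simp add: S_def)
  have finP: "finite (\<sigma> \<rightarrow>\<^sub>E {..N})" if "\<sigma> \<in> S" for \<sigma>
    using that fin by (intro finite_PiE) (auto simp: S_def intro: finite_subset)
  have cR: "card (R \<sigma>) \<le> (N + 1) ^ m" if \<sigma>: "\<sigma> \<in> S" for \<sigma>
  proof -
    have "finite \<sigma>" using \<sigma> fin by (auto simp: S_def intro: finite_subset)
    then have "card (R \<sigma>) \<le> (N + 1) ^ card \<sigma>"
      unfolding R_def using card_image_le[OF finP[OF \<sigma>]] by (simp add: card_PiE)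
    also have "\<dots> \<le> (N + 1) ^ m" using \<sigma> by (intro power_increasing) (auto simp: S_def)
    finally show ?thesis .
  qed
  have "sparse_functions \<beta> m N \<subseteq> (\<Union>\<sigma>\<in>S. R \<sigma>)"
  proof
    fix k assume k: "k \<in> sparse_functions \<beta> m N"
    define \<sigma> where "\<sigma> = {U \<in> \<beta>. k U \<noteq> 0}"
    have "\<sigma> \<in> S" using k by (auto simp: S_def \<sigma>_def sparse_functions_def)
    moreover have "restrict k \<sigma> \<in> \<sigma> \<rightarrow>\<^sub>E {..N}" using k by (auto simp: \<sigma>_def sparse_functions_def PiE_iff)
    moreover have "k = (\<lambda>U\<in>\<beta>. if U \<in> \<sigma> then restrict k \<sigma> U else 0)"
      using k by (auto simp: \<sigma>_def sparse_functions_def PiE_iff extensional_def fun_eq_iff restrict_def)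
    ultimately show "k \<in> (\<Union>\<sigma>\<in>S. R \<sigma>)" unfolding R_def by blast
  qed
  moreover have "finite (\<Union>\<sigma>\<in>S. R \<sigma>)" using finS finP by (auto simp: R_def)
  ultimately have "card (sparse_functions \<beta> m N) \<le> card (\<Union>\<sigma>\<in>S. R \<sigma>)" by (rule card_mono[rotated])
  also have "\<dots> \<le> (\<Sum>\<sigma>\<in>S. card (R \<sigma>))" by (rule card_UN_le[OF finS])
  also have "\<dots> \<le> (\<Sum>\<sigma>\<in>S. (N + 1) ^ m)" by (intro sum_mono cR)
  also have "\<dots> = card S * (N + 1) ^ m" by simp
  also have "\<dots> \<le> 2 ^ card \<beta> * (2 * N) ^ m"
  proof (intro mult_mono power_mono)
    have "card S \<le> card (Pow \<beta>)" using fin by (intro card_mono) (auto simp: S_def)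
    then show "card S \<le> 2 ^ card \<beta>" by (simp add: card_Pow fin)
  qed (use N in auto)
  finally show ?thesis by (simp add: power_mult_distrib mult.assoc)
qed

subsection \<open>A norm estimate for positive matrices\<close>

text \<open>
  Polarization for \<open>v\<close> and a vector \<open>u\<close> of the same length in the direction of \<open>D v\<close>: four times
  \<open>\<parallel>v\<parallel> \<parallel>D v\<parallel> = Re \<langle>D v, u\<rangle>\<close> is the value of the form at \<open>v + u\<close> minus its value at \<open>v - u\<close>, the latter
  being nonnegative, and \<open>v + u\<close> has length at most \<open>2 \<parallel>v\<parallel>\<close>.
\<close>

lemma norm_positive_le:
  assumes D: "star D = D" and r: "emb r (1\<^sub>m r) * D = D" and k: "0 \<le> k"
    and q: "\<And>v. v \<in> carrier_vec r \<Longrightarrow> 0 \<le> Re (act r D v \<bullet>c v) \<and> Re (act r D v \<bullet>c v) \<le> k * (cvec_norm v)\<^sup>2"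
  shows "norm D \<le> k"
proof -
  have "cvec_norm (act r D v) \<le> k * cvec_norm v" if v: "v \<in> carrier_vec r" for v
  proof (cases "cvec_norm (act r D v) = 0")
    case True
    then show ?thesis using k by simp
  next
    case False
    define n where "n = cvec_norm (act r D v)"
    define s where "s = cvec_norm v"
    have n: "n > 0" using False cvec_norm_nonneg[of "act r D v"] unfolding n_def by linarith
    define u where "u = of_real (s / n) \<cdot>\<^sub>v act r D v"
    have u: "u \<in> carrier_vec r" by (simp add: u_def)
    have s0: "0 \<le> s" by (simp add: s_def)
    have nu: "cvec_norm u = s" using n s0 by (simp add: u_def cvec_norm_smult norm_divide) (simp add: n_def)
    have a: "Re (act r D v \<bullet>c u) = s * n"
    proof -
      have "act r D v \<bullet>c u = of_real (s / n) * (act r D v \<bullet>c act r D v)"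
        by (simp add: u_def conjugate_smult_vec)
      also have "\<dots> = of_real (s / n * n\<^sup>2)" unfolding cscalar_prod_self n_def by simp
      finally show ?thesis using n by (simp add: power2_eq_square)
    qed
    have b: "Re (act r D u \<bullet>c v) = s * n"
    proof -
      have "act r D u \<bullet>c v = u \<bullet>c act r D v" using act_star[OF u v, of D] D by simp
      also have "\<dots> = of_real (s / n) * (act r D v \<bullet>c act r D v)" by (simp add: u_def)
      also have "\<dots> = of_real (s / n * n\<^sup>2)" unfolding cscalar_prod_self n_def by simp
      finally show ?thesis using n by (simp add: power2_eq_square)
    qed
    have plus: "act r D (v + u) \<bullet>c (v + u) = act r D v \<bullet>c v + act r D v \<bullet>c u + (act r D u \<bullet>c v + act r D u \<bullet>c u)"
      using v u by (simp add: act_vec_add conjugate_add_vec[of _ r] scalar_prod_add_distrib[of _ r] add_scalar_prod_distrib[of _ r])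
    have minus: "act r D (v - u) \<bullet>c (v - u) = act r D v \<bullet>c v - act r D v \<bullet>c u - (act r D u \<bullet>c v - act r D u \<bullet>c u)"
    proof -
      have "conjugate (v - u) = conjugate v - conjugate u" using v u by (intro eq_vecI) auto
      then show ?thesis using v u
        by (simp add: act_vec_diff scalar_prod_minus_distrib[of _ r] minus_scalar_prod_distrib[of _ r])
    qed
    have "4 * (s * n) = Re (act r D (v + u) \<bullet>c (v + u)) - Re (act r D (v - u) \<bullet>c (v - u))"
      unfolding plus minus using a b by simp
    also have "\<dots> \<le> k * (cvec_norm (v + u))\<^sup>2" using q[of "v + u"] q[of "v - u"] v u by auto
    also have "\<dots> \<le> k * (s + s)\<^sup>2"
      using cvec_norm_triangle[OF v u] nu k by (intro mult_left_mono power_mono) (auto simp: s_def)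
    finally have "s * n \<le> s * (k * s)" by (simp add: power2_eq_square algebra_simps)
    moreover have "s \<noteq> 0"
    proof
      assume "s = 0"
      then have "act r D v = 0\<^sub>v r" using cvec_norm_eq_0[OF v] cvec_norm_act[OF v, of D] n by (simp add: s_def n_def)
      then show False using n by (simp add: n_def)
    qed
    ultimately have "0 < s" "s * n \<le> s * (k * s)" using s0 by simp_all
    then have "n \<le> k * s" by simp
    then show ?thesis by (simp add: n_def s_def)
  qed
  then have "mat_opnorm (entry D r) \<le> k"
    by (intro mat_opnorm_le[OF entry_carrier k]) (simp add: act_def)
  then show ?thesis using emb_entry[OF r] norm_emb[OF entry_carrier, of r D] by simp
qed

subsection \<open>Comparing two almost projections\<close>

lemma star_sum: "star (sum f A) = (\<Sum>x\<in>A. star (f x :: 'a::unital_cstar_algebra))"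
  by (induction A rule: infinite_finite_induct) (auto simp: star_add)

text \<open>
  For a self-adjoint \<open>p\<close> the C*-identity turns the hypothesis into \<open>\<parallel>p\<parallel>\<^sup>2 \<le> \<parallel>p\<parallel> + 1\<close>.
\<close>

lemma norm_almost_projection:
  fixes p :: "'a::unital_cstar_algebra"
  assumes "star p = p" "norm (p - p * p) \<le> 1" shows "norm p \<le> 2"
proof -
  have "(norm p)\<^sup>2 = norm (p - (p - p * p))" using norm_self_adjoint_square[OF assms(1)] by simp
  also have "\<dots> \<le> norm p + 1" using norm_triangle_ineq4[of p "p - p * p"] assms(2) by linarith
  finally have *: "norm p * norm p \<le> norm p + 1" by (simp add: power2_eq_square)
  show ?thesis
  proof (rule ccontr)
    assume "\<not> norm p \<le> 2"
    then have "2 < norm p" by simp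
    moreover from this have "2 * norm p < norm p * norm p" by (intro mult_strict_right_mono) linarith+
    ultimately have "2 * norm p < norm p * norm p" "2 < norm p" by simp_all
    with * show False by linarith
  qed
qed

text \<open>
  The projection \<open>E\<close> need not lie under \<open>c\<close>.  But \<open>tr ((1 - c) E) = tr (E (1 - c) E) \<ge> 0\<close>, so cutting down by \<open>c\<close>
  can only lose trace, and inside \<open>c\<close> the error is at most \<open>d\<close> times the trace of \<open>c\<close>.
\<close>

lemma trace_lower:
  assumes c: "is_projection c" "c * P = P" and E: "is_projection E" and d: "norm (E - P) \<le> d"
  shows "Re (tr r P) - d * Re (tr r c) \<le> Re (tr r E)"
proof -
  have "tr r E = tr r (c * E) + tr r ((1 - c) * E)"
    by (simp add: tr_add[symmetric] distrib_right[symmetric])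
  moreover have "0 \<le> Re (tr r ((1 - c) * E))"
  proof -
    have "tr r ((1 - c) * E) = tr r (((1 - c) * E) * E)" using is_projectionD[OF E] by (simp add: mult.assoc)
    also have "\<dots> = tr r (E * ((1 - c) * E))" by (rule tr_comm)
    also have "\<dots> = tr r (star ((1 - c) * E) * ((1 - c) * E))"
      using is_projectionD[OF E] is_projectionD[OF is_projection_compl[OF c(1)]]
      by (simp add: star_mult) (metis mult.assoc)
    finally show ?thesis using tr_star_mult_ge_0 by simp
  qed
  moreover have "tr r (c * E) = tr r P + tr r (c * (E - P))" using c(2) by (simp add: tr_diff right_diff_distrib)
  moreover have "cmod (tr r (c * (E - P))) \<le> Re (tr r c) * d"
    by (rule order_trans[OF norm_tr_corner_le[OF c(1)]])
       (use d tr_projection_ge_0[OF c(1)] in \<open>auto intro: mult_left_mono\<close>)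
  then have "- (d * Re (tr r c)) \<le> Re (tr r (c * (E - P)))"
    using abs_Re_le_cmod[of "tr r (c * (E - P))"] by (simp add: mult.commute)
  ultimately show ?thesis by simp
qed

text \<open>
  First \<open>Q\<close> is split by \<open>F\<close>.  The part outside \<open>F\<close> is small relative to the trace of \<open>c\<close>, the difference
  inside \<open>F\<close> is small relative to the trace of \<open>F\<close>, and \<open>d \<le> 1/2\<close> bounds the latter a priori by 5 times the
  trace of \<open>c\<close>.
\<close>

lemma trace_upper:
  assumes c: "is_projection c" "c * Q = Q" and F: "is_projection F" and d: "norm (F - Q) \<le> d" "d \<le> 1/2"
    and Q: "norm Q \<le> 2" "star Q = Q"
  shows "Re (tr r F) \<le> Re (tr r Q) + 6 * d * Re (tr r c)"
proof -
  let ?n = "Re (tr r c)" and ?f = "Re (tr r F)"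
  have d0: "0 \<le> d" using d(1) norm_ge_zero order_trans by blast
  have n0: "0 \<le> ?n" and f0: "0 \<le> ?f" using tr_projection_ge_0 c F by auto
  have Qc: "Q * c = Q" using arg_cong[OF c(2), of star] is_projectionD[OF c(1)] Q by (simp add: star_mult)
  have "tr r Q = tr r (F * Q) + tr r ((1 - F) * Q)" by (simp add: tr_add[symmetric] distrib_right[symmetric])
  moreover have "cmod (tr r ((1 - F) * Q)) \<le> ?n * d"
  proof -
    have "tr r ((1 - F) * Q) = tr r (((1 - F) * Q) * c)" by (simp add: mult.assoc Qc)
    also have "\<dots> = tr r (c * ((1 - F) * Q))" by (rule tr_comm)
    finally have "cmod (tr r ((1 - F) * Q)) \<le> ?n * norm ((1 - F) * Q)"
      using norm_tr_corner_le[OF c(1), of r "(1 - F) * Q"] by simp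
    also have FQ: "(1 - F) * Q = (1 - F) * (Q - F)" using is_projectionD[OF F] by (simp add: algebra_simps)
    also have "norm ((1 - F) * (Q - F)) \<le> 1 * d"
    proof (rule order_trans[OF norm_mult_ineq], rule mult_mono)
      show "norm (1 - F) \<le> 1" by (rule norm_projection_le[OF is_projection_compl[OF F]])
      show "norm (Q - F) \<le> d" using d by (simp add: norm_minus_commute)
    qed simp_all
    finally show ?thesis using n0 unfolding FQ by (simp add: mult_left_mono)
  qed
  moreover have "tr r (F * Q) = tr r F + tr r (F * (Q - F))"
    using is_projectionD[OF F] by (simp add: tr_diff right_diff_distrib)
  moreover have "cmod (tr r (F * (Q - F))) \<le> ?f * d"
    by (rule order_trans[OF norm_tr_corner_le[OF F]])
       (use d f0 in \<open>auto intro!: mult_left_mono simp: norm_minus_commute\<close>)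
  moreover have "cmod (tr r Q) \<le> ?n * 2"
    using norm_tr_corner_le[OF c(1), of r Q] c(2) mult_left_mono[OF Q(1) n0] by simp
  ultimately have fq: "?f \<le> Re (tr r Q) + ?n * d + ?f * d" and q2: "Re (tr r Q) \<le> ?n * 2"
    using abs_Re_le_cmod[of "tr r ((1 - F) * Q)"] abs_Re_le_cmod[of "tr r (F * (Q - F))"] abs_Re_le_cmod[of "tr r Q"]
    by simp_all
  have "?f * d \<le> ?f * (1/2)" "?n * d \<le> ?n * (1/2)"
    by (rule mult_left_mono[OF d(2) f0], rule mult_left_mono[OF d(2) n0])
  then have "?f \<le> 5 * ?n" using fq q2 by linarith
  then have "?f * d \<le> 5 * ?n * d" using d0 by (simp add: mult_right_mono)
  with fq show ?thesis by (simp add: algebra_simps)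
qed

text \<open>
  Replaces \<open>P\<close> by its affine interpolation between sample points \<open>c U\<close>, one in each member of the cover.
\<close>

definition nerve_sum :: "('x set \<Rightarrow> 'x \<Rightarrow> real) \<Rightarrow> 'x set set \<Rightarrow> ('x set \<Rightarrow> 'x) \<Rightarrow> ('x \<Rightarrow> bmat) \<Rightarrow> 'x \<Rightarrow> bmat" where
  "nerve_sum \<phi> \<beta> c P x = (\<Sum>U\<in>\<beta>. \<phi> U x *\<^sub>R P (c U))"

text \<open>
  The interpolation \<open>H\<close> of \<open>P\<close> over the nerve is within \<open>\<epsilon>\<close> of \<open>P\<close>, because only members containing \<open>x\<close>
  contribute at \<open>x\<close>; hence \<open>H\<close> is a projection up to \<open>6 \<epsilon>\<close>, and its spectral projection \<open>E\<close> is within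
  \<open>18 \<epsilon>\<close> of \<open>H\<close>.  Since \<open>H\<close> is linear in the values \<open>\<phi> U x\<close>, the projection \<open>E\<close> is Lipschitz in them
  with constant \<open>4 * 2\<close>, where 4 comes from the spectral projection and 2 bounds the sampled values of \<open>P\<close>.
\<close>

lemma nerve_projection:
  fixes P :: "'x \<Rightarrow> bmat"
  assumes \<beta>: "finite_open_cover T \<beta>"
    and \<phi>: "\<And>U x. U \<in> \<beta> \<Longrightarrow> x \<in> topspace T \<Longrightarrow> 0 \<le> \<phi> U x \<and> (\<phi> U x \<noteq> 0 \<longrightarrow> x \<in> U)"
      "\<And>x. x \<in> topspace T \<Longrightarrow> (\<Sum>U\<in>\<beta>. \<phi> U x) = 1"
    and pt: "\<And>U. U \<in> \<beta> \<Longrightarrow> U \<noteq> {} \<Longrightarrow> pt U \<in> U"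
    and sP: "\<And>x. x \<in> topspace T \<Longrightarrow> star (P x) = P x"
    and eP: "\<And>x. x \<in> topspace T \<Longrightarrow> norm (P x - P x * P x) \<le> \<epsilon>"
    and nP: "\<And>U x y. U \<in> \<beta> \<Longrightarrow> x \<in> U \<Longrightarrow> y \<in> U \<Longrightarrow> norm (P x - P y) \<le> \<epsilon>"
    and rP: "\<And>x. x \<in> topspace T \<Longrightarrow> emb r (1\<^sub>m r) * P x = P x"
    and \<epsilon>: "\<epsilon> \<le> 1/2000"
  shows "\<exists>E. (\<forall>x\<in>topspace T. is_projection (E x) \<and> norm (E x - P x) \<le> 19 * \<epsilon> \<and> emb r (1\<^sub>m r) * E x = E x) \<and>
    (\<forall>x\<in>topspace T. \<forall>y\<in>topspace T. norm (E x - E y) \<le> 8 * (\<Sum>U\<in>\<beta>. \<bar>\<phi> U x - \<phi> U y\<bar>))"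
proof -
  have fin: "finite \<beta>" and sub: "\<And>U. U \<in> \<beta> \<Longrightarrow> U \<subseteq> topspace T" and cov: "\<Union>\<beta> = topspace T"
    using \<beta> by (auto simp: finite_open_cover_def dest: openin_subset)
  define H where "H = nerve_sum \<phi> \<beta> pt P"
  have ptT: "pt U \<in> topspace T" if "U \<in> \<beta>" "x \<in> topspace T" "\<phi> U x \<noteq> 0" for U x
    using \<phi>(1)[of U x] pt[of U] sub[of U] that by blast
  have P2: "norm (P x) \<le> 2" if "x \<in> topspace T" for x
    by (rule norm_almost_projection) (use sP eP \<epsilon> that in \<open>force intro: order_trans\<close>)+
  have e0: "0 \<le> \<epsilon>" if "x \<in> topspace T" for x using eP[OF that] norm_ge_zero order_trans by blast
  have HP: "norm (H x - P x) \<le> \<epsilon>" if x: "x \<in> topspace T" for x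
  proof -
    have "H x - P x = (\<Sum>U\<in>\<beta>. \<phi> U x *\<^sub>R (P (pt U) - P x))"
      unfolding H_def nerve_sum_def scaleR_diff_right sum_subtractf
      by (simp add: scaleR_left.sum[symmetric] \<phi>(2)[OF x])
    also have "norm \<dots> \<le> (\<Sum>U\<in>\<beta>. \<phi> U x * \<epsilon>)"
    proof (rule sum_norm_le)
      fix U assume U: "U \<in> \<beta>"
      show "norm (\<phi> U x *\<^sub>R (P (pt U) - P x)) \<le> \<phi> U x * \<epsilon>"
      proof (cases "\<phi> U x = 0")
        case False
        then have "x \<in> U" using \<phi>(1)[OF U x] by blast
        then show ?thesis using nP[OF U pt[OF U]] \<phi>(1)[OF U x] by (auto intro: mult_left_mono)
      qed simp
    qed
    also have "\<dots> = \<epsilon>" by (simp add: sum_distrib_right[symmetric] \<phi>(2)[OF x])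
    finally show ?thesis .
  qed
  have sH: "star (H x) = H x" if x: "x \<in> topspace T" for x
  proof -
    have "star (H x) = (\<Sum>U\<in>\<beta>. star (\<phi> U x *\<^sub>R P (pt U)))"
      unfolding H_def nerve_sum_def by (rule star_sum)
    also have "\<dots> = H x" unfolding H_def nerve_sum_def
      by (rule sum.cong) (use sP ptT x in \<open>auto simp: star_scaleR\<close>)
    finally show ?thesis .
  qed
  have rH: "emb r (1\<^sub>m r) * H x = H x" if x: "x \<in> topspace T" for x
    unfolding H_def nerve_sum_def sum_distrib_left
    by (rule sum.cong) (use rP ptT x in \<open>auto simp: mult_scaleR_right\<close>)
  have H2: "norm (H x - H x * H x) \<le> 6 * \<epsilon>" if x: "x \<in> topspace T" for x
  proof -
    have nH: "norm (H x) \<le> 2"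
    proof -
      have "norm (H x) \<le> (\<Sum>U\<in>\<beta>. \<phi> U x * 2)" unfolding H_def nerve_sum_def
      proof (rule sum_norm_le)
        fix U assume U: "U \<in> \<beta>"
        show "norm (\<phi> U x *\<^sub>R P (pt U)) \<le> \<phi> U x * 2"
          using P2 ptT[OF U x] \<phi>(1)[OF U x] by (cases "\<phi> U x = 0") auto
      qed
      then show ?thesis by (simp add: sum_distrib_right[symmetric] \<phi>(2)[OF x])
    qed
    have "H x - H x * H x = (H x - P x) + (P x - P x * P x) + (P x * (P x - H x) + (P x - H x) * H x)"
      by (simp add: algebra_simps)
    also have "norm \<dots> \<le> norm (H x - P x) + norm (P x - P x * P x) + (norm (P x * (P x - H x)) + norm ((P x - H x) * H x))"
      using norm_triangle_ineq[of "(H x - P x) + (P x - P x * P x)" "P x * (P x - H x) + (P x - H x) * H x"]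
        norm_triangle_ineq[of "H x - P x" "P x - P x * P x"]
        norm_triangle_ineq[of "P x * (P x - H x)" "(P x - H x) * H x"] by linarith
    finally have "norm (H x - H x * H x) \<le>
      norm (H x - P x) + norm (P x - P x * P x) + (norm (P x * (P x - H x)) + norm ((P x - H x) * H x))" .
    moreover have PH: "norm (P x - H x) \<le> \<epsilon>" using HP[OF x] by (simp add: norm_minus_commute)
    have "norm (P x * (P x - H x)) \<le> 2 * \<epsilon>"
      by (rule order_trans[OF norm_mult_ineq mult_mono[OF P2[OF x] PH]]) simp_all
    moreover have "norm ((P x - H x) * H x) \<le> \<epsilon> * 2"
      by (rule order_trans[OF norm_mult_ineq mult_mono[OF PH nH]]) (use e0[OF x] in simp_all)
    ultimately show ?thesis using HP[OF x] eP[OF x] by linarith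
  qed
  have "\<forall>x\<in>topspace T. \<exists>e. is_projection e \<and> e * H x = H x * e \<and> norm (e - H x) \<le> 3 * norm (H x - H x * H x) \<and>
      (\<forall>c. c * H x = H x \<longrightarrow> c * e = e)"
  proof
    fix x assume x: "x \<in> topspace T"
    have "norm (H x - H x * H x) \<le> 1/16" using H2[OF x] \<epsilon> by simp
    then show "\<exists>e. is_projection e \<and> e * H x = H x * e \<and> norm (e - H x) \<le> 3 * norm (H x - H x * H x) \<and>
      (\<forall>c. c * H x = H x \<longrightarrow> c * e = e)" by (rule spectral_projection[OF sH[OF x]])
  qed
  then obtain E where E: "\<And>x. x \<in> topspace T \<Longrightarrow> is_projection (E x)" "\<And>x. x \<in> topspace T \<Longrightarrow> E x * H x = H x * E x"
    "\<And>x. x \<in> topspace T \<Longrightarrow> norm (E x - H x) \<le> 3 * norm (H x - H x * H x)"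
    "\<And>x c. x \<in> topspace T \<Longrightarrow> c * H x = H x \<Longrightarrow> c * E x = E x"
    unfolding bchoice_iff by blast
  have EH: "norm (E x - H x) \<le> 18 * \<epsilon>" if "x \<in> topspace T" for x using E(3)[OF that] H2[OF that] by simp
  have lip: "norm (E x - E y) \<le> 8 * (\<Sum>U\<in>\<beta>. \<bar>\<phi> U x - \<phi> U y\<bar>)" if x: "x \<in> topspace T" and y: "y \<in> topspace T" for x y
  proof -
    have "norm (E x - E y) \<le> 4 * norm (H x - H y)"
      using E(1,2) EH[OF x] EH[OF y] \<epsilon> x y by (intro spectral_projection_lipschitz) auto
    also have "H x - H y = (\<Sum>U\<in>\<beta>. (\<phi> U x - \<phi> U y) *\<^sub>R P (pt U))"
      by (simp add: H_def nerve_sum_def scaleR_left_diff_distrib sum_subtractf)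
    also have "norm \<dots> \<le> (\<Sum>U\<in>\<beta>. \<bar>\<phi> U x - \<phi> U y\<bar> * 2)"
    proof (rule sum_norm_le)
      fix U assume U: "U \<in> \<beta>"
      show "norm ((\<phi> U x - \<phi> U y) *\<^sub>R P (pt U)) \<le> \<bar>\<phi> U x - \<phi> U y\<bar> * 2"
      proof (cases "\<phi> U x = 0 \<and> \<phi> U y = 0")
        case False
        then have "pt U \<in> topspace T" using ptT[OF U] x y by blast
        then show ?thesis using P2 by (simp add: mult_left_mono)
      qed simp
    qed
    finally show ?thesis by (simp add: sum_distrib_right[symmetric])
  qed
  have EP: "norm (E x - P x) \<le> 19 * \<epsilon>" if x: "x \<in> topspace T" for x
    using norm_triangle_ineq[of "E x - H x" "H x - P x"] EH[OF x] HP[OF x] by simp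
  show ?thesis
    using E(1) EP E(4)[OF _ rH] lip by (intro exI[of _ E]) auto
qed

lemma continuous_map_if_dominated:
  fixes E :: "'x \<Rightarrow> bmat"
  assumes \<beta>: "finite \<beta>" and \<phi>: "\<And>U. U \<in> \<beta> \<Longrightarrow> continuous_map T euclideanreal (\<phi> U)"
    and E: "\<And>x y. x \<in> topspace T \<Longrightarrow> y \<in> topspace T \<Longrightarrow> norm (E x - E y) \<le> 8 * (\<Sum>U\<in>\<beta>. \<bar>\<phi> U x - \<phi> U y\<bar>)"
  shows "continuous_map T euclidean E"
  unfolding continuous_map_atin
proof
  fix x assume x: "x \<in> topspace T"
  have "((\<lambda>y. 8 * (\<Sum>U\<in>\<beta>. \<bar>\<phi> U y - \<phi> U x\<bar>)) \<longlongrightarrow> 8 * (\<Sum>U\<in>\<beta>. \<bar>\<phi> U x - \<phi> U x\<bar>)) (atin T x)"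
    by (intro tendsto_intros) (use \<phi> x in \<open>auto simp: continuous_map_atin\<close>)
  then have lim: "((\<lambda>y. 8 * (\<Sum>U\<in>\<beta>. \<bar>\<phi> U y - \<phi> U x\<bar>)) \<longlongrightarrow> 0) (atin T x)" by simp
  have "((\<lambda>y. E y - E x) \<longlongrightarrow> 0) (atin T x)"
  proof (rule Lim_null_comparison[OF _ lim])
    show "\<forall>\<^sub>F y in atin T x. norm (E y - E x) \<le> 8 * (\<Sum>U\<in>\<beta>. \<bar>\<phi> U y - \<phi> U x\<bar>)"
      unfolding eventually_atin using E x by (intro disjI2 exI[of _ "topspace T"]) auto
  qed
  then show "limitin euclidean E (E x) (atin T x)" by (simp add: LIM_zero_iff)
qed

text \<open>
  Two almost projections over a compact space, nearly constant on the members of a cover of order \<open>d\<close>.  Their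
  ranks differ by more than half the number of parameters of the nerve: passing to \<open>E\<close> and \<open>F\<close> costs
  \<open>19 \<epsilon> n\<close> and \<open>6 * 19 \<epsilon> n\<close> in trace, in total \<open>133 \<epsilon> n\<close>, which is less than half of \<open>\<delta> n\<close>, and
  what remains is at least \<open>2 d\<close> and positive.  So general position applies, and finitely many Newton-Schulz
  steps make \<open>E M F\<close> an almost partial isometry, uniformly in \<open>x\<close>.  The corner \<open>c\<close> of trace \<open>n\<close>
  ensures that all errors are measured relative to the rank of the bundle and not to the matrix size \<open>r\<close>.
\<close>

theorem comparison_over_cover:
  fixes P Q c :: "'x \<Rightarrow> bmat" and n d :: nat and \<epsilon> \<delta> :: real
  assumes T: "compact_space T" "Hausdorff_space T" and \<beta>: "finite_open_cover T \<beta>"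
    and ord: "\<And>x. x \<in> topspace T \<Longrightarrow> card {U \<in> \<beta>. x \<in> U} \<le> d + 1"
    and sP: "\<And>x. x \<in> topspace T \<Longrightarrow> star (P x) = P x" and sQ: "\<And>x. x \<in> topspace T \<Longrightarrow> star (Q x) = Q x"
    and eP: "\<And>x. x \<in> topspace T \<Longrightarrow> norm (P x - P x * P x) \<le> \<epsilon>"
    and eQ: "\<And>x. x \<in> topspace T \<Longrightarrow> norm (Q x - Q x * Q x) \<le> \<epsilon>"
    and nP: "\<And>U x y. U \<in> \<beta> \<Longrightarrow> x \<in> U \<Longrightarrow> y \<in> U \<Longrightarrow> norm (P x - P y) \<le> \<epsilon>"
    and nQ: "\<And>U x y. U \<in> \<beta> \<Longrightarrow> x \<in> U \<Longrightarrow> y \<in> U \<Longrightarrow> norm (Q x - Q y) \<le> \<epsilon>"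
    and rP: "\<And>x. x \<in> topspace T \<Longrightarrow> emb r (1\<^sub>m r) * P x = P x"
    and rQ: "\<And>x. x \<in> topspace T \<Longrightarrow> emb r (1\<^sub>m r) * Q x = Q x"
    and c: "\<And>x. x \<in> topspace T \<Longrightarrow> is_projection (c x) \<and> c x * P x = P x \<and> c x * Q x = Q x \<and> tr r (c x) = of_nat n"
    and \<epsilon>: "0 < \<epsilon>" "\<epsilon> \<le> 1/2000" and n: "0 < n"
    and gap: "\<And>x. x \<in> topspace T \<Longrightarrow> \<delta> * n \<le> Re (tr r (P x)) - Re (tr r (Q x))"
    and \<delta>: "300 * \<epsilon> \<le> \<delta>" and d: "real d \<le> \<delta> / 4 * n"
  shows "\<exists>V. continuous_map T euclidean V \<and> (\<forall>x\<in>topspace T. norm (V x) \<le> 2 \<and> emb r (1\<^sub>m r) * V x = V x \<and>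
    norm (Q x - Q x * star (V x) * P x * V x * Q x) \<le> 1/2)"
proof -
  let ?X = "topspace T"
  have fin: "finite \<beta>" using \<beta> by (simp add: finite_open_cover_def)
  obtain \<phi> where \<phi>: "\<And>U. U \<in> \<beta> \<Longrightarrow> continuous_map T euclideanreal (\<phi> U)"
    "\<And>U x. U \<in> \<beta> \<Longrightarrow> x \<in> ?X \<Longrightarrow> 0 \<le> \<phi> U x \<and> (\<phi> U x \<noteq> (0::real) \<longrightarrow> x \<in> U)"
    "\<And>x. x \<in> ?X \<Longrightarrow> (\<Sum>U\<in>\<beta>. \<phi> U x) = 1"
    using partition_of_unity[OF T \<beta>] by blast
  define pt where "pt U = (SOME x. x \<in> U)" for U :: "'x set"
  have pt: "U \<noteq> {} \<Longrightarrow> pt U \<in> U" for U by (simp add: pt_def some_in_eq)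
  have "\<exists>E. (\<forall>x\<in>?X. is_projection (E x) \<and> norm (E x - P x) \<le> 19 * \<epsilon> \<and> emb r (1\<^sub>m r) * E x = E x) \<and>
    (\<forall>x\<in>?X. \<forall>y\<in>?X. norm (E x - E y) \<le> 8 * (\<Sum>U\<in>\<beta>. \<bar>\<phi> U x - \<phi> U y\<bar>))"
  proof (rule nerve_projection[where \<phi> = \<phi> and pt = pt, OF \<beta>])
    show "0 \<le> \<phi> U x \<and> (\<phi> U x \<noteq> 0 \<longrightarrow> x \<in> U)" if "U \<in> \<beta>" "x \<in> ?X" for U x by (rule \<phi>(2)[OF that])
    show "norm (P x - P y) \<le> \<epsilon>" if "U \<in> \<beta>" "x \<in> U" "y \<in> U" for U x y by (rule nP[OF that])
  qed (use \<epsilon>(2) in \<open>simp_all add: \<phi>(3) pt sP eP rP\<close>)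
  then obtain E where E: "\<And>x. x \<in> ?X \<Longrightarrow> is_projection (E x)" "\<And>x. x \<in> ?X \<Longrightarrow> norm (E x - P x) \<le> 19 * \<epsilon>"
    "\<And>x. x \<in> ?X \<Longrightarrow> emb r (1\<^sub>m r) * E x = E x"
    "\<And>x y. x \<in> ?X \<Longrightarrow> y \<in> ?X \<Longrightarrow> norm (E x - E y) \<le> 8 * (\<Sum>U\<in>\<beta>. \<bar>\<phi> U x - \<phi> U y\<bar>)"
    by blast
  have "\<exists>E. (\<forall>x\<in>?X. is_projection (E x) \<and> norm (E x - Q x) \<le> 19 * \<epsilon> \<and> emb r (1\<^sub>m r) * E x = E x) \<and>
    (\<forall>x\<in>?X. \<forall>y\<in>?X. norm (E x - E y) \<le> 8 * (\<Sum>U\<in>\<beta>. \<bar>\<phi> U x - \<phi> U y\<bar>))"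
  proof (rule nerve_projection[where \<phi> = \<phi> and pt = pt, OF \<beta>])
    show "0 \<le> \<phi> U x \<and> (\<phi> U x \<noteq> 0 \<longrightarrow> x \<in> U)" if "U \<in> \<beta>" "x \<in> ?X" for U x by (rule \<phi>(2)[OF that])
    show "norm (Q x - Q y) \<le> \<epsilon>" if "U \<in> \<beta>" "x \<in> U" "y \<in> U" for U x y by (rule nQ[OF that])
  qed (use \<epsilon>(2) in \<open>simp_all add: \<phi>(3) pt sQ eQ rQ\<close>)
  then obtain F where F: "\<And>x. x \<in> ?X \<Longrightarrow> is_projection (F x)" "\<And>x. x \<in> ?X \<Longrightarrow> norm (F x - Q x) \<le> 19 * \<epsilon>"
    "\<And>x. x \<in> ?X \<Longrightarrow> emb r (1\<^sub>m r) * F x = F x"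
    "\<And>x y. x \<in> ?X \<Longrightarrow> y \<in> ?X \<Longrightarrow> norm (F x - F y) \<le> 8 * (\<Sum>U\<in>\<beta>. \<bar>\<phi> U x - \<phi> U y\<bar>)"
    by blast
  have Q2: "norm (Q x) \<le> 2" and P2: "norm (P x) \<le> 2" if "x \<in> ?X" for x
    using norm_almost_projection[OF sQ[OF that]] norm_almost_projection[OF sP[OF that]] eQ[OF that] eP[OF that] \<epsilon> by auto
  have rank: "2 * vec_space.rank r (entry (F x) r) + (d + 1) + 1 \<le> 2 * vec_space.rank r (entry (E x) r)"
    if x: "x \<in> ?X" for x
  proof -
    let ?a = "vec_space.rank r (entry (E x) r)" and ?b = "vec_space.rank r (entry (F x) r)"
    have cn: "Re (tr r (c x)) = real n" using c[OF x] by simp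
    have "Re (tr r (P x)) - 19 * \<epsilon> * real n \<le> real ?a"
      using trace_lower[of "c x" "P x" "E x" "19 * \<epsilon>" r] c[OF x] E(1,2)[OF x] cn trace_eq_rank[OF E(1)[OF x], of r] by simp
    moreover have "real ?b \<le> Re (tr r (Q x)) + 6 * (19 * \<epsilon>) * real n"
      using trace_upper[of "c x" "Q x" "F x" "19 * \<epsilon>" r] c[OF x] F(1,2)[OF x] cn trace_eq_rank[OF F(1)[OF x], of r]
        Q2[OF x] sQ[OF x] \<epsilon> by simp
    ultimately have "\<delta> * n - 133 * (\<epsilon> * n) \<le> real ?a - real ?b" using gap[OF x] by simp
    moreover have "300 * (\<epsilon> * n) \<le> \<delta> * n" using mult_right_mono[OF \<delta>, of "real n"] by simp
    moreover have "0 < \<epsilon> * n" using \<epsilon> n by simp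
    ultimately have "0 < real ?a - real ?b" "2 * real d \<le> real ?a - real ?b" using d by simp_all
    then have "real ?b < real ?a" "real (2 * d + ?b) \<le> real ?a" by simp_all
    then have "?b < ?a" "2 * d + ?b \<le> ?a" unfolding of_nat_less_iff of_nat_le_iff .
    then show ?thesis by arith
  qed
  \<comment> \<open>The barycentric coordinates of \<open>x\<close>, rounded down to multiples of \<open>1/N\<close>.\<close>
  define \<kappa> where "\<kappa> N x = (\<lambda>U\<in>\<beta>. nat \<lfloor>real N * \<phi> U x\<rfloor>)" for N x
  have \<kappa>in: "\<kappa> N ` ?X \<subseteq> sparse_functions \<beta> (d + 1) N" for N
  proof
    fix k assume "k \<in> \<kappa> N ` ?X"
    then obtain x where x: "x \<in> ?X" "k = \<kappa> N x" by blast
    have "nat \<lfloor>real N * \<phi> U x\<rfloor> \<le> N" if U: "U \<in> \<beta>" for U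
    proof -
      have "\<phi> U x \<le> (\<Sum>U\<in>\<beta>. \<phi> U x)" by (rule member_le_sum) (use U \<phi>(2) x fin in auto)
      then have "real N * \<phi> U x \<le> real N" using \<phi>(3)[OF x(1)] by (simp add: mult_left_le)
      then have "\<lfloor>real N * \<phi> U x\<rfloor> \<le> int N" by (simp add: floor_le_iff) 
      then show ?thesis by simp
    qed
    moreover have "x \<in> U" if "U \<in> \<beta>" "k U \<noteq> 0" for U
    proof -
      have "\<phi> U x \<noteq> 0"
      proof
        assume "\<phi> U x = 0"
        then show False using that by (simp add: x(2) \<kappa>_def)
      qed
      then show ?thesis using \<phi>(2)[OF that(1) x(1)] by blast
    qed
    then have "{U \<in> \<beta>. k U \<noteq> 0} \<subseteq> {U \<in> \<beta>. x \<in> U}" by blast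
    then have "card {U \<in> \<beta>. k U \<noteq> 0} \<le> card {U \<in> \<beta>. x \<in> U}"
      by (rule card_mono[rotated]) (simp add: fin)
    ultimately show "k \<in> sparse_functions \<beta> (d + 1) N"
      using ord[OF x(1)] by (auto simp: sparse_functions_def x(2) \<kappa>_def)
  qed
  have finsp: "finite (sparse_functions \<beta> (d + 1) N)" for N
    by (rule finite_subset[of _ "\<beta> \<rightarrow>\<^sub>E {..N}"]) (auto simp: sparse_functions_def fin intro: finite_PiE)
  have close: "norm (G x - G y) \<le> 8 * real (card \<beta>) / N"
    if N: "1 \<le> N" and x: "x \<in> ?X" and y: "y \<in> ?X" and eq: "\<kappa> N x = \<kappa> N y"
      and G: "norm (G x - G y) \<le> 8 * (\<Sum>U\<in>\<beta>. \<bar>\<phi> U x - \<phi> U y\<bar>)" for N x y and G :: "'x \<Rightarrow> bmat"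
  proof -
    have "(\<Sum>U\<in>\<beta>. \<bar>\<phi> U x - \<phi> U y\<bar>) \<le> (\<Sum>U\<in>\<beta>. 1 / N)"
    proof (rule sum_mono)
      fix U assume U: "U \<in> \<beta>"
      have "nat \<lfloor>real N * \<phi> U x\<rfloor> = nat \<lfloor>real N * \<phi> U y\<rfloor>" using fun_cong[OF eq, of U] U by (simp add: \<kappa>_def)
      moreover have "0 \<le> real N * \<phi> U x" "0 \<le> real N * \<phi> U y" using \<phi>(2)[OF U] x y by auto
      ultimately have "\<lfloor>real N * \<phi> U x\<rfloor> = \<lfloor>real N * \<phi> U y\<rfloor>" by (metis eq_nat_nat_iff zero_le_floor)
      then have "\<bar>real N * \<phi> U x - real N * \<phi> U y\<bar> \<le> 1" by linarith
      then have "real N * \<bar>\<phi> U x - \<phi> U y\<bar> \<le> 1" by (simp add: right_diff_distrib[symmetric] abs_mult)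
      then show "\<bar>\<phi> U x - \<phi> U y\<bar> \<le> 1 / N" using N by (simp add: field_simps)
    qed
    then show ?thesis using G by simp
  qed
  have "\<exists>M\<in>carrier_mat r r. \<exists>c>0. \<forall>x\<in>?X. \<forall>\<xi>\<in>carrier_vec r. act r (F x) \<xi> = \<xi> \<longrightarrow>
    c * cvec_norm \<xi> \<le> cvec_norm (act r (E x) (M *\<^sub>v \<xi>))"
  proof (rule general_position[where \<kappa> = \<kappa> and L = "8 * real (card \<beta>)" and D = "d + 1" and C = "2 ^ card \<beta> * 2 ^ (d + 1)"])
    fix N :: nat assume N: "1 \<le> N"
    show "finite (\<kappa> N ` ?X)" by (rule finite_subset[OF \<kappa>in finsp])
    show "card (\<kappa> N ` ?X) \<le> 2 ^ card \<beta> * 2 ^ (d + 1) * N ^ (d + 1)"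
      using card_mono[OF finsp \<kappa>in, of N] card_sparse_functions_le[OF fin N, of "d + 1"] by linarith
    fix x y assume "x \<in> ?X" "y \<in> ?X" "\<kappa> N x = \<kappa> N y"
    then show "norm (E x - E y) \<le> 8 * real (card \<beta>) / N \<and> norm (F x - F y) \<le> 8 * real (card \<beta>) / N"
      using close[OF N] E(4) F(4) by blast
  qed (use E(1) F(1) rank in auto)
  then obtain M c0 where M: "M \<in> carrier_mat r r" and c0: "0 < c0"
    and low: "\<And>x \<xi>. x \<in> ?X \<Longrightarrow> \<xi> \<in> carrier_vec r \<Longrightarrow> act r (F x) \<xi> = \<xi> \<Longrightarrow> c0 * cvec_norm \<xi> \<le> cvec_norm (act r (E x) (M *\<^sub>v \<xi>))"
    by blast
  \<comment> \<open>Dividing by \<open>sqrt K\<close> makes \<open>E M F\<close> contractive;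
    the lower bound \<open>c0\<close> then keeps the defect below \<open>k < 1\<close> everywhere.\<close>
  define K where "K = (norm (emb r M))\<^sup>2 + c0\<^sup>2 + 1"
  have K: "0 < K" "c0\<^sup>2 \<le> K" by (auto simp: K_def add_nonneg_pos)
  define k where "k = 1 - c0\<^sup>2 / K"
  have k: "0 \<le> k" "k < 1" using K c0 by (auto simp: k_def)
  define w where "w x = (1 / sqrt K) *\<^sub>R (E x * emb r M * F x)" for x
  have wF: "w x * F x = w x" "E x * w x = w x" if x: "x \<in> ?X" for x
    using is_projectionD[OF E(1)[OF x]] is_projectionD[OF F(1)[OF x]]
    by (simp_all add: w_def mult.assoc) (simp add: mult.assoc[symmetric])
  have wk: "norm (F x - star (w x) * w x) \<le> k" if x: "x \<in> ?X" for x
  proof (rule norm_positive_le[OF _ _ k(1)])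
    note FF = is_projectionD[OF F(1)[OF x]] and EE = is_projectionD[OF E(1)[OF x]]
    have Fw: "F x * star (w x) = star (w x)" using arg_cong[OF wF(1)[OF x], of star] FF by (simp add: star_mult)
    show "star (F x - star (w x) * w x) = F x - star (w x) * w x" by (simp add: star_diff star_mult star_star FF)
    have "emb r (1\<^sub>m r) * star (w x) = (emb r (1\<^sub>m r) * F x) * star (w x)" by (simp only: mult.assoc Fw)
    then have "emb r (1\<^sub>m r) * star (w x) = star (w x)" by (simp only: F(3)[OF x] Fw)
    then show "emb r (1\<^sub>m r) * (F x - star (w x) * w x) = F x - star (w x) * w x"
      by (simp only: right_diff_distrib F(3)[OF x] mult.assoc[symmetric])
    fix v :: "complex vec" assume v: "v \<in> carrier_vec r"
    define \<xi> where "\<xi> = act r (F x) v"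
    have \<xi>: "\<xi> \<in> carrier_vec r" "act r (F x) \<xi> = \<xi>" using v FF by (auto simp: \<xi>_def act_mult[symmetric])
    have \<xi>v: "cvec_norm \<xi> \<le> cvec_norm v"
      using cvec_norm_act[OF v, of "F x"] norm_projection_le[OF F(1)[OF x]] mult_right_mono[of "norm (F x)" 1 "cvec_norm v"]
      by (simp add: \<xi>_def)
    have wv: "act r (w x) v = act r (w x) \<xi>" using wF(1)[OF x] v by (simp add: \<xi>_def act_mult[symmetric])
    have t1: "act r (F x) v \<bullet>c v = of_real ((cvec_norm \<xi>)\<^sup>2)"
    proof -
      have "act r (F x) v \<bullet>c v = act r (F x) (act r (F x) v) \<bullet>c v" using \<xi>(2) by (simp add: \<xi>_def)
      also have "\<dots> = \<xi> \<bullet>c \<xi>" using act_star[of "act r (F x) v" r v "F x"] v FF by (simp add: \<xi>_def)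
      finally show ?thesis by (simp add: cscalar_prod_self)
    qed
    have t2: "act r (star (w x) * w x) v \<bullet>c v = of_real ((cvec_norm (act r (w x) v))\<^sup>2)"
      using act_star[of "act r (w x) v" r v "star (w x)"] v by (simp add: act_mult star_star cscalar_prod_self)
    have q: "Re (act r (F x - star (w x) * w x) v \<bullet>c v) = (cvec_norm \<xi>)\<^sup>2 - (cvec_norm (act r (w x) \<xi>))\<^sup>2"
      using v t1 t2 by (simp add: act_diff minus_scalar_prod_distrib[of _ r] wv)
    have eM: "act r (emb r M) \<xi> = M *\<^sub>v \<xi>" using M by (simp add: act_def)
    have wx: "cvec_norm (act r (w x) \<xi>) = 1 / sqrt K * cvec_norm (act r (E x) (M *\<^sub>v \<xi>))"
    proof -
      have "act r (w x) \<xi> = of_real (1 / sqrt K) \<cdot>\<^sub>v act r (E x * emb r M * F x) \<xi>"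
        unfolding w_def act_def entry_scaleR by (rule smult_mult_mat_vec[OF entry_carrier \<xi>(1)])
      also have "act r (E x * emb r M * F x) \<xi> = act r (E x) (M *\<^sub>v \<xi>)" using \<xi> eM by (simp add: act_mult)
      finally show ?thesis using K by (simp add: cvec_norm_smult norm_divide)
    qed
    have "cvec_norm (act r (E x) (M *\<^sub>v \<xi>)) \<le> norm (emb r M) * cvec_norm \<xi>"
    proof -
      have "act r (E x) (M *\<^sub>v \<xi>) = act r (E x * emb r M) \<xi>" using \<xi> eM by (simp add: act_mult)
      also have "cvec_norm \<dots> \<le> norm (E x * emb r M) * cvec_norm \<xi>" by (rule cvec_norm_act[OF \<xi>(1)])
      also have "\<dots> \<le> (1 * norm (emb r M)) * cvec_norm \<xi>"
        using norm_projection_le[OF E(1)[OF x]] by (intro mult_right_mono order_trans[OF norm_mult_ineq]) auto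
      finally show ?thesis by simp
    qed
    then have "(cvec_norm (act r (E x) (M *\<^sub>v \<xi>)))\<^sup>2 \<le> (norm (emb r M) * cvec_norm \<xi>)\<^sup>2" by (intro power_mono) auto
    also have "\<dots> \<le> K * (cvec_norm \<xi>)\<^sup>2" unfolding power_mult_distrib by (intro mult_right_mono) (auto simp: K_def)
    finally have up: "(cvec_norm (act r (w x) \<xi>))\<^sup>2 \<le> (cvec_norm \<xi>)\<^sup>2"
      using K unfolding wx by (simp add: power_mult_distrib power_divide field_simps)
    have "(c0 * cvec_norm \<xi>)\<^sup>2 \<le> (cvec_norm (act r (E x) (M *\<^sub>v \<xi>)))\<^sup>2"
      by (rule power_mono[OF low[OF x \<xi>]]) (use c0 in simp)
    then have lo: "c0\<^sup>2 / K * (cvec_norm \<xi>)\<^sup>2 \<le> (cvec_norm (act r (w x) \<xi>))\<^sup>2"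
      using K unfolding wx by (simp add: power_mult_distrib power_divide divide_right_mono)
    have "(cvec_norm \<xi>)\<^sup>2 - (cvec_norm (act r (w x) \<xi>))\<^sup>2 \<le> k * (cvec_norm \<xi>)\<^sup>2"
      using lo by (simp add: k_def left_diff_distrib)
    also have "\<dots> \<le> k * (cvec_norm v)\<^sup>2" using \<xi>v k by (intro mult_left_mono power_mono) auto
    finally show "0 \<le> Re (act r (F x - star (w x) * w x) v \<bullet>c v) \<and>
        Re (act r (F x - star (w x) * w x) v \<bullet>c v) \<le> k * (cvec_norm v)\<^sup>2"
      unfolding q using up by simp
  qed
  obtain m where m: "k ^ m < 1/10" using real_arch_pow_inv[of "1/10" k] k by auto
  have km: "k ^ 2 ^ m \<le> 1/10"
    using power_decreasing[of m "2 ^ m" k] k m less_exp[of m] by simp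
  define V where "V x = (ns_step ^^ m) (w x)" for x
  have V: "V x * F x = V x" "norm (F x - star (V x) * V x) \<le> 1/10" "E x * V x = V x" if x: "x \<in> ?X" for x
  proof -
    have k1: "k \<le> 1" using k by simp
    note it = F(1)[OF x] wF(1)[OF x] wk[OF x] k1
    show "V x * F x = V x" unfolding V_def by (rule ns_iterate(1)[OF it])
    show "norm (F x - star (V x) * V x) \<le> 1/10"
      unfolding V_def by (rule order_trans[OF ns_iterate(2)[OF it] km])
    show "E x * V x = V x" unfolding V_def by (rule ns_iterate(3)[OF it wF(2)[OF x]])
  qed
  have V2: "norm (V x) \<le> 2" if x: "x \<in> ?X" for x
    by (rule norm_square_le[OF F(1)[OF x]]) (use V(2)[OF x] in simp)
  have cE: "continuous_map T euclidean E" by (rule continuous_map_if_dominated[OF fin \<phi>(1) E(4)])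
  have cF: "continuous_map T euclidean F" by (rule continuous_map_if_dominated[OF fin \<phi>(1) F(4)])
  have cw: "continuous_map T euclidean w"
    using cE cF unfolding w_def continuous_map_atin by (auto intro!: tendsto_intros)
  have "continuous_map T euclidean (\<lambda>x. (ns_step ^^ j) (w x))" for j
  proof (induction j)
    case 0 then show ?case using cw by simp
  next
    case (Suc j)
    then show ?case unfolding funpow.simps o_def ns_step_def continuous_map_atin by (auto intro!: tendsto_intros)
  qed
  then have cV: "continuous_map T euclidean V" unfolding V_def .
  have est: "norm (Q x - Q x * star (V x) * P x * V x * Q x) \<le> 1/2" if x: "x \<in> ?X" for x
  proof -
    define A where "A = V x * Q x"
    have nA: "norm A \<le> 2 * 2" unfolding A_def
      by (rule order_trans[OF norm_mult_ineq]) (use V2[OF x] Q2[OF x] in \<open>intro mult_mono; simp\<close>)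
    have AV: "norm (A - V x) \<le> 2 * (19 * \<epsilon>)"
    proof -
      have "A - V x = V x * (Q x - F x)" using V(1)[OF x] by (simp add: A_def right_diff_distrib)
      then show ?thesis using norm_mult_ineq[of "V x" "Q x - F x"] V2[OF x] F(2)[OF x]
        by (metis (no_types, lifting) mult_mono norm_ge_zero norm_minus_commute order_trans zero_le_numeral)
    qed
    have QA: "Q x * star (V x) * P x * V x * Q x = star A * P x * A"
      using sQ[OF x] by (simp add: A_def star_mult mult.assoc)
    have dec: "star A * P x * A - F x = star (A - V x) * P x * A + star (V x) * P x * (A - V x)
        + star (V x) * (P x - E x) * V x - (F x - star (V x) * V x)"
    proof -
      have "star (V x) * E x * V x = star (V x) * V x" using V(3)[OF x] by (simp add: mult.assoc)
      then show ?thesis by (simp add: star_diff left_diff_distrib right_diff_distrib)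
    qed
    have "norm (star A * P x * A - F x) \<le> norm (star (A - V x) * P x * A) + norm (star (V x) * P x * (A - V x))
        + norm (star (V x) * (P x - E x) * V x) + norm (F x - star (V x) * V x)"
      unfolding dec
      using norm_triangle_ineq4[of "star (A - V x) * P x * A + star (V x) * P x * (A - V x)
          + star (V x) * (P x - E x) * V x" "F x - star (V x) * V x"]
        norm_triangle_ineq[of "star (A - V x) * P x * A + star (V x) * P x * (A - V x)" "star (V x) * (P x - E x) * V x"]
        norm_triangle_ineq[of "star (A - V x) * P x * A" "star (V x) * P x * (A - V x)"] by linarith
    moreover have "norm (star (A - V x) * P x * A) \<le> (2 * (19 * \<epsilon>)) * 2 * (2 * 2)"
      by (rule order_trans[OF norm_mult3_le]) (use AV P2[OF x] nA \<epsilon> in \<open>intro mult_mono; simp\<close>)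
    moreover have "norm (star (V x) * P x * (A - V x)) \<le> 2 * 2 * (2 * (19 * \<epsilon>))"
      by (rule order_trans[OF norm_mult3_le]) (use AV P2[OF x] V2[OF x] \<epsilon> in \<open>intro mult_mono; simp\<close>)
    moreover have "norm (star (V x) * (P x - E x) * V x) \<le> 2 * (19 * \<epsilon>) * 2"
      by (rule order_trans[OF norm_mult3_le])
         (use E(2)[OF x] V2[OF x] \<epsilon> in \<open>intro mult_mono; simp add: norm_minus_commute\<close>)
    moreover have "norm (Q x - star A * P x * A) \<le> norm (star A * P x * A - F x) + norm (F x - Q x)"
      using norm_triangle_ineq[of "star A * P x * A - F x" "F x - Q x"] by (simp add: norm_minus_commute)
    ultimately show ?thesis unfolding QA using V(2)[OF x] F(2)[OF x] \<epsilon> by linarith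
  qed
  have rV: "emb r (1\<^sub>m r) * V x = V x" if x: "x \<in> ?X" for x
  proof -
    have "emb r (1\<^sub>m r) * V x = (emb r (1\<^sub>m r) * E x) * V x" by (simp only: mult.assoc V(3)[OF x])
    then show ?thesis by (simp only: E(3)[OF x] V(3)[OF x])
  qed
  show ?thesis using cV V2 est rV by (intro exI[of _ V]) auto
qed

section \<open>The building blocks as sections over their base spaces\<close>

text \<open>
  The definitions of the building blocks use continuity of the entries, the C*-algebraic arguments use the norm.
\<close>

lemma tendsto_emb_iff:
  assumes c: "\<And>y. y \<in> S \<Longrightarrow> F y \<in> carrier_mat r r" and A: "A \<in> carrier_mat r r" and S: "eventually (\<lambda>y. y \<in> S) G"
  shows "((\<lambda>y. emb r (F y)) \<longlongrightarrow> emb r A) G \<longleftrightarrow> (\<forall>a<r. \<forall>b<r. ((\<lambda>y. F y $$ (a, b)) \<longlongrightarrow> A $$ (a, b)) G)"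
proof safe
  fix a b assume lim: "((\<lambda>y. emb r (F y)) \<longlongrightarrow> emb r A) G" and ab: "a < r" "b < r"
  have "((\<lambda>y. F y $$ (a, b) - A $$ (a, b)) \<longlongrightarrow> 0) G"
  proof (rule Lim_null_comparison)
    show "((\<lambda>y. norm (emb r (F y) - emb r A)) \<longlongrightarrow> 0) G"
      using tendsto_norm[OF tendsto_diff[OF lim tendsto_const[of "emb r A"]]] by simp
    show "\<forall>\<^sub>F y in G. norm (F y $$ (a, b) - A $$ (a, b)) \<le> norm (emb r (F y) - emb r A)"
      using S
    proof eventually_elim
      case (elim y)
      have "norm (F y $$ (a, b) - A $$ (a, b)) = cmod ((F y - A) $$ (a, b))" using c[OF elim] A ab by simp
      also have "\<dots> \<le> mat_opnorm (F y - A)"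
        by (rule cmod_index_le_mat_opnorm[of _ r r]) (use A ab in \<open>auto intro: minus_carrier_mat\<close>)
      also have "\<dots> = norm (emb r (F y) - emb r A)"
        using c[OF elim] A by (simp add: emb_diff[symmetric] norm_emb minus_carrier_mat)
      finally show ?case .
    qed
  qed
  then show "((\<lambda>y. F y $$ (a, b)) \<longlongrightarrow> A $$ (a, b)) G" by (simp add: LIM_zero_iff)
next
  assume lim: "\<forall>a<r. \<forall>b<r. ((\<lambda>y. F y $$ (a, b)) \<longlongrightarrow> A $$ (a, b)) G"
  have l0: "((\<lambda>y. cmod (F y $$ (a, b) - A $$ (a, b))) \<longlongrightarrow> 0) G" if "a < r" "b < r" for a b
    using lim that tendsto_norm[OF tendsto_diff[OF _ tendsto_const[of "A $$ (a, b)"]]] by force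
  have "((\<lambda>y. \<Sum>a<r. \<Sum>b<r. cmod (F y $$ (a, b) - A $$ (a, b))) \<longlongrightarrow> (\<Sum>a<r. \<Sum>b<r. 0)) G"
    by (intro tendsto_sum l0) auto
  then have l1: "((\<lambda>y. \<Sum>a<r. \<Sum>b<r. cmod (F y $$ (a, b) - A $$ (a, b))) \<longlongrightarrow> 0) G" by simp
  have "((\<lambda>y. emb r (F y) - emb r A) \<longlongrightarrow> 0) G"
  proof (rule Lim_null_comparison[OF _ l1])
    show "\<forall>\<^sub>F y in G. norm (emb r (F y) - emb r A) \<le> (\<Sum>a<r. \<Sum>b<r. cmod (F y $$ (a, b) - A $$ (a, b)))"
      using S
    proof eventually_elim
      case (elim y)
      have "norm (emb r (F y) - emb r A) = mat_opnorm (F y - A)"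
        using c[OF elim] A by (simp add: emb_diff[symmetric] norm_emb minus_carrier_mat)
      also have "\<dots> \<le> (\<Sum>a<r. \<Sum>b<r. cmod ((F y - A) $$ (a, b)))"
        by (rule mat_opnorm_le_sum) (use A in \<open>auto intro: minus_carrier_mat\<close>)
      also have "\<dots> = (\<Sum>a<r. \<Sum>b<r. cmod (F y $$ (a, b) - A $$ (a, b)))"
        using c[OF elim] A by (intro sum.cong) auto
      finally show ?case .
    qed
  qed
  then show "((\<lambda>y. emb r (F y)) \<longlongrightarrow> emb r A) G" by (simp add: LIM_zero_iff)
qed

lemma eventually_atin_topspace: "eventually (\<lambda>y. y \<in> topspace T) (atin T x)"
  unfolding eventually_atin by (cases "x \<in> topspace T") (auto intro!: exI[of _ "topspace T"])

lemma continuous_map_emb_iff: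
  assumes c: "\<And>y. y \<in> topspace T \<Longrightarrow> F y \<in> carrier_mat r r"
  shows "continuous_map T euclidean (\<lambda>y. emb r (F y)) \<longleftrightarrow> (\<forall>a<r. \<forall>b<r. continuous_map T euclidean (\<lambda>y. F y $$ (a, b)))"
proof -
  have "((\<lambda>y. emb r (F y)) \<longlongrightarrow> emb r (F x)) (atin T x) \<longleftrightarrow>
      (\<forall>a<r. \<forall>b<r. ((\<lambda>y. F y $$ (a, b)) \<longlongrightarrow> F x $$ (a, b)) (atin T x))" if "x \<in> topspace T" for x
    by (rule tendsto_emb_iff[where S = "topspace T"]) (use c that eventually_atin_topspace in auto)
  then show ?thesis unfolding continuous_map_atin limitin_canonical_iff by blast
qed

lemma continuous_map_bmat_mult:
  fixes f g :: "'x \<Rightarrow> bmat"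
  shows "continuous_map T euclidean f \<Longrightarrow> continuous_map T euclidean g \<Longrightarrow> continuous_map T euclidean (\<lambda>x. f x * g x)"
  by (auto simp: continuous_map_atin intro!: tendsto_intros)

lemma continuous_map_bmat_star:
  fixes f :: "'x \<Rightarrow> bmat"
  shows "continuous_map T euclidean f \<Longrightarrow> continuous_map T euclidean (\<lambda>x. star (f x))"
  by (auto simp: continuous_map_atin intro!: tendsto_intros)

lemma bounded_linear_scaleC: "bounded_linear (scaleC c :: 'a::unital_cstar_algebra \<Rightarrow> 'a)"
proof (rule bounded_linear_intro[where K = "cmod c"])
  show "scaleC c (r *\<^sub>R x) = r *\<^sub>R scaleC c x" for r and x :: 'a
    by (simp add: scaleC_of_real[symmetric] scaleC_scaleC mult.commute)
qed (auto simp: scaleC_add_right norm_scaleC)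

lemmas tendsto_scaleC [tendsto_intros] = bounded_linear.tendsto[OF bounded_linear_scaleC]

lemma scaleC_zero_left [simp]: "scaleC 0 (x :: 'a::unital_cstar_algebra) = 0"
  using scaleC_of_real[of 0 x] by simp

lemma emb_one_mult: "M \<in> carrier_mat r r \<Longrightarrow> emb r (1\<^sub>m r) * emb r M = emb r M"
  by (simp add: emb_mult[symmetric])

lemma emb_inject: "M \<in> carrier_mat r r \<Longrightarrow> N \<in> carrier_mat r r \<Longrightarrow> emb r M = emb r N \<longleftrightarrow> M = N"
  by (metis entry_emb_same)

locale building_blocks =
  fixes D :: "'x ah_data"
  assumes blocks: "ah_building_blocks D"
begin

lemma summands_pos: "0 < summands D i"
  using blocks by (simp add: ah_building_blocks_def)

context
  fixes j k assumes k: "k < summands D j"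
begin

lemma base_props: "topspace (base D j k) \<noteq> {}" "connected_space (base D j k)"
    "compact_space (base D j k)" "Hausdorff_space (base D j k)" "0 < rk D j k"
    "matrix_projection (base D j k) (msize D j k) (rk D j k) (cproj D j k)"
  using blocks k by (auto simp: ah_building_blocks_def)

lemma cproj_carrier: "x \<in> topspace (base D j k) \<Longrightarrow> cproj D j k x \<in> carrier_mat (msize D j k) (msize D j k)"
  using base_props(6) by (auto simp: matrix_projection_def matrix_functions_def)

end

text \<open>
  The unit of the fibre at \<open>x\<close> of the bundle whose sections form the \<open>k\<close>-th summand.
\<close>

definition un :: "nat \<Rightarrow> nat \<Rightarrow> 'x \<Rightarrow> bmat" where
  "un j k x = emb (msize D j k) (cproj D j k x)"

text \<open>
  Elements of the stages are regarded as sections with values in the one C*-algebra \<^typ>\<open>bmat\<close>.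
\<close>

definition sec :: "nat \<Rightarrow> 'x dsum \<Rightarrow> nat \<Rightarrow> 'x \<Rightarrow> bmat" where
  "sec j a k x = emb (msize D j k) (a k x)"

lemma un_projection:
  assumes k: "k < summands D j" and x: "x \<in> topspace (base D j k)"
  shows "is_projection (un j k x)" "tr (msize D j k) (un j k x) = of_nat (rk D j k)"
    "emb (msize D j k) (1\<^sub>m (msize D j k)) * un j k x = un j k x"
proof -
  note c = cproj_carrier[OF k x]
  have p: "cproj D j k x * cproj D j k x = cproj D j k x" "mat_adjoint (cproj D j k x) = cproj D j k x"
    "vec_space.rank (msize D j k) (cproj D j k x) = rk D j k"
    using base_props(6)[OF k] x by (auto simp: matrix_projection_def)
  show pr: "is_projection (un j k x)"
    unfolding is_projection_def un_def using p c by (simp add: emb_mult[symmetric] emb_adjoint[symmetric])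
  show "tr (msize D j k) (un j k x) = of_nat (rk D j k)"
    using trace_eq_rank[OF pr, of "msize D j k"] p(3) c by (simp add: un_def)
  show "emb (msize D j k) (1\<^sub>m (msize D j k)) * un j k x = un j k x"
    unfolding un_def by (rule emb_one_mult[OF c])
qed

lemma matrix_functions_iff:
  "f \<in> matrix_functions T r \<longleftrightarrow> f \<in> extensional (topspace T) \<and> (\<forall>x\<in>topspace T. f x \<in> carrier_mat r r) \<and>
     continuous_map T euclidean (\<lambda>x. emb r (f x))"
  using continuous_map_emb_iff[of T f r] by (auto simp: matrix_functions_def PiE_iff)

lemma un_continuous: "k < summands D j \<Longrightarrow> continuous_map (base D j k) euclidean (un j k)"
  using base_props(6)[of k j] by (simp add: matrix_projection_def matrix_functions_iff un_def[abs_def])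

lemma block_iff:
  assumes k: "k < summands D j"
  shows "f \<in> block D j k \<longleftrightarrow> f \<in> extensional (topspace (base D j k)) \<and>
    (\<forall>x\<in>topspace (base D j k). f x \<in> carrier_mat (msize D j k) (msize D j k) \<and>
      un j k x * emb (msize D j k) (f x) * un j k x = emb (msize D j k) (f x)) \<and>
    continuous_map (base D j k) euclidean (\<lambda>x. emb (msize D j k) (f x))"
proof -
  let ?T = "base D j k" and ?r = "msize D j k" and ?p = "cproj D j k"
  note pc = cproj_carrier[OF k]
  have conv: "emb ?r (?p x * g x * ?p x) = un j k x * emb ?r (g x) * un j k x"
    if "x \<in> topspace ?T" "g x \<in> carrier_mat ?r ?r" for g :: "'x \<Rightarrow> complex mat" and x
    unfolding un_def using pc[OF that(1)] that(2) by (simp add: emb_mult[of _ ?r] mult_carrier_mat[of _ ?r ?r] mult.assoc)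
  show ?thesis
  proof
    assume "f \<in> block D j k"
    then obtain g where g: "g \<in> matrix_functions ?T ?r" "f = (\<lambda>x\<in>topspace ?T. ?p x * g x * ?p x)"
      by (auto simp: block_def corner_def)
    have gc: "g x \<in> carrier_mat ?r ?r" if "x \<in> topspace ?T" for x using g(1) that by (simp add: matrix_functions_iff)
    have ef: "emb ?r (f x) = un j k x * emb ?r (g x) * un j k x" if "x \<in> topspace ?T" for x
      using conv[of x g] gc[OF that] that by (simp add: g(2))
    have "continuous_map ?T euclidean (\<lambda>x. un j k x * emb ?r (g x) * un j k x)"
      using g(1) by (intro continuous_map_bmat_mult un_continuous[OF k]) (simp add: matrix_functions_iff)
    then have "continuous_map ?T euclidean (\<lambda>x. emb ?r (f x))"
      by (rule continuous_map_eq) (simp add: ef)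
    moreover have "un j k x * emb ?r (f x) * un j k x = emb ?r (f x)" if x: "x \<in> topspace ?T" for x
      using is_projectionD(1)[OF un_projection(1)[OF k x]] unfolding ef[OF x] by (simp add: mult.assoc) (simp add: mult.assoc[symmetric])
    moreover have "f x \<in> carrier_mat ?r ?r" if "x \<in> topspace ?T" for x
      using that pc[OF that] gc[OF that] by (auto simp: g(2) intro!: mult_carrier_mat)
    ultimately show "f \<in> extensional (topspace ?T) \<and>
      (\<forall>x\<in>topspace ?T. f x \<in> carrier_mat ?r ?r \<and> un j k x * emb ?r (f x) * un j k x = emb ?r (f x)) \<and>
      continuous_map ?T euclidean (\<lambda>x. emb ?r (f x))" by (auto simp: g(2))
  next
    assume f: "f \<in> extensional (topspace ?T) \<and>
      (\<forall>x\<in>topspace ?T. f x \<in> carrier_mat ?r ?r \<and> un j k x * emb ?r (f x) * un j k x = emb ?r (f x)) \<and>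
      continuous_map ?T euclidean (\<lambda>x. emb ?r (f x))"
    have "f = (\<lambda>x\<in>topspace ?T. ?p x * f x * ?p x)"
    proof
      fix x
      show "f x = (\<lambda>x\<in>topspace ?T. ?p x * f x * ?p x) x"
      proof (cases "x \<in> topspace ?T")
        case True
        then have "emb ?r (?p x * f x * ?p x) = emb ?r (f x)" using conv[of x f] f by simp
        then have "?p x * f x * ?p x = f x" 
          using True f pc[OF True] emb_inject[of "?p x * f x * ?p x" ?r "f x"] by (auto simp: mult_carrier_mat[of _ ?r ?r])
        then show ?thesis using True by simp
      next
        case False
        then show ?thesis using f by (simp add: extensional_def)
      qed
    qed
    moreover have "f \<in> matrix_functions ?T ?r" using f by (simp add: matrix_functions_iff)
    ultimately show "f \<in> block D j k" unfolding block_def corner_def by blast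
  qed
qed

abbreviation "A j \<equiv> sa_carrier (stage D j)"

lemma carrier_stage_iff:
  "a \<in> A j \<longleftrightarrow> a \<in> extensional {..<summands D j} \<and> (\<forall>k<summands D j. a k \<in> extensional (topspace (base D j k)) \<and>
    (\<forall>x\<in>topspace (base D j k). a k x \<in> carrier_mat (msize D j k) (msize D j k) \<and> un j k x * sec j a k x * un j k x = sec j a k x) \<and>
    continuous_map (base D j k) euclidean (sec j a k))"
  by (auto simp: stage_def PiE_iff block_iff sec_def[abs_def])

lemma carrier_stageD:
  assumes "a \<in> A j" "k < summands D j"
  shows "a k \<in> block D j k" "continuous_map (base D j k) euclidean (sec j a k)"
    "x \<in> topspace (base D j k) \<Longrightarrow> a k x \<in> carrier_mat (msize D j k) (msize D j k)"
    "x \<in> topspace (base D j k) \<Longrightarrow> un j k x * sec j a k x * un j k x = sec j a k x"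
    "x \<in> topspace (base D j k) \<Longrightarrow> un j k x * sec j a k x = sec j a k x"
    "x \<in> topspace (base D j k) \<Longrightarrow> sec j a k x * un j k x = sec j a k x"
proof -
  show "a k \<in> block D j k" using assms by (auto simp: stage_def)
  show "continuous_map (base D j k) euclidean (sec j a k)"
    "x \<in> topspace (base D j k) \<Longrightarrow> a k x \<in> carrier_mat (msize D j k) (msize D j k)"
    using assms by (auto simp: carrier_stage_iff)
  show u: "x \<in> topspace (base D j k) \<Longrightarrow> un j k x * sec j a k x * un j k x = sec j a k x"
    using assms by (auto simp: carrier_stage_iff)
  assume x: "x \<in> topspace (base D j k)"
  note pp = is_projectionD(1)[OF un_projection(1)[OF assms(2) x]]
  have "un j k x * sec j a k x = (un j k x * un j k x) * sec j a k x * un j k x"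
    using u[OF x] by (metis mult.assoc)
  then show "un j k x * sec j a k x = sec j a k x" unfolding pp u[OF x] .
  have "sec j a k x * un j k x = un j k x * sec j a k x * (un j k x * un j k x)"
    using u[OF x] by (metis mult.assoc)
  then show "sec j a k x * un j k x = sec j a k x" unfolding pp u[OF x] .
qed

text \<open>
  The inverse passage from sections to elements of the stage.
\<close>

definition of_sections :: "nat \<Rightarrow> (nat \<Rightarrow> 'x \<Rightarrow> bmat) \<Rightarrow> 'x dsum" where
  "of_sections j G = pointwise D j (\<lambda>k x. entry (G k x) (msize D j k))"

lemma of_sections_props:
  assumes G: "\<And>k x. k < summands D j \<Longrightarrow> x \<in> topspace (base D j k) \<Longrightarrow> un j k x * G k x * un j k x = G k x"
    and c: "\<And>k. k < summands D j \<Longrightarrow> continuous_map (base D j k) euclidean (G k)"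
  shows "of_sections j G \<in> A j"
    "\<And>k x. k < summands D j \<Longrightarrow> x \<in> topspace (base D j k) \<Longrightarrow> sec j (of_sections j G) k x = G k x"
proof -
  show s: "sec j (of_sections j G) k x = G k x" if k: "k < summands D j" and x: "x \<in> topspace (base D j k)" for k x
  proof -
    have "emb (msize D j k) (1\<^sub>m (msize D j k)) * G k x = G k x"
    proof -
      have "emb (msize D j k) (1\<^sub>m (msize D j k)) * (un j k x * G k x * un j k x) = un j k x * G k x * un j k x"
        using un_projection(3)[OF k x] by (simp add: mult.assoc[symmetric])
      then show ?thesis unfolding G[OF k x] .
    qed
    then show ?thesis using k x emb_entry by (simp add: sec_def of_sections_def pointwise_def)
  qed
  have "continuous_map (base D j k) euclidean (sec j (of_sections j G) k)" if k: "k < summands D j" for k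
    by (rule continuous_map_eq[OF c[OF k]]) (simp add: s k)
  then show "of_sections j G \<in> A j"
    unfolding carrier_stage_iff using G s by (auto simp: of_sections_def pointwise_def)
qed

lemma sec_inject:
  assumes a: "a \<in> A j" and b: "b \<in> A j"
    and eq: "\<And>k x. k < summands D j \<Longrightarrow> x \<in> topspace (base D j k) \<Longrightarrow> sec j a k x = sec j b k x"
  shows "a = b"
proof (rule extensionalityI[of _ "{..<summands D j}"])
  show "a \<in> extensional {..<summands D j}" "b \<in> extensional {..<summands D j}" using a b by (auto simp: carrier_stage_iff)
  fix k assume k: "k \<in> {..<summands D j}"
  show "a k = b k"
  proof (rule extensionalityI[of _ "topspace (base D j k)"])
    show "a k \<in> extensional (topspace (base D j k))" "b k \<in> extensional (topspace (base D j k))"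
      using a b k by (auto simp: carrier_stage_iff)
    fix x assume x: "x \<in> topspace (base D j k)"
    show "a k x = b k x"
      using eq[of k x] k x carrier_stageD(3)[OF a, of k x] carrier_stageD(3)[OF b, of k x]
      by (simp add: sec_def emb_inject)
  qed
qed

lemma sec_stage_ops:
  assumes a: "a \<in> A j" and k: "k < summands D j" and x: "x \<in> topspace (base D j k)"
  shows "b \<in> A j \<Longrightarrow> sec j (sa_plus (stage D j) a b) k x = sec j a k x + sec j b k x"
    "b \<in> A j \<Longrightarrow> sec j (sa_times (stage D j) a b) k x = sec j a k x * sec j b k x"
    "sec j (sa_scale (stage D j) c a) k x = scaleC c (sec j a k x)"
    "sec j (sa_star (stage D j) a) k x = star (sec j a k x)"
  using carrier_stageD(3)[OF a k x] carrier_stageD(3)[OF _ k x] k x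
  by (auto simp: sec_def stage_def pointwise_def emb_add emb_mult emb_smult emb_adjoint)

lemma sec_one: "k < summands D j \<Longrightarrow> x \<in> topspace (base D j k) \<Longrightarrow> sec j (sa_one (stage D j)) k x = un j k x"
  by (simp add: sec_def stage_def pointwise_def un_def)

lemma stage_closed:
  assumes a: "a \<in> A j"
  shows "b \<in> A j \<Longrightarrow> sa_plus (stage D j) a b \<in> A j" "b \<in> A j \<Longrightarrow> sa_times (stage D j) a b \<in> A j"
    "sa_scale (stage D j) c a \<in> A j" "sa_star (stage D j) a \<in> A j" "sa_one (stage D j) \<in> A j"
proof -
  note D = carrier_stageD[OF a]
  have ext: "pointwise D j F \<in> extensional {..<summands D j}"
      "k < summands D j \<Longrightarrow> pointwise D j F k \<in> extensional (topspace (base D j k))" for F k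
    by (auto simp: pointwise_def)
  have I: "g \<in> A j" if g: "\<And>k. k < summands D j \<Longrightarrow> continuous_map (base D j k) euclidean (G k)"
      "\<And>k x. k < summands D j \<Longrightarrow> x \<in> topspace (base D j k) \<Longrightarrow> sec j g k x = G k x"
      "\<And>k x. k < summands D j \<Longrightarrow> x \<in> topspace (base D j k) \<Longrightarrow> un j k x * G k x * un j k x = G k x"
      "\<And>k x. k < summands D j \<Longrightarrow> x \<in> topspace (base D j k) \<Longrightarrow> g k x \<in> carrier_mat (msize D j k) (msize D j k)"
      "g = pointwise D j F" for g G F
    unfolding carrier_stage_iff using g(2-4) ext continuous_map_eq[OF g(1)] unfolding g(5) by simp
  have cm: "continuous_map (base D j k) euclidean (sec j a k)" if "k < summands D j" for k using D(2)[OF that] .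
  {
    assume b: "b \<in> A j"
    note Db = carrier_stageD[OF b]
    show "sa_plus (stage D j) a b \<in> A j"
      by (rule I[where G = "\<lambda>k x. sec j a k x + sec j b k x"])
         (use D Db sec_stage_ops(1)[OF a _ _ b] in \<open>auto simp: stage_def pointwise_def distrib_left distrib_right
            continuous_map_atin intro!: tendsto_intros\<close>)
    show "sa_times (stage D j) a b \<in> A j"
    proof (rule I[where G = "\<lambda>k x. sec j a k x * sec j b k x"])
      show "continuous_map (base D j k) euclidean (\<lambda>x. sec j a k x * sec j b k x)" if "k < summands D j" for k
        by (rule continuous_map_bmat_mult[OF D(2)[OF that] Db(2)[OF that]])
      show "un j k x * (sec j a k x * sec j b k x) * un j k x = sec j a k x * sec j b k x"
        if "k < summands D j" "x \<in> topspace (base D j k)" for k x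
        using D(5)[OF that] Db(6)[OF that] by (metis mult.assoc)
      show "sa_times (stage D j) a b k x \<in> carrier_mat (msize D j k) (msize D j k)"
        if "k < summands D j" "x \<in> topspace (base D j k)" for k x
        using that D(3)[OF that] Db(3)[OF that] by (auto simp: stage_def pointwise_def intro: mult_carrier_mat)
      show "sa_times (stage D j) a b = pointwise D j (\<lambda>l x. a l x * b l x)" by (simp add: stage_def)
    qed (rule sec_stage_ops(2)[OF a _ _ b])
  }
  show "sa_scale (stage D j) c a \<in> A j"
    by (rule I[where G = "\<lambda>k x. scaleC c (sec j a k x)"])
       (use D sec_stage_ops(3)[OF a] in \<open>auto simp: stage_def pointwise_def mult_scaleC_right mult_scaleC_left
            continuous_map_atin intro!: tendsto_intros\<close>)
  show "sa_star (stage D j) a \<in> A j"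
  proof (rule I[where G = "\<lambda>k x. star (sec j a k x)"])
    show "continuous_map (base D j k) euclidean (\<lambda>x. star (sec j a k x))" if "k < summands D j" for k
      by (rule continuous_map_bmat_star[OF D(2)[OF that]])
    show "un j k x * star (sec j a k x) * un j k x = star (sec j a k x)"
      if "k < summands D j" "x \<in> topspace (base D j k)" for k x
      using arg_cong[OF D(4)[OF that], of star] is_projectionD(2)[OF un_projection(1)[OF that]]
      by (simp add: star_mult mult.assoc)
    show "sa_star (stage D j) a k x \<in> carrier_mat (msize D j k) (msize D j k)"
      if "k < summands D j" "x \<in> topspace (base D j k)" for k x
      using that D(3)[OF that] by (auto simp: stage_def pointwise_def)
    show "sa_star (stage D j) a = pointwise D j (\<lambda>l x. mat_adjoint (a l x))" by (simp add: stage_def)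
  qed (rule sec_stage_ops(4)[OF a])
  show "sa_one (stage D j) \<in> A j"
  proof (rule I[where G = "un j"])
    show "continuous_map (base D j k) euclidean (un j k)" if "k < summands D j" for k by (rule un_continuous[OF that])
    show "un j k x * un j k x * un j k x = un j k x" if "k < summands D j" "x \<in> topspace (base D j k)" for k x
      using is_projectionD(1)[OF un_projection(1)[OF that]] by simp
    show "sa_one (stage D j) k x \<in> carrier_mat (msize D j k) (msize D j k)"
      if "k < summands D j" "x \<in> topspace (base D j k)" for k x
      using that cproj_carrier[OF that] by (simp add: stage_def pointwise_def)
    show "sa_one (stage D j) = pointwise D j (cproj D j)" by (simp add: stage_def)
  qed (rule sec_one)
qed

lemma norm_sec: "a \<in> A j \<Longrightarrow> k < summands D j \<Longrightarrow> x \<in> topspace (base D j k) \<Longrightarrow> norm (sec j a k x) = mat_opnorm (a k x)"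
  by (simp add: sec_def norm_emb carrier_stageD(3))

lemma bounded_sec:
  assumes a: "a \<in> A j"
  shows "\<exists>K\<ge>0. \<forall>k<summands D j. \<forall>x\<in>topspace (base D j k). norm (sec j a k x) \<le> K"
proof -
  have "\<exists>K. \<forall>x\<in>topspace (base D j k). norm (sec j a k x) \<le> K" if k: "k < summands D j" for k
  proof -
    have "compactin euclidean (sec j a k ` topspace (base D j k))"
      by (rule image_compactin[OF _ carrier_stageD(2)[OF a k]]) (use base_props(3)[OF k] in \<open>simp add: compact_space_def\<close>)
    then have "bounded (sec j a k ` topspace (base D j k))" by (simp add: compact_imp_bounded)
    then show ?thesis by (auto simp: bounded_iff)
  qed
  then obtain K where K: "\<And>k x. k < summands D j \<Longrightarrow> x \<in> topspace (base D j k) \<Longrightarrow> norm (sec j a k x) \<le> K k" by metis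
  show ?thesis
  proof (intro exI[of _ "\<Sum>k<summands D j. \<bar>K k\<bar>"] conjI allI impI ballI)
    show "0 \<le> (\<Sum>k<summands D j. \<bar>K k\<bar>)" by (simp add: sum_nonneg)
    fix k x assume *: "k < summands D j" "x \<in> topspace (base D j k)"
    have "norm (sec j a k x) \<le> \<bar>K k\<bar>" using K[OF *] by simp
    also have "\<dots> \<le> (\<Sum>k<summands D j. \<bar>K k\<bar>)" by (rule member_le_sum) (use * in auto)
    finally show "norm (sec j a k x) \<le> (\<Sum>k<summands D j. \<bar>K k\<bar>)" .
  qed
qed

lemma norm_sec_le_sa_norm:
  assumes a: "a \<in> A j" and k: "k < summands D j" and x: "x \<in> topspace (base D j k)"
  shows "norm (sec j a k x) \<le> sa_norm (stage D j) a"
proof -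
  obtain K where K: "\<forall>k<summands D j. \<forall>x\<in>topspace (base D j k). norm (sec j a k x) \<le> K" using bounded_sec[OF a] by blast
  have "mat_opnorm (a k x) \<le> Sup {mat_opnorm (a l x) | l x. l < summands D j \<and> x \<in> topspace (base D j l)}"
  proof (rule cSup_upper)
    show "bdd_above {mat_opnorm (a l x) | l x. l < summands D j \<and> x \<in> topspace (base D j l)}"
      by (rule bdd_aboveI[of _ K]) (use K norm_sec[OF a] in auto)
  qed (use k x in auto)
  then show ?thesis using norm_sec[OF a k x] by (simp add: stage_def)
qed

lemma sa_norm_le:
  assumes a: "a \<in> A j"
    and "\<And>k x. k < summands D j \<Longrightarrow> x \<in> topspace (base D j k) \<Longrightarrow> norm (sec j a k x) \<le> K"
  shows "sa_norm (stage D j) a \<le> K"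
proof -
  obtain x where "x \<in> topspace (base D j 0)" using base_props(1)[OF summands_pos] by blast
  then have "mat_opnorm (a 0 x) \<in> {mat_opnorm (a l x) | l x. l < summands D j \<and> x \<in> topspace (base D j l)}"
    using summands_pos by blast
  then have "Sup {mat_opnorm (a l x) | l x. l < summands D j \<and> x \<in> topspace (base D j l)} \<le> K"
    by (intro cSup_least) (use assms norm_sec[OF a] in auto)
  then show ?thesis by (simp add: stage_def)
qed

end

section \<open>Norms of block diagonal matrices\<close>

lemma cvec_norm_append: "(cvec_norm (v @\<^sub>v w))\<^sup>2 = (cvec_norm v)\<^sup>2 + (cvec_norm w)\<^sup>2"
proof -
  have "complex_of_real ((cvec_norm (v @\<^sub>v w))\<^sup>2) = (v @\<^sub>v w) \<bullet> (conjugate v @\<^sub>v conjugate w)"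
  proof -
    have "conjugate (v @\<^sub>v w) = conjugate v @\<^sub>v conjugate w" by (intro eq_vecI) auto
    then show ?thesis using cscalar_prod_self[of "v @\<^sub>v w"] by simp
  qed
  also have "\<dots> = v \<bullet>c v + w \<bullet>c w"
    by (rule scalar_prod_append[of _ "dim_vec v" _ "dim_vec w"]) (auto intro: carrier_vecI)
  also have "\<dots> = complex_of_real ((cvec_norm v)\<^sup>2 + (cvec_norm w)\<^sup>2)" by (simp add: cscalar_prod_self)
  finally show ?thesis by (simp only: of_real_eq_iff)
qed

lemma opnorm_diag_block2:
  assumes A: "A \<in> carrier_mat n n" "mat_opnorm A \<le> K" and B: "B \<in> carrier_mat m m" "mat_opnorm B \<le> K"
  shows "mat_opnorm (four_block_mat A (0\<^sub>m n m) (0\<^sub>m m n) B) \<le> K"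
proof (rule mat_opnorm_le)
  show "four_block_mat A (0\<^sub>m n m) (0\<^sub>m m n) B \<in> carrier_mat (n + m) (n + m)" using A B by simp
  show K: "0 \<le> K" using mat_opnorm_nonneg[OF A(1)] A(2) by linarith
  fix v :: "complex vec" assume v: "v \<in> carrier_vec (n + m)"
  let ?a = "vec_first v n" and ?b = "vec_last v m"
  have v': "v = ?a @\<^sub>v ?b" using v by simp
  have ab: "?a \<in> carrier_vec n" "?b \<in> carrier_vec m" by auto
  have le: "cvec_norm (A *\<^sub>v ?a) \<le> K * cvec_norm ?a" "cvec_norm (B *\<^sub>v ?b) \<le> K * cvec_norm ?b"
    using cvec_norm_mult_mat_vec[OF A(1) ab(1)] cvec_norm_mult_mat_vec[OF B(1) ab(2)] A(2) B(2)
    by (meson cvec_norm_nonneg mult_right_mono order_trans)+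
  have "(cvec_norm (four_block_mat A (0\<^sub>m n m) (0\<^sub>m m n) B *\<^sub>v v))\<^sup>2 = (cvec_norm (A *\<^sub>v ?a))\<^sup>2 + (cvec_norm (B *\<^sub>v ?b))\<^sup>2"
    by (subst v', subst mult_mat_vec_split[OF A(1) B(1) ab]) (rule cvec_norm_append)
  also have "\<dots> \<le> (K * cvec_norm ?a)\<^sup>2 + (K * cvec_norm ?b)\<^sup>2"
    using le by (intro add_mono power_mono) auto
  also have "\<dots> = (K * cvec_norm v)\<^sup>2"
    by (subst (3) v') (simp add: cvec_norm_append power_mult_distrib distrib_left)
  finally show "cvec_norm (four_block_mat A (0\<^sub>m n m) (0\<^sub>m m n) B *\<^sub>v v) \<le> K * cvec_norm v"
    by (rule power2_le_imp_le) (use K in simp)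
qed

text \<open>
  With two blocks this is Pythagoras' theorem, and more blocks are added one by one.
\<close>

lemma opnorm_diag_block_mat:
  assumes "0 \<le> K" "\<And>M. M \<in> set Ms \<Longrightarrow> dim_row M = dim_col M \<and> mat_opnorm M \<le> K"
  shows "dim_row (diag_block_mat Ms) = dim_col (diag_block_mat Ms) \<and> mat_opnorm (diag_block_mat Ms) \<le> K"
  using assms(2)
proof (induction Ms)
  case Nil
  then show ?case using assms(1) by simp
next
  case (Cons M Ms)
  let ?B = "diag_block_mat Ms"
  have IH: "dim_row ?B = dim_col ?B" "mat_opnorm ?B \<le> K" using Cons by auto
  have M: "dim_row M = dim_col M" "mat_opnorm M \<le> K" using Cons.prems by auto
  have "mat_opnorm (four_block_mat M (0\<^sub>m (dim_col M) (dim_col ?B)) (0\<^sub>m (dim_col ?B) (dim_col M)) ?B) \<le> K"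
    by (rule opnorm_diag_block2) (use IH M in \<open>auto intro: carrier_matI\<close>)
  then show ?case using IH M by (simp add: Let_def)
qed

lemma diag_block_mat_diff:
  assumes "list_all2 (\<lambda>M N. dim_row M = dim_col M \<and> dim_row N = dim_col N \<and> dim_col M = dim_col N) Ms Ns"
  shows "diag_block_mat Ms - diag_block_mat Ns = diag_block_mat (map2 (-) Ms (Ns :: complex mat list)) \<and>
    dim_row (diag_block_mat Ms) = dim_row (diag_block_mat Ns) \<and> dim_col (diag_block_mat Ms) = dim_col (diag_block_mat Ns) \<and>
    dim_row (diag_block_mat Ms) = dim_col (diag_block_mat Ms)"
  using assms
proof (induction rule: list_all2_induct)
  case (Cons M Ms N Ns)
  let ?A = "diag_block_mat Ms" and ?B = "diag_block_mat Ns"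
  have IH: "?A - ?B = diag_block_mat (map2 (-) Ms Ns)" "dim_row ?A = dim_row ?B" "dim_col ?A = dim_col ?B" "dim_row ?A = dim_col ?A"
    using Cons.IH by auto
  have eq: "four_block_mat M (0\<^sub>m (dim_row M) (dim_col ?A)) (0\<^sub>m (dim_row ?A) (dim_col M)) ?A -
      four_block_mat N (0\<^sub>m (dim_row N) (dim_col ?B)) (0\<^sub>m (dim_row ?B) (dim_col N)) ?B =
      four_block_mat (M - N) (0\<^sub>m (dim_row (M - N)) (dim_col (?A - ?B))) (0\<^sub>m (dim_row (?A - ?B)) (dim_col (M - N))) (?A - ?B)"
    using Cons.hyps IH(2-4) by (intro eq_matI) auto
  have "diag_block_mat (M # Ms) - diag_block_mat (N # Ns) = diag_block_mat (map2 (-) (M # Ms) (N # Ns))"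
    using eq unfolding IH(1) by (simp add: Let_def)
  then show ?case using Cons.hyps IH(2-4) by (simp add: Let_def)
qed simp

section \<open>Diagonal maps\<close>

text \<open>
  The standard trick of amplification: constants disappear on taking high roots.
\<close>

lemma le_if_powers_le:
  fixes X Y c :: real
  assumes Y: "0 \<le> Y" and le: "\<And>n. X ^ (2 ^ n) \<le> c * Y ^ (2 ^ n)"
  shows "X \<le> Y"
proof (rule ccontr)
  assume "\<not> X \<le> Y"
  then have XY: "Y < X" by simp
  show False
  proof (cases "Y = 0")
    case True
    then show False using le[of 0] XY by simp
  next
    case False
    then have Y: "0 < Y" using Y by simp
    have gt: "1 < X / Y" using XY Y by simp
    obtain n where n: "c < (X / Y) ^ n" using real_arch_pow[OF gt] by blast
    also have "(X / Y) ^ n \<le> (X / Y) ^ (2 ^ n)"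
      using gt by (intro power_increasing) (auto intro: less_imp_le less_exp)
    finally have "c * Y ^ (2 ^ n) < X ^ (2 ^ n)" using Y by (simp add: power_divide field_simps)
    then show False using le[of n] by simp
  qed
qed

locale diag_ah = building_blocks D for D :: "'x ah_data" +
  fixes \<psi> :: "nat \<Rightarrow> 'x dsum \<Rightarrow> 'a::unital_cstar_algebra"
  assumes limit: "is_inductive_limit (stage D) (conn D) \<psi>" and diag: "has_diagonal_maps D"
begin

lemma conn_hom: "i \<le> j \<Longrightarrow> unital_star_hom (stage D i) (stage D j) (conn D i j)"
  using limit by (simp add: is_inductive_limit_def inductive_system_def)

lemma psi_hom: "unital_star_hom (stage D i) type_algebra (\<psi> i)"
  using limit by (simp add: is_inductive_limit_def)

lemma conn_closed: "i \<le> j \<Longrightarrow> a \<in> A i \<Longrightarrow> conn D i j a \<in> A j"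
  using conn_hom[of i j] by (auto simp: unital_star_hom_def)

lemma conn_ops:
  assumes "i \<le> j" "a \<in> A i"
  shows "b \<in> A i \<Longrightarrow> conn D i j (sa_plus (stage D i) a b) = sa_plus (stage D j) (conn D i j a) (conn D i j b)"
    "b \<in> A i \<Longrightarrow> conn D i j (sa_times (stage D i) a b) = sa_times (stage D j) (conn D i j a) (conn D i j b)"
    "conn D i j (sa_scale (stage D i) c a) = sa_scale (stage D j) c (conn D i j a)"
    "conn D i j (sa_star (stage D i) a) = sa_star (stage D j) (conn D i j a)"
    "conn D i j (sa_one (stage D i)) = sa_one (stage D j)"
  using conn_hom[OF assms(1)] assms(2) by (auto simp: unital_star_hom_def)

lemma conn_conn: "i \<le> j \<Longrightarrow> j \<le> k \<Longrightarrow> a \<in> A i \<Longrightarrow> conn D j k (conn D i j a) = conn D i k a"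
  using limit by (auto simp: is_inductive_limit_def inductive_system_def)

lemma psi_ops:
  assumes "a \<in> A i"
  shows "b \<in> A i \<Longrightarrow> \<psi> i (sa_plus (stage D i) a b) = \<psi> i a + \<psi> i b"
    "b \<in> A i \<Longrightarrow> \<psi> i (sa_times (stage D i) a b) = \<psi> i a * \<psi> i b"
    "\<psi> i (sa_scale (stage D i) c a) = scaleC c (\<psi> i a)"
    "\<psi> i (sa_star (stage D i) a) = star (\<psi> i a)"
    "\<psi> i (sa_one (stage D i)) = 1"
  using psi_hom[of i] assms by (auto simp: unital_star_hom_def type_algebra_def)

lemma psi_conn: "i \<le> j \<Longrightarrow> a \<in> A i \<Longrightarrow> \<psi> j (conn D i j a) = \<psi> i a"
  using limit by (auto simp: is_inductive_limit_def)

lemma sec_conn_ops: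
  assumes "i \<le> j" "a \<in> A i" "k < summands D j" "x \<in> topspace (base D j k)"
  shows "b \<in> A i \<Longrightarrow> sec j (conn D i j (sa_plus (stage D i) a b)) k x = sec j (conn D i j a) k x + sec j (conn D i j b) k x"
    "b \<in> A i \<Longrightarrow> sec j (conn D i j (sa_times (stage D i) a b)) k x = sec j (conn D i j a) k x * sec j (conn D i j b) k x"
    "sec j (conn D i j (sa_scale (stage D i) c a)) k x = scaleC c (sec j (conn D i j a) k x)"
    "sec j (conn D i j (sa_star (stage D i) a)) k x = star (sec j (conn D i j a) k x)"
    "sec j (conn D i j (sa_one (stage D i))) k x = un j k x"
  using conn_ops[OF assms(1,2)] sec_stage_ops[OF conn_closed[OF assms(1,2)] assms(3,4)]
    conn_closed[OF assms(1)] sec_one[OF assms(3,4)] by auto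

subsection \<open>The diagonal form\<close>

text \<open>
  The element \<open>a\<close> restricted to the summands in \<open>S\<close>.  It serves to decompose \<open>a\<close> inductively into the
  contributions of the single summands, to which the diagonal form of the connecting maps refers.
\<close>

definition part :: "nat \<Rightarrow> 'x dsum \<Rightarrow> nat set \<Rightarrow> 'x dsum" where
  "part i a S = of_sections i (\<lambda>l x. if l \<in> S then sec i a l x else 0)"

lemma part_props:
  assumes a: "a \<in> A i"
  shows "part i a S \<in> A i"
    "\<And>l x. l < summands D i \<Longrightarrow> x \<in> topspace (base D i l) \<Longrightarrow> sec i (part i a S) l x = (if l \<in> S then sec i a l x else 0)"
proof -
  have "un i l x * (if l \<in> S then sec i a l x else 0) * un i l x = (if l \<in> S then sec i a l x else 0)"
    if "l < summands D i" "x \<in> topspace (base D i l)" for l x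
    using carrier_stageD(4)[OF a that] by simp
  moreover have "continuous_map (base D i l) euclidean (\<lambda>x. if l \<in> S then sec i a l x else 0)" if "l < summands D i" for l
    using carrier_stageD(2)[OF a that] by simp
  ultimately show "part i a S \<in> A i"
    "\<And>l x. l < summands D i \<Longrightarrow> x \<in> topspace (base D i l) \<Longrightarrow> sec i (part i a S) l x = (if l \<in> S then sec i a l x else 0)"
    unfolding part_def using of_sections_props[of i "\<lambda>l x. if l \<in> S then sec i a l x else 0"] by blast+
qed

lemma incl_eq_part:
  assumes a: "a \<in> A i" and l: "l < summands D i" shows "incl D i l (a l) = part i a {l}"
proof -
  have "incl D i l (a l) l' x = part i a {l} l' x" for l' x
    using carrier_stageD(3)[OF a l]
    by (cases "l' < summands D i \<and> x \<in> topspace (base D i l')")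
       (auto simp: incl_def part_def of_sections_def pointwise_def sec_def)
  then show ?thesis by blast
qed

lemma sec_conn_sum:
  assumes a: "a \<in> A i" and ij: "i \<le> j" and k: "k < summands D j" and x: "x \<in> topspace (base D j k)"
  shows "sec j (conn D i j a) k x = (\<Sum>l<summands D i. sec j (conn D i j (incl D i l (a l))) k x)"
proof -
  have "L \<le> summands D i \<Longrightarrow> sec j (conn D i j (part i a {..<L})) k x = (\<Sum>l<L. sec j (conn D i j (incl D i l (a l))) k x)" for L
  proof (induction L)
    case 0
    have "part i a {..<0} = sa_scale (stage D i) 0 a"
      by (rule sec_inject[OF part_props(1)[OF a] stage_closed(3)[OF a]])
         (simp add: part_props(2)[OF a] sec_stage_ops(3)[OF a])
    then show ?case using sec_conn_ops(3)[OF ij a k x, of 0] by simp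
  next
    case (Suc L)
    have "part i a {..<Suc L} = sa_plus (stage D i) (part i a {..<L}) (part i a {L})"
      by (rule sec_inject[OF part_props(1)[OF a] stage_closed(1)[OF part_props(1)[OF a] part_props(1)[OF a]]])
         (auto simp: part_props(2)[OF a] sec_stage_ops(1)[OF part_props(1)[OF a] _ _ part_props(1)[OF a]])
    then show ?case using sec_conn_ops(1)[OF ij part_props(1)[OF a] k x part_props(1)[OF a]] Suc
      by (simp add: incl_eq_part[OF a])
  qed
  from this[of "summands D i"] have "sec j (conn D i j (part i a {..<summands D i})) k x =
      (\<Sum>l<summands D i. sec j (conn D i j (incl D i l (a l))) k x)" by simp
  moreover have "part i a {..<summands D i} = a"
    by (rule sec_inject[OF part_props(1)[OF a] a]) (simp add: part_props(2)[OF a])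
  ultimately show ?thesis by simp
qed

definition eig_block :: "nat \<Rightarrow> nat \<Rightarrow> nat \<Rightarrow> nat \<Rightarrow> nat \<Rightarrow> nat \<Rightarrow> ('x \<Rightarrow> complex mat) \<Rightarrow> 'x \<Rightarrow> complex mat" where
  "eig_block i j l k s t f x = diag_block_mat ([0\<^sub>m s s] @ map (\<lambda>m. f (eig D i j l k m x)) [0..<eigs D i j l k] @ [0\<^sub>m t t])"

lemma eig_in_base:
  assumes "i < j" "l < summands D i" "k < summands D j" "m < eigs D i j l k"
  shows "continuous_map (base D j k) (base D i l) (eig D i j l k m)"
    "x \<in> topspace (base D j k) \<Longrightarrow> eig D i j l k m x \<in> topspace (base D i l)"
proof -
  show c: "continuous_map (base D j k) (base D i l) (eig D i j l k m)"
    using diag assms unfolding has_diagonal_maps_def by blast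
  show "x \<in> topspace (base D j k) \<Longrightarrow> eig D i j l k m x \<in> topspace (base D i l)"
    using continuous_map_funspace[OF c] by blast
qed

text \<open>
  The diagonal form is given for the components \<open>A\<^sub>i\<^sub>,\<^sub>l \<rightarrow> A\<^sub>j\<^sub>,\<^sub>k\<close> separately, but with one unitary for all
  of them.  Adding the components, the conjugated image of \<open>a\<close> is a sum of diagonal blocks.
\<close>

lemma diagonal_form:
  assumes ij: "i < j"
  shows "\<exists>u s t. (\<forall>k<summands D j. continuous_map (base D j k) euclidean (u k)) \<and>
    (\<forall>k<summands D j. \<forall>x\<in>topspace (base D j k). star (u k x) * u k x = un j k x \<and> u k x * star (u k x) = un j k x \<and>
       un j k x * u k x = u k x \<and> u k x * un j k x = u k x) \<and>
    (\<forall>k<summands D j. \<forall>x\<in>topspace (base D j k). \<forall>a\<in>A i.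
       (\<forall>l<summands D i. eig_block i j l k (s l k) (t l k) (a l) x \<in> carrier_mat (msize D j k) (msize D j k)) \<and>
       u k x * sec j (conn D i j a) k x * star (u k x) =
         (\<Sum>l<summands D i. emb (msize D j k) (eig_block i j l k (s l k) (t l k) (a l) x)))"
proof -
  obtain U where U: "unitary_in (stage D j) U"
    and "\<forall>l<summands D i. \<forall>k<summands D j. \<exists>s t. \<forall>f\<in>block D i l. \<forall>x\<in>topspace (base D j k).
            sa_times (stage D j) (sa_times (stage D j) U (conn D i j (incl D i l f)))
              (sa_star (stage D j) U) k x = eig_block i j l k s t f x"
    using diag ij unfolding has_diagonal_maps_def eig_block_def by blast
  then obtain s t where st: "\<And>l k f x. l < summands D i \<Longrightarrow> k < summands D j \<Longrightarrow> f \<in> block D i l \<Longrightarrow> x \<in> topspace (base D j k) \<Longrightarrow>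
            sa_times (stage D j) (sa_times (stage D j) U (conn D i j (incl D i l f)))
              (sa_star (stage D j) U) k x = eig_block i j l k (s l k) (t l k) f x" by metis
  have UA: "U \<in> A j" and UU: "sa_times (stage D j) (sa_star (stage D j) U) U = sa_one (stage D j)"
    "sa_times (stage D j) U (sa_star (stage D j) U) = sa_one (stage D j)" using U by (auto simp: unitary_in_def)
  have "star (sec j U k x) * sec j U k x = un j k x \<and> sec j U k x * star (sec j U k x) = un j k x"
    if "k < summands D j" "x \<in> topspace (base D j k)" for k x
    using arg_cong[OF UU(1), of "\<lambda>z. sec j z k x"] arg_cong[OF UU(2), of "\<lambda>z. sec j z k x"]
    by (simp add: sec_stage_ops[OF UA that] sec_stage_ops(2)[OF stage_closed(4)[OF UA] that UA]
        sec_stage_ops(2)[OF UA that stage_closed(4)[OF UA]] sec_one[OF that])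
  moreover have "eig_block i j l k (s l k) (t l k) (a l) x \<in> carrier_mat (msize D j k) (msize D j k) \<and>
      sec j U k x * sec j (conn D i j (incl D i l (a l))) k x * star (sec j U k x) =
      emb (msize D j k) (eig_block i j l k (s l k) (t l k) (a l) x)"
    if k: "k < summands D j" and x: "x \<in> topspace (base D j k)" and a: "a \<in> A i" and l: "l < summands D i" for k x a l
  proof -
    have c: "conn D i j (incl D i l (a l)) \<in> A j"
      using conn_closed[of i j] ij part_props(1)[OF a] by (simp add: incl_eq_part[OF a l])
    note c1 = stage_closed(2)[OF UA c]
    note c2 = stage_closed(2)[OF c1 stage_closed(4)[OF UA]]
    have e: "sa_times (stage D j) (sa_times (stage D j) U (conn D i j (incl D i l (a l)))) (sa_star (stage D j) U) k x =
        eig_block i j l k (s l k) (t l k) (a l) x"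
      by (rule st[OF l k carrier_stageD(1)[OF a l] x])
    have "sec j (sa_times (stage D j) (sa_times (stage D j) U (conn D i j (incl D i l (a l)))) (sa_star (stage D j) U)) k x =
        sec j U k x * sec j (conn D i j (incl D i l (a l))) k x * star (sec j U k x)"
      by (simp add: sec_stage_ops(2)[OF c1 k x stage_closed(4)[OF UA]] sec_stage_ops(2)[OF UA k x c] sec_stage_ops(4)[OF UA k x])
    then show ?thesis using carrier_stageD(3)[OF c2 k x] unfolding sec_def e by simp
  qed
  ultimately show ?thesis
    using carrier_stageD(2,5,6)[OF UA] sec_conn_sum[of _ i j] ij
    by (intro exI[of _ "sec j U"] exI[of _ s] exI[of _ t])
       (auto simp: sum_distrib_left sum_distrib_right intro!: sum.cong)
qed

lemma norm_eig_block_diff: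
  assumes ij: "i < j" and a: "a \<in> A i" and k: "k < summands D j" and l: "l < summands D i"
    and x: "x \<in> topspace (base D j k)" and y: "y \<in> topspace (base D j k)"
    and c: "eig_block i j l k s t (a l) x \<in> carrier_mat (msize D j k) (msize D j k)"
      "eig_block i j l k s t (a l) y \<in> carrier_mat (msize D j k) (msize D j k)"
    and K: "0 \<le> K" and le: "\<And>m. m < eigs D i j l k \<Longrightarrow> norm (sec i a l (eig D i j l k m x) - sec i a l (eig D i j l k m y)) \<le> K"
  shows "norm (emb (msize D j k) (eig_block i j l k s t (a l) x) - emb (msize D j k) (eig_block i j l k s t (a l) y)) \<le> K"
proof -
  let ?L = "\<lambda>x. [0\<^sub>m s s] @ map (\<lambda>m. a l (eig D i j l k m x)) [0..<eigs D i j l k] @ [0\<^sub>m t t]"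
  have dim: "a l (eig D i j l k m z) \<in> carrier_mat (msize D i l) (msize D i l)"
    if "m < eigs D i j l k" "z \<in> topspace (base D j k)" for m z
    by (rule carrier_stageD(3)[OF a l eig_in_base(2)[OF ij l k that]])
  have d: "dim_row (a l (eig D i j l k m z)) = msize D i l" "dim_col (a l (eig D i j l k m z)) = msize D i l"
    if "m < eigs D i j l k" "z \<in> topspace (base D j k)" for m z
    using carrier_matD[OF dim[OF that]] by simp_all
  have "list_all2 (\<lambda>M N. dim_row M = dim_col M \<and> dim_row N = dim_col N \<and> dim_col M = dim_col N)
      (map (\<lambda>m. a l (eig D i j l k m x)) [0..<eigs D i j l k]) (map (\<lambda>m. a l (eig D i j l k m y)) [0..<eigs D i j l k])"
    by (simp add: list_all2_conv_all_nth d[OF _ x] d[OF _ y])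
  then have "list_all2 (\<lambda>M N. dim_row M = dim_col M \<and> dim_row N = dim_col N \<and> dim_col M = dim_col N) (?L x) (?L y)"
    by (intro list_all2_appendI) simp_all
  then have eq: "eig_block i j l k s t (a l) x - eig_block i j l k s t (a l) y = diag_block_mat (map2 (-) (?L x) (?L y))"
    unfolding eig_block_def by (rule diag_block_mat_diff[THEN conjunct1])
  have zz: "(0\<^sub>m n n - 0\<^sub>m n n :: complex mat) = 0\<^sub>m n n" for n by (intro eq_matI) auto
  have L2: "map2 (-) (?L x) (?L y) = [0\<^sub>m s s] @
      map (\<lambda>m. a l (eig D i j l k m x) - a l (eig D i j l k m y)) [0..<eigs D i j l k] @ [0\<^sub>m t t]"
    by (simp add: map2_map_map zz)
  have "mat_opnorm (diag_block_mat (map2 (-) (?L x) (?L y))) \<le> K"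
  proof (rule opnorm_diag_block_mat[OF K, THEN conjunct2])
    fix M assume "M \<in> set (map2 (-) (?L x) (?L y))"
    then consider "M = 0\<^sub>m s s" | "M = 0\<^sub>m t t"
      | m where "m < eigs D i j l k" "M = a l (eig D i j l k m x) - a l (eig D i j l k m y)"
      unfolding L2 by auto
    then show "dim_row M = dim_col M \<and> mat_opnorm M \<le> K"
    proof cases
      case (3 m)
      have "norm (sec i a l (eig D i j l k m x) - sec i a l (eig D i j l k m y)) = mat_opnorm M"
        using dim[OF 3(1) x] dim[OF 3(1) y] by (simp add: sec_def 3(2) emb_diff[symmetric] norm_emb minus_carrier_mat)
      then show ?thesis using le[OF 3(1)] d[OF 3(1) x] d[OF 3(1) y] by (simp add: 3(2))
    qed (use K in auto)
  qed
  then show ?thesis using c unfolding eq[symmetric] by (simp add: emb_diff[symmetric] norm_emb minus_carrier_mat)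
qed

lemma norm_eig_block:
  assumes ij: "i < j" and a: "a \<in> A i" and k: "k < summands D j" and l: "l < summands D i"
    and x: "x \<in> topspace (base D j k)"
    and c: "eig_block i j l k s t (a l) x \<in> carrier_mat (msize D j k) (msize D j k)"
    and K: "0 \<le> K" and le: "\<And>y. y \<in> topspace (base D i l) \<Longrightarrow> norm (sec i a l y) \<le> K"
  shows "norm (emb (msize D j k) (eig_block i j l k s t (a l) x)) \<le> K"
proof -
  have "mat_opnorm (eig_block i j l k s t (a l) x) \<le> K"
    unfolding eig_block_def
  proof (rule opnorm_diag_block_mat[OF K, THEN conjunct2])
    fix M assume "M \<in> set ([0\<^sub>m s s] @ map (\<lambda>m. a l (eig D i j l k m x)) [0..<eigs D i j l k] @ [0\<^sub>m t t])"
    then consider "M = 0\<^sub>m s s" | "M = 0\<^sub>m t t" | m where "m < eigs D i j l k" "M = a l (eig D i j l k m x)" by auto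
    then show "dim_row M = dim_col M \<and> mat_opnorm M \<le> K"
    proof cases
      case (3 m)
      note e = eig_in_base(2)[OF ij l k 3(1) x]
      show ?thesis using le[OF e] norm_sec[OF a l e] carrier_stageD(3)[OF a l e] by (auto simp: 3(2))
    qed (use K in auto)
  qed
  then show ?thesis using c by (simp add: norm_emb)
qed

subsection \<open>The canonical maps are contractive\<close>

text \<open>
  The triangle inequality for the sum of the blocks coming from the single summands; the factor is removed in
  \<open>norm_psi_le\<close>.
\<close>

lemma norm_sec_conn_crude:
  fixes K :: real
  assumes ij: "i < j" and a: "a \<in> A i" and k: "k < summands D j" and x: "x \<in> topspace (base D j k)"
    and K: "0 \<le> K" and le: "\<And>l y. l < summands D i \<Longrightarrow> y \<in> topspace (base D i l) \<Longrightarrow> norm (sec i a l y) \<le> K"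
  shows "norm (sec j (conn D i j a) k x) \<le> real (summands D i) * K"
proof -
  from diagonal_form[OF ij] obtain u s t where
    u0: "\<forall>k<summands D j. \<forall>x\<in>topspace (base D j k). star (u k x) * u k x = un j k x \<and> u k x * star (u k x) = un j k x \<and>
       un j k x * u k x = u k x \<and> u k x * un j k x = u k x" and
    f0: "\<forall>k<summands D j. \<forall>x\<in>topspace (base D j k). \<forall>a\<in>A i.
       (\<forall>l<summands D i. eig_block i j l k (s l k) (t l k) (a l) x \<in> carrier_mat (msize D j k) (msize D j k)) \<and>
       u k x * sec j (conn D i j a) k x * star (u k x) =
         (\<Sum>l<summands D i. emb (msize D j k) (eig_block i j l k (s l k) (t l k) (a l) x))"
    by (elim exE conjE) (rule that)
  note u = u0[rule_format, OF k x] and f1 = f0[rule_format, OF k x a]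
  have f: "\<And>l. l < summands D i \<Longrightarrow> eig_block i j l k (s l k) (t l k) (a l) x \<in> carrier_mat (msize D j k) (msize D j k)"
      "u k x * sec j (conn D i j a) k x * star (u k x) =
         (\<Sum>l<summands D i. emb (msize D j k) (eig_block i j l k (s l k) (t l k) (a l) x))"
    using f1 by simp_all
  let ?c = "sec j (conn D i j a) k x"
  have C: "conn D i j a \<in> A j" using conn_closed[of i j a] ij a by simp
  have "(norm (u k x))\<^sup>2 = norm (un j k x)" using cstar_identity[of "u k x"] u by simp
  also have "\<dots> \<le> 1\<^sup>2" using norm_projection_le[OF un_projection(1)[OF k x]] by simp
  finally have nu: "norm (u k x) \<le> 1" by (rule power2_le_imp_le) simp
  have "?c = star (u k x) * (u k x * ?c * star (u k x)) * u k x"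
  proof -
    have "star (u k x) * (u k x * ?c * star (u k x)) * u k x = (star (u k x) * u k x) * ?c * (star (u k x) * u k x)"
      by (simp add: mult.assoc)
    then show ?thesis using u carrier_stageD(4)[OF C k x] by simp
  qed
  then have "norm ?c \<le> norm (star (u k x)) * norm (u k x * ?c * star (u k x)) * norm (u k x)"
    by (metis norm_mult3_le)
  also have "\<dots> \<le> 1 * norm (u k x * ?c * star (u k x)) * 1" using nu by (intro mult_mono) auto
  also have "\<dots> \<le> (\<Sum>l<summands D i. K)"
    unfolding f(2) mult_1 mult_1_right
  proof (rule sum_norm_le)
    fix l assume "l \<in> {..<summands D i}"
    then have l: "l < summands D i" by simp
    show "norm (emb (msize D j k) (eig_block i j l k (s l k) (t l k) (a l) x)) \<le> K"
      by (rule norm_eig_block[OF ij a k l x f(1)[OF l] K le[OF l]])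
  qed
  finally show ?thesis by simp
qed

lemma sa_norm_conn_tendsto: "a \<in> A i \<Longrightarrow> (\<lambda>j. sa_norm (stage D j) (conn D i j a)) \<longlonglongrightarrow> norm (\<psi> i a)"
  using limit by (simp add: is_inductive_limit_def)

lemma norm_psi_crude:
  fixes K :: real
  assumes a: "a \<in> A i"
    and K: "0 \<le> K" and le: "\<And>l y. l < summands D i \<Longrightarrow> y \<in> topspace (base D i l) \<Longrightarrow> norm (sec i a l y) \<le> K"
  shows "norm (\<psi> i a) \<le> real (summands D i) * K"
proof (rule LIMSEQ_le_const2[OF sa_norm_conn_tendsto[OF a]], intro exI[of _ "Suc i"] allI impI)
  fix j assume "Suc i \<le> j"
  then have "i < j" by simp
  then show "sa_norm (stage D j) (conn D i j a) \<le> real (summands D i) * K"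
    by (intro sa_norm_le[OF conn_closed[OF less_imp_le a]] norm_sec_conn_crude[OF _ a _ _ K]) (use le in auto)
qed

text \<open>
  The crude bound has a constant factor that depends on \<open>i\<close> only.  Applying it to \<open>(a\<^sup>* a)\<close> raised to the power \<open>2 ^ n\<close>,
  whose norm in the limit algebra is the corresponding power of \<open>\<parallel>\<psi> a\<parallel>\<^sup>2\<close> by the C*-identity, removes the factor.
\<close>

lemma norm_psi_le:
  assumes a: "a \<in> A i"
    and K: "0 \<le> K" and le: "\<And>l y. l < summands D i \<Longrightarrow> y \<in> topspace (base D i l) \<Longrightarrow> norm (sec i a l y) \<le> K"
  shows "norm (\<psi> i a) \<le> K"
proof -
  define sq where "sq = rec_nat (sa_times (stage D i) (sa_star (stage D i) a) a) (\<lambda>_ b. sa_times (stage D i) b b)"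
  have sq0: "sq 0 = sa_times (stage D i) (sa_star (stage D i) a) a"
    and sqS: "sq (Suc n) = sa_times (stage D i) (sq n) (sq n)" for n by (simp_all add: sq_def)
  have sqA: "sq n \<in> A i" for n
    by (induction n) (auto simp: sq0 sqS intro: stage_closed(2)[OF stage_closed(4)[OF a] a] stage_closed(2))
  have sec_le: "norm (sec i (sq n) l y) \<le> (K\<^sup>2) ^ (2 ^ n)" if l: "l < summands D i" "y \<in> topspace (base D i l)" for n l y
  proof (induction n)
    case 0
    have "norm (sec i (sq 0) l y) = (norm (sec i a l y))\<^sup>2"
      by (simp add: sq0 sec_stage_ops(2)[OF stage_closed(4)[OF a] l a] sec_stage_ops(4)[OF a l] cstar_identity)
    then show ?case using power_mono[OF le[OF l], of 2] by simp
  next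
    case (Suc n)
    have "norm (sec i (sq (Suc n)) l y) \<le> norm (sec i (sq n) l y) * norm (sec i (sq n) l y)"
      by (simp add: sqS sec_stage_ops(2)[OF sqA l sqA] norm_mult_ineq)
    also have "\<dots> \<le> (K\<^sup>2) ^ (2 ^ n) * (K\<^sup>2) ^ (2 ^ n)" by (rule mult_mono[OF Suc Suc]) auto
    finally show ?case by (simp add: power_add[symmetric] mult_2)
  qed
  have psq: "star (\<psi> i (sq n)) = \<psi> i (sq n) \<and> norm (\<psi> i (sq n)) = ((norm (\<psi> i a))\<^sup>2) ^ (2 ^ n)" for n
  proof (induction n)
    case 0
    show ?case
      by (simp add: sq0 psi_ops(2)[OF stage_closed(4)[OF a] a] psi_ops(4)[OF a] star_mult star_star cstar_identity)
  next
    case (Suc n)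
    then show ?case
      using norm_self_adjoint_square[of "\<psi> i (sq n)"]
      by (simp add: sqS psi_ops(2)[OF sqA sqA] star_mult power_mult[symmetric] mult.commute)
  qed
  have "((norm (\<psi> i a))\<^sup>2) ^ (2 ^ n) \<le> real (summands D i) * (K\<^sup>2) ^ (2 ^ n)" for n
    using norm_psi_crude[OF sqA, of "(K\<^sup>2) ^ (2 ^ n)" n] sec_le psq[of n] by simp
  then have "(norm (\<psi> i a))\<^sup>2 \<le> K\<^sup>2" by (rule le_if_powers_le[rotated]) simp
  then show ?thesis by (rule power2_le_imp_le) (rule K)
qed

lemma eventually_norm_sec_conn_less:
  assumes a: "a \<in> A i" and C: "norm (\<psi> i a) < C"
  shows "\<forall>\<^sub>F j in sequentially. i < j \<and> (\<forall>k<summands D j. \<forall>x\<in>topspace (base D j k). norm (sec j (conn D i j a) k x) < C)"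
  using order_tendstoD(2)[OF sa_norm_conn_tendsto[OF a] C] eventually_gt_at_top[of i]
proof eventually_elim
  case (elim j)
  then show ?case using norm_sec_le_sa_norm[OF conn_closed[of i j a]] a by (auto intro: le_less_trans)
qed

subsection \<open>Fine covers\<close>

text \<open>
  Small balls around finitely many values of \<open>a\<close> and \<open>b\<close> pull back to a finite cover, by compactness.
\<close>

lemma oscillation_cover:
  assumes l: "l < summands D i" and a: "a \<in> A i" and b: "b \<in> A i" and \<epsilon>: "0 < \<epsilon>"
  shows "\<exists>\<gamma>. finite_open_cover (base D i l) \<gamma> \<and> (\<forall>V\<in>\<gamma>. \<forall>x\<in>V. \<forall>y\<in>V.
    norm (sec i a l x - sec i a l y) \<le> \<epsilon> \<and> norm (sec i b l x - sec i b l y) \<le> \<epsilon>)"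
proof -
  let ?T = "base D i l"
  define N where "N z = {x \<in> topspace ?T. sec i a l x \<in> ball (sec i a l z) (\<epsilon>/2)} \<inter> {x \<in> topspace ?T. sec i b l x \<in> ball (sec i b l z) (\<epsilon>/2)}" for z
  have "openin ?T (N z)" for z
    unfolding N_def
    by (intro openin_Int openin_continuous_map_preimage[OF carrier_stageD(2)[OF a l]]
        openin_continuous_map_preimage[OF carrier_stageD(2)[OF b l]]) auto
  moreover have "topspace ?T \<subseteq> \<Union>(N ` topspace ?T)" using \<epsilon> by (auto simp: N_def)
  ultimately obtain \<gamma> where g: "finite \<gamma>" "\<gamma> \<subseteq> N ` topspace ?T" "topspace ?T \<subseteq> \<Union>\<gamma>"
    using base_props(3)[OF l] unfolding compact_space_alt by (metis (no_types, lifting) imageE)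
  have "norm (sec i a l x - sec i a l y) \<le> \<epsilon> \<and> norm (sec i b l x - sec i b l y) \<le> \<epsilon>" if "x \<in> N z" "y \<in> N z" for x y z
  proof -
    have "dist (sec i a l z) (sec i a l x) < \<epsilon>/2" "dist (sec i a l z) (sec i a l y) < \<epsilon>/2"
      "dist (sec i b l z) (sec i b l x) < \<epsilon>/2" "dist (sec i b l z) (sec i b l y) < \<epsilon>/2"
      using that by (auto simp: N_def)
    then show ?thesis using dist_triangle3[of "sec i a l x" "sec i a l y" "sec i a l z"]
        dist_triangle3[of "sec i b l x" "sec i b l y" "sec i b l z"] by (auto simp: dist_norm)
  qed
  moreover have "finite_open_cover ?T \<gamma>"
    unfolding finite_open_cover_def using g \<open>\<And>z. openin ?T (N z)\<close> by (auto simp: N_def)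
  ultimately show ?thesis using g(2) by blast
qed

text \<open>
  Covers of the single base spaces are assembled to a cover of their disjoint union.  The base spaces are
  connected, so its members respect connected components.  The cover that it induces on a base space may
  additionally contain the empty set, because the image of the empty set is empty in every component.
\<close>

lemma fine_component_cover:
  assumes a: "a \<in> A i" and b: "b \<in> A i" and \<epsilon>: "0 < \<epsilon>"
  shows "\<exists>\<alpha>\<in>component_covers D i. \<forall>l<summands D i. finite_open_cover (base D i l) (induced_cover \<alpha> l) \<and>
    (\<forall>V\<in>induced_cover \<alpha> l. \<forall>x\<in>V. \<forall>y\<in>V.
      norm (sec i a l x - sec i a l y) \<le> \<epsilon> \<and> norm (sec i b l x - sec i b l y) \<le> \<epsilon>)"
proof -
  obtain \<gamma> where g: "\<And>l. l < summands D i \<Longrightarrow> finite_open_cover (base D i l) (\<gamma> l)"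
    "\<And>l V x y. l < summands D i \<Longrightarrow> V \<in> \<gamma> l \<Longrightarrow> x \<in> V \<Longrightarrow> y \<in> V \<Longrightarrow>
      norm (sec i a l x - sec i a l y) \<le> \<epsilon> \<and> norm (sec i b l x - sec i b l y) \<le> \<epsilon>"
    using oscillation_cover[OF _ a b \<epsilon>] by metis
  have gs: "V \<subseteq> topspace (base D i l)" if "l < summands D i" "V \<in> \<gamma> l" for l V
    using g(1)[OF that(1)] that(2) by (auto simp: finite_open_cover_def)
  define \<alpha> where "\<alpha> = (\<Union>l<summands D i. (\<lambda>V. Pair l ` V) ` \<gamma> l)"
  have tot: "topspace (total_space D i) = (\<Union>l<summands D i. Pair l ` topspace (base D i l))"
    by (auto simp: total_space_def)
  have "finite_open_cover (total_space D i) \<alpha>"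
    unfolding finite_open_cover_def
  proof (intro conjI ballI)
    show "finite \<alpha>" using g(1) by (auto simp: \<alpha>_def finite_open_cover_def)
    show "openin (total_space D i) W" if W: "W \<in> \<alpha>" for W
    proof -
      obtain l V where lV: "l < summands D i" "V \<in> \<gamma> l" "W = Pair l ` V" using W by (auto simp: \<alpha>_def)
      have op: "openin (base D i l) V" using g(1)[OF lV(1)] lV(2) by (auto simp: finite_open_cover_def)
      have "{x. (l', x) \<in> Pair l ` V} = (if l' = l then V else {})" for l' by auto
      then show ?thesis using op gs[OF lV(1,2)] lV(1) unfolding lV(3) total_space_def openin_sum_topology by auto
    qed
    show "\<Union>\<alpha> = topspace (total_space D i)"
    proof -
      have "\<Union>(\<gamma> l) = topspace (base D i l)" if "l < summands D i" for l
        using g(1)[OF that] by (simp add: finite_open_cover_def)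
      moreover have "\<Union>\<alpha> = (\<Union>l<summands D i. Pair l ` \<Union>(\<gamma> l))" by (auto simp: \<alpha>_def)
      ultimately show ?thesis unfolding tot by simp
    qed
  qed
  moreover have "\<exists>C\<in>connected_components_of (total_space D i). W \<subseteq> C" if W: "W \<in> \<alpha>" for W
  proof -
    obtain l V where lV: "l < summands D i" "V \<in> \<gamma> l" "W = Pair l ` V" using W by (auto simp: \<alpha>_def)
    have "continuous_map (base D i l) (total_space D i) (Pair l)"
      unfolding total_space_def by (rule continuous_map_component_injection) (use lV in simp)
    moreover have "connectedin (base D i l) (topspace (base D i l))"
      using base_props(2)[OF lV(1)] by (simp add: connectedin_topspace)
    ultimately have "connectedin (total_space D i) (Pair l ` topspace (base D i l))"
      by (rule connectedin_continuous_map_image)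
    moreover have "topspace (total_space D i) \<noteq> {}"
      using base_props(1)[OF lV(1)] lV(1) unfolding tot by blast
    ultimately obtain C where "C \<in> connected_components_of (total_space D i)" "Pair l ` topspace (base D i l) \<subseteq> C"
      using exists_connected_component_of_superset[of "total_space D i" "Pair l ` topspace (base D i l)"] by auto
    then show ?thesis using gs[OF lV(1,2)] unfolding lV(3) by blast
  qed
  ultimately have "\<alpha> \<in> component_covers D i" by (simp add: component_covers_def)
  moreover have ind: "\<gamma> l \<subseteq> induced_cover \<alpha> l" "induced_cover \<alpha> l \<subseteq> insert {} (\<gamma> l)" if "l < summands D i" for l
  proof -
    show "\<gamma> l \<subseteq> induced_cover \<alpha> l" using that by (auto simp: induced_cover_def \<alpha>_def)
    show "induced_cover \<alpha> l \<subseteq> insert {} (\<gamma> l)"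
    proof
      fix V assume "V \<in> induced_cover \<alpha> l"
      then obtain l' V' where *: "V' \<in> \<gamma> l'" "Pair l ` V = Pair l' ` V'" by (auto simp: induced_cover_def \<alpha>_def)
      show "V \<in> insert {} (\<gamma> l)"
      proof (cases "V = {}")
        case False
        then obtain v where "v \<in> V" by blast
        then have "(l, v) \<in> Pair l' ` V'" using *(2) by blast
        then have "l' = l" by auto
        then have "V = V'" using *(2) by (auto simp: inj_image_eq_iff[OF inj_onI])
        then show ?thesis using * \<open>l' = l\<close> by simp
      qed simp
    qed
  qed
  have "finite_open_cover (base D i l) (induced_cover \<alpha> l)" if l: "l < summands D i" for l
  proof -
    have "\<Union>(induced_cover \<alpha> l) = \<Union>(\<gamma> l)" using ind[OF l] by blast
    moreover have "finite (induced_cover \<alpha> l)"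
      using finite_subset[OF ind(2)[OF l]] g(1)[OF l] by (simp add: finite_open_cover_def)
    moreover have "openin (base D i l) V" if "V \<in> induced_cover \<alpha> l" for V
      using ind(2)[OF l] that g(1)[OF l] by (auto simp: finite_open_cover_def)
    ultimately show ?thesis using g(1)[OF l] by (simp add: finite_open_cover_def)
  qed
  ultimately show ?thesis using g(2) ind(2)
    by (intro bexI[of _ \<alpha>]) (auto, (metis empty_iff insertE subsetD)+)
qed

lemma push_cover_props:
  assumes ij: "i < j" and k: "k < summands D j"
    and \<alpha>: "\<And>l. l < summands D i \<Longrightarrow> finite_open_cover (base D i l) (induced_cover \<alpha> l)"
  shows "finite_open_cover (base D j k) (push_cover D i j k \<alpha>)"
    "\<And>W l m. W \<in> push_cover D i j k \<alpha> \<Longrightarrow> l < summands D i \<Longrightarrow> m < eigs D i j l k \<Longrightarrow>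
      \<exists>V\<in>induced_cover \<alpha> l. eig D i j l k m ` W \<subseteq> V"
proof -
  let ?T = "base D j k"
  define S where "S = {(l, m). l < summands D i \<and> m < eigs D i j l k}"
  define c where "c = (\<lambda>(l, m). pull_cover ?T (eig D i j l k m) (induced_cover \<alpha> l))"
  have pc: "push_cover D i j k \<alpha> = join_covers ?T S c" by (simp add: push_cover_def S_def c_def)
  have S: "finite S"
    by (rule finite_subset[of _ "\<Union>l<summands D i. Pair l ` {..<eigs D i j l k}"]) (auto simp: S_def)
  have cfin: "finite (c s)" and cop: "\<And>W. W \<in> c s \<Longrightarrow> openin ?T W" and ccov: "topspace ?T \<subseteq> \<Union>(c s)" if s: "s \<in> S" for s
  proof -
    obtain l m where lm: "s = (l, m)" "l < summands D i" "m < eigs D i j l k" using s by (auto simp: S_def)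
    note A = \<alpha>[OF lm(2), unfolded finite_open_cover_def]
    show "finite (c s)" using A by (simp add: lm(1) c_def pull_cover_def)
    show "openin ?T W" if "W \<in> c s" for W
      using that A openin_continuous_map_preimage[OF eig_in_base(1)[OF ij lm(2) k lm(3)]]
      by (auto simp: lm(1) c_def pull_cover_def)
    show "topspace ?T \<subseteq> \<Union>(c s)"
    proof
      fix x assume x: "x \<in> topspace ?T"
      then have "eig D i j l k m x \<in> \<Union>(induced_cover \<alpha> l)" using eig_in_base(2)[OF ij lm(2) k lm(3)] A by simp
      then show "x \<in> \<Union>(c s)" using x by (auto simp: lm(1) c_def pull_cover_def)
    qed
  qed
  show "finite_open_cover ?T (push_cover D i j k \<alpha>)"
    unfolding finite_open_cover_def pc join_covers_def
  proof (intro conjI ballI)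
    show "finite ((\<lambda>V. topspace ?T \<inter> \<Inter> (V ` S)) ` Pi\<^sub>E S c)" by (intro finite_imageI finite_PiE S cfin)
    fix W assume "W \<in> (\<lambda>V. topspace ?T \<inter> \<Inter> (V ` S)) ` Pi\<^sub>E S c"
    then obtain V where V: "V \<in> Pi\<^sub>E S c" "W = topspace ?T \<inter> \<Inter> (V ` S)" by blast
    have "openin ?T ((\<Inter>s\<in>S. V s) \<inter> topspace ?T)"
      by (rule openin_INT[OF S]) (use V(1) cop in auto)
    then show "openin ?T W" by (simp add: V(2) Int_commute)
  next
    have "x \<in> \<Union>((\<lambda>V. topspace ?T \<inter> \<Inter> (V ` S)) ` Pi\<^sub>E S c)" if x: "x \<in> topspace ?T" for x
    proof -
      have "\<forall>s\<in>S. \<exists>W. W \<in> c s \<and> x \<in> W" using ccov x by blast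
      then obtain V where V: "\<And>s. s \<in> S \<Longrightarrow> V s \<in> c s \<and> x \<in> V s" by metis
      have "restrict V S \<in> Pi\<^sub>E S c" using V by auto
      moreover have "x \<in> topspace ?T \<inter> \<Inter> (restrict V S ` S)" using V x by auto
      ultimately show ?thesis by blast
    qed
    then show "\<Union>((\<lambda>V. topspace ?T \<inter> \<Inter> (V ` S)) ` Pi\<^sub>E S c) = topspace ?T" by blast
  qed
  fix W l m assume W: "W \<in> push_cover D i j k \<alpha>" and lm: "l < summands D i" "m < eigs D i j l k"
  then obtain V where V: "V \<in> Pi\<^sub>E S c" "W = topspace ?T \<inter> \<Inter> (V ` S)" unfolding pc join_covers_def by blast
  have lmS: "(l, m) \<in> S" using lm by (simp add: S_def)
  then have "V (l, m) \<in> c (l, m)" using V(1) by blast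
  then obtain V' where V': "V' \<in> induced_cover \<alpha> l" "V (l, m) = {x \<in> topspace ?T. eig D i j l k m x \<in> V'}"
    by (auto simp: c_def pull_cover_def)
  moreover have "W \<subseteq> V (l, m)" using V(2) lmS by blast
  ultimately show "\<exists>V\<in>induced_cover \<alpha> l. eig D i j l k m ` W \<subseteq> V" by blast
qed

end

lemma cover_dim_attained:
  assumes T: "topspace T \<noteq> {}" and \<gamma>: "finite_open_cover T \<gamma>"
  shows "\<exists>\<beta>. finite_open_cover T \<beta> \<and> refines \<beta> \<gamma> \<and> (\<forall>x\<in>topspace T. card {U \<in> \<beta>. x \<in> U} \<le> cover_dim T \<gamma> + 1)"
proof -
  have "cover_ord T \<gamma> \<in> {cover_ord T \<beta> | \<beta>. finite_open_cover T \<beta> \<and> refines \<beta> \<gamma>}"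
    using \<gamma> by (auto simp: refines_def)
  then have "cover_dim T \<gamma> \<in> {cover_ord T \<beta> | \<beta>. finite_open_cover T \<beta> \<and> refines \<beta> \<gamma>}"
    unfolding cover_dim_def by (intro Inf_nat_def1) blast
  then obtain \<beta> where b: "finite_open_cover T \<beta>" "refines \<beta> \<gamma>" "cover_dim T \<gamma> = cover_ord T \<beta>" by blast
  have fin: "finite \<beta>" using b(1) by (simp add: finite_open_cover_def)
  have ind: "(\<Sum>U\<in>\<beta>. indicator U x) = card {U \<in> \<beta>. x \<in> U}" for x
  proof -
    have "(\<Sum>U\<in>\<beta>. indicator U x :: nat) = (\<Sum>U\<in>\<beta>. if x \<in> U then 1 else 0)" by (simp add: indicator_def of_bool_def)
    also have "\<dots> = card {U \<in> \<beta>. x \<in> U}" using fin by (simp add: sum.If_cases Int_def)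
    finally show ?thesis .
  qed
  have "card {U \<in> \<beta>. x \<in> U} \<le> cover_ord T \<beta> + 1" if x: "x \<in> topspace T" for x
  proof -
    have "finite ((\<lambda>x. \<Sum>U\<in>\<beta>. indicator U x :: nat) ` topspace T)"
      unfolding ind by (rule finite_subset[of _ "{..card \<beta>}"]) (use fin in \<open>auto intro: card_mono\<close>)
    then have "card {U \<in> \<beta>. x \<in> U} \<le> Max ((\<lambda>x. \<Sum>U\<in>\<beta>. indicator U x :: nat) ` topspace T)"
      using x unfolding ind by (intro Max_ge) auto
    then show ?thesis by (simp add: cover_ord_def)
  qed
  then show ?thesis using b by (intro exI[of _ \<beta>]) simp
qed

section \<open>Tracial states and the traces at the points of the base spaces\<close>

text \<open>
  The conditions defining a tracial state at the arguments \<open>a\<close>, \<open>b\<close>, \<open>c\<close>, each up to the error \<open>e\<close>.  They are closed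
  conditions on finitely many values of \<open>\<tau>\<close>.
\<close>

definition almost_tracial :: "'a::unital_cstar_algebra \<Rightarrow> 'a \<Rightarrow> complex \<Rightarrow> real \<Rightarrow> ('a \<Rightarrow> complex) \<Rightarrow> bool" where
  "almost_tracial a b c e \<tau> \<longleftrightarrow>
     cmod (\<tau> (a + b) - (\<tau> a + \<tau> b)) \<le> e \<and> cmod (\<tau> (a * b) - \<tau> (b * a)) \<le> e \<and>
     cmod (\<tau> (scaleC c a) - c * \<tau> a) \<le> e \<and> - e \<le> Re (\<tau> (star a * a)) \<and> \<bar>Im (\<tau> (star a * a))\<bar> \<le> e \<and>
     cmod (\<tau> 1 - 1) \<le> e"

lemma tracial_state_if_almost_tracial:
  assumes "\<And>a b c e. 0 < e \<Longrightarrow> almost_tracial a b c e \<tau>"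
  shows "tracial_state \<tau>"
proof -
  have z: "x = 0" if "\<And>e. 0 < e \<Longrightarrow> cmod x \<le> e" for x
    using that by (metis dense_ge norm_le_zero_iff)
  have "\<tau> (a + b) = \<tau> a + \<tau> b" for a b
    using z[of "\<tau> (a + b) - (\<tau> a + \<tau> b)"] assms unfolding almost_tracial_def by auto
  moreover have "\<tau> (a * b) = \<tau> (b * a)" for a b
    using z[of "\<tau> (a * b) - \<tau> (b * a)"] assms unfolding almost_tracial_def by auto
  moreover have "\<tau> (scaleC c a) = c * \<tau> a" for a c
    using z[of "\<tau> (scaleC c a) - c * \<tau> a"] assms unfolding almost_tracial_def by auto
  moreover have "\<tau> 1 = 1" using z[of "\<tau> 1 - 1"] assms unfolding almost_tracial_def by auto
  moreover have "0 \<le> Re (\<tau> (star a * a))" for a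
  proof (rule field_le_epsilon)
    show "0 \<le> Re (\<tau> (star a * a)) + e" if "0 < e" for e
      using assms[OF that, of a a 0] unfolding almost_tracial_def by linarith
  qed
  moreover have "\<tau> (star a * a) \<in> \<real>" for a
  proof -
    have "Im (\<tau> (star a * a)) = 0"
      using z[of "of_real (Im (\<tau> (star a * a)))"] assms unfolding almost_tracial_def by auto
    then show ?thesis by (simp add: complex_is_Real_iff)
  qed
  ultimately show ?thesis unfolding tracial_state_def by blast
qed

text \<open>
  By Tychonoff's theorem the functions bounded by \<open>norm a + 1\<close> form a compact set in the topology of pointwise
  convergence.  Neither linearity nor continuity is demanded of the approximating functions; the limit has
  these properties because its defining conditions hold with every error.
\<close>

lemma tracial_state_compactness:
  fixes p q :: "'a::unital_cstar_algebra"
  assumes fip: "\<And>Z e. finite (Z :: ('a \<times> 'a \<times> complex) set) \<Longrightarrow> 0 < e \<Longrightarrow>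
    \<exists>\<tau>. (\<forall>a. cmod (\<tau> a) \<le> norm a + 1) \<and> (\<forall>(a, b, c)\<in>Z. almost_tracial a b c e \<tau>) \<and> Re (\<tau> p) - Re (\<tau> q) \<le> e"
  shows "\<exists>\<tau>. tracial_state \<tau> \<and> Re (\<tau> p) \<le> Re (\<tau> q)"
proof -
  define B :: "('a \<Rightarrow> complex) set" where "B = (\<Pi>\<^sub>E a\<in>UNIV. cball 0 (norm a + 1))"
  define K where "K = (\<lambda>((a, b, c), e). {\<tau> :: 'a \<Rightarrow> complex. almost_tracial a b c e \<tau> \<and> Re (\<tau> p) - Re (\<tau> q) \<le> e})"
  define I :: "(('a \<times> 'a \<times> complex) \<times> real) set" where "I = UNIV \<times> {0<..}"
  have "compactin (product_topology (\<lambda>a. euclidean) UNIV) B"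
    unfolding B_def by (subst compactin_PiE) auto
  then have comp: "compact B" by (simp add: euclidean_product_topology)
  have ev: "continuous_on UNIV (\<lambda>\<tau> :: 'a \<Rightarrow> complex. \<tau> a)" for a by (rule continuous_on_product_coordinates)
  have cl: "closed (K ze)" for ze
  proof -
    obtain a b c e where ze: "ze = ((a, b, c), e)" by (metis prod_cases4 surj_pair)
    show ?thesis
      unfolding ze K_def almost_tracial_def prod.case
      by (intro closed_Collect_conj closed_Collect_le continuous_intros ev)
  qed
  have "B \<inter> \<Inter>(K ` I) \<noteq> {}"
  proof (rule compact_imp_fip[OF comp])
    show "closed T" if "T \<in> K ` I" for T using that cl by blast
    fix \<F> assume "finite \<F>" "\<F> \<subseteq> K ` I"
    then obtain J where J: "finite J" "J \<subseteq> I" "\<F> = K ` J" by (meson finite_subset_image)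
    define e where "e = Min (insert 1 (snd ` J))"
    have e: "0 < e" using J by (auto simp: e_def I_def)
    have ele: "e \<le> snd ze" if "ze \<in> J" for ze using J that by (auto simp: e_def)
    obtain \<tau> where \<tau>: "\<And>a. cmod (\<tau> a) \<le> norm a + 1" "\<And>a b c. (a, b, c) \<in> fst ` J \<Longrightarrow> almost_tracial a b c e \<tau>"
      "Re (\<tau> p) - Re (\<tau> q) \<le> e"
      using fip[of "fst ` J" e] J(1) e by blast
    have "\<tau> \<in> K ze" if ze: "ze \<in> J" for ze
    proof -
      obtain a b c e' where z: "ze = ((a, b, c), e')" by (metis prod_cases4 surj_pair)
      have "(a, b, c) \<in> fst ` J" using ze z by force
      from \<tau>(2)[OF this] \<tau>(3) ele[OF ze] show ?thesis by (simp add: K_def z almost_tracial_def)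
    qed
    moreover have "\<tau> \<in> B" using \<tau>(1) by (auto simp: B_def PiE_iff)
    ultimately show "B \<inter> \<Inter>\<F> \<noteq> {}" unfolding J(3) by blast
  qed
  then obtain \<tau> where \<tau>: "\<tau> \<in> \<Inter>(K ` I)" by blast
  have K: "almost_tracial a b c e \<tau> \<and> Re (\<tau> p) - Re (\<tau> q) \<le> e" if "0 < e" for a b c e
  proof -
    have "\<tau> \<in> K ((a, b, c), e)" using \<tau> that by (auto simp: I_def)
    then show ?thesis by (simp add: K_def)
  qed
  have "Re (\<tau> p) \<le> Re (\<tau> q)"
  proof (rule field_le_epsilon)
    show "Re (\<tau> p) \<le> Re (\<tau> q) + e" if "0 < e" for e using K[OF that] by (simp add: algebra_simps)
  qed
  then show ?thesis using tracial_state_if_almost_tracial[of \<tau>] K by blast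
qed

context diag_ah
begin

definition stage_diff :: "nat \<Rightarrow> 'x dsum \<Rightarrow> 'x dsum \<Rightarrow> 'x dsum" where
  "stage_diff i a b = sa_plus (stage D i) a (sa_scale (stage D i) (-1) b)"

lemma sub_closed: "a \<in> A i \<Longrightarrow> b \<in> A i \<Longrightarrow> stage_diff i a b \<in> A i"
  by (simp add: stage_diff_def stage_closed)

lemma psi_sub: "a \<in> A i \<Longrightarrow> b \<in> A i \<Longrightarrow> \<psi> i (stage_diff i a b) = \<psi> i a - \<psi> i b"
  by (simp add: stage_diff_def psi_ops(1,3) stage_closed(3) scaleC_minus_one)

lemma sec_conn_sub:
  assumes "i \<le> j" "a \<in> A i" "b \<in> A i" "k < summands D j" "x \<in> topspace (base D j k)"
  shows "sec j (conn D i j (stage_diff i a b)) k x = sec j (conn D i j a) k x - sec j (conn D i j b) k x"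
  using sec_conn_ops(1)[OF assms(1,2,4,5) stage_closed(3)[OF assms(3)]] sec_conn_ops(3)[OF assms(1,3,4,5)]
  by (simp add: stage_diff_def scaleC_minus_one)

text \<open>
  Finitely many elements are approximated at one common stage, which can be chosen as late as desired.
\<close>

lemma approximants:
  assumes "finite H" "0 < d" "finite J"
  shows "\<exists>i y. (\<forall>h\<in>H. y h \<in> A i \<and> norm (\<psi> i (y h) - h) < d) \<and> (\<forall>j\<in>J. j \<le> i)"
proof -
  have dense: "\<exists>i a. a \<in> A i \<and> norm (\<psi> i a - h) < d" for h
  proof -
    have "h \<in> closure (\<Union>i. \<psi> i ` A i)" using limit by (simp add: is_inductive_limit_def)
    then obtain z where "z \<in> (\<Union>i. \<psi> i ` A i)" "dist z h < d" using assms(2) by (meson closure_approachable)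
    then show ?thesis by (auto simp: dist_norm)
  qed
  then obtain s a where sa: "\<And>h. a h \<in> A (s h)" "\<And>h. norm (\<psi> (s h) (a h) - h) < d" by metis
  define i where "i = Max (insert 0 (s ` H \<union> J))"
  have le: "s h \<le> i" if "h \<in> H" for h using assms that by (auto simp: i_def)
  have "j \<le> i" if "j \<in> J" for j using assms that by (auto simp: i_def)
  then show ?thesis
    using sa psi_conn[OF le sa(1)] conn_closed[OF le sa(1)]
    by (intro exI[of _ i] exI[of _ "\<lambda>h. conn D (s h) i (a h)"]) auto
qed

text \<open>
  Otherwise every \<open>\<eta>\<close> fails at a point \<open>x\<close> of an arbitrarily late stage.  The normalized trace at \<open>x\<close>, applied to
  approximants of finitely many given elements, is tracial and positive exactly, and it respects the relations
  between the given elements approximately, because norms at late stages are close to norms in the limit.  By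
  compactness there is a tracial state that does not separate \<open>p\<close> from \<open>q\<close> in the assumed order.
\<close>

lemma trace_gap:
  assumes tr: "\<And>\<tau> :: 'a \<Rightarrow> complex. tracial_state \<tau> \<Longrightarrow> Re (\<tau> p) > Re (\<tau> q)"
  shows "\<exists>\<eta>>0. \<forall>i. \<forall>a\<in>A i. \<forall>b\<in>A i. norm (\<psi> i a - p) < \<eta> \<longrightarrow> norm (\<psi> i b - q) < \<eta> \<longrightarrow>
    (\<forall>\<^sub>F j in sequentially. \<forall>k<summands D j. \<forall>x\<in>topspace (base D j k).
      \<eta> * rk D j k \<le> Re (tr (msize D j k) (sec j (conn D i j a) k x)) - Re (tr (msize D j k) (sec j (conn D i j b) k x)))"
proof (rule ccontr)
  assume neg: "\<not> ?thesis"
  have "\<exists>\<tau>. tracial_state \<tau> \<and> Re (\<tau> p) \<le> Re (\<tau> q)"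
  proof (rule tracial_state_compactness)
    fix Z :: "('a \<times> 'a \<times> complex) set" and e :: real
    assume Z: "finite Z" and e: "0 < e"
    \<comment> \<open>\<open>R\<close> bounds everything in \<open>Z\<close>, so that with errors below \<open>d\<close> in the approximants the errors in products stay below \<open>e\<close>.\<close>
    define R where "R = (\<Sum>(a, b, c)\<in>Z. norm a + norm b + cmod c) + 1"
    have RZ: "norm a + norm b + cmod c + 1 \<le> R" if "(a, b, c) \<in> Z" for a b c
      using member_le_sum[OF that, of "\<lambda>(a, b, c). norm a + norm b + cmod c"] Z by (auto simp: R_def)
    have R: "1 \<le> R" by (auto simp: R_def intro!: sum_nonneg)
    define d where "d = min 1 e / (10 * R)"
    have d: "0 < d" "d \<le> 1/10" "d * R \<le> e / 10" "d \<le> e / 10"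
    proof -
      show "0 < d" using e R by (simp add: d_def)
      have "d * R = min 1 e / 10" using R by (simp add: d_def)
      then show "d * R \<le> e / 10" by simp
      have "d * 1 \<le> d * R" by (rule mult_left_mono[OF R]) (use \<open>0 < d\<close> in simp)
      then show "d \<le> 1/10" "d \<le> e / 10" using \<open>d * R = min 1 e / 10\<close> by auto
    qed
    from neg d(1) obtain i1 a1 b1 where ab1: "a1 \<in> A i1" "b1 \<in> A i1" "norm (\<psi> i1 a1 - p) < d" "norm (\<psi> i1 b1 - q) < d"
      and bad: "\<not> (\<forall>\<^sub>F j in sequentially. \<forall>k<summands D j. \<forall>x\<in>topspace (base D j k).
        d * rk D j k \<le> Re (tr (msize D j k) (sec j (conn D i1 j a1) k x)) - Re (tr (msize D j k) (sec j (conn D i1 j b1) k x)))"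
      by blast
    define H where "H = {p, q, 1} \<union> (\<Union>(a, b, c)\<in>Z. {a, b, a + b, a * b, b * a, scaleC c a, star a * a})"
    have finH: "finite H" unfolding H_def using Z by auto
    obtain i y where y: "\<And>h. h \<in> H \<Longrightarrow> y h \<in> A i" "\<And>h. h \<in> H \<Longrightarrow> norm (\<psi> i (y h) - h) < d" and i1: "i1 \<le> i"
      using approximants[OF finH d(1), of "{i1}"] by blast
    define a' where "a' = conn D i1 i a1"
    define b' where "b' = conn D i1 i b1"
    have ab': "a' \<in> A i" "b' \<in> A i" using conn_closed[OF i1] ab1 by (auto simp: a'_def b'_def)
    \<comment> \<open>Differences that are small in the limit algebra express the algebraic relations between the approximants;
      their sections are small at every point of a late stage.\<close>
    define rel :: "'x dsum set" where "rel = y ` H \<union> {stage_diff i (y p) a', stage_diff i (y q) b', stage_diff i (y 1) (sa_one (stage D i))} \<union>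
      (\<Union>(a, b, c)\<in>Z. {stage_diff i (y (a + b)) (sa_plus (stage D i) (y a) (y b)),
        stage_diff i (y (a * b)) (sa_times (stage D i) (y a) (y b)), stage_diff i (y (b * a)) (sa_times (stage D i) (y b) (y a)),
        stage_diff i (y (scaleC c a)) (sa_scale (stage D i) c (y a)), stage_diff i (y (star a * a)) (sa_times (stage D i) (sa_star (stage D i) (y a)) (y a))})"
    have Hpq: "p \<in> H" "q \<in> H" "1 \<in> H" by (auto simp: H_def)
    have HZ: "a \<in> H" "b \<in> H" "a + b \<in> H" "a * b \<in> H" "b * a \<in> H" "scaleC c a \<in> H" "star a * a \<in> H"
      if "(a, b, c) \<in> Z" for a b c using that by (force simp: H_def)+
    have relZ: "{stage_diff i (y (a + b)) (sa_plus (stage D i) (y a) (y b)),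
        stage_diff i (y (a * b)) (sa_times (stage D i) (y a) (y b)), stage_diff i (y (b * a)) (sa_times (stage D i) (y b) (y a)),
        stage_diff i (y (scaleC c a)) (sa_scale (stage D i) c (y a)), stage_diff i (y (star a * a)) (sa_times (stage D i) (sa_star (stage D i) (y a)) (y a))} \<subseteq> A i"
      if "(a, b, c) \<in> Z" for a b c
      using HZ[OF that] by (auto intro!: sub_closed stage_closed y)
    have "rel \<subseteq> A i"
      unfolding rel_def
    proof (intro Un_least UN_least)
      show "y ` H \<subseteq> A i" using y by blast
      show "{stage_diff i (y p) a', stage_diff i (y q) b', stage_diff i (y 1) (sa_one (stage D i))} \<subseteq> A i"
        using stage_closed(5)[OF ab'(1)] by (auto intro!: sub_closed y Hpq ab')
      fix z assume "z \<in> Z"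
      then show "(case z of (a, b, c) \<Rightarrow> {stage_diff i (y (a + b)) (sa_plus (stage D i) (y a) (y b)),
        stage_diff i (y (a * b)) (sa_times (stage D i) (y a) (y b)), stage_diff i (y (b * a)) (sa_times (stage D i) (y b) (y a)),
        stage_diff i (y (scaleC c a)) (sa_scale (stage D i) c (y a)), stage_diff i (y (star a * a)) (sa_times (stage D i) (sa_star (stage D i) (y a)) (y a))}) \<subseteq> A i"
        using relZ by (cases z) simp
    qed
    then have relA: "g \<in> A i" if "g \<in> rel" for g using that by blast
    have finrel: "finite rel" unfolding rel_def using finH Z by (auto split: prod.splits)
    have ev: "\<forall>\<^sub>F j in sequentially. i < j \<and> (\<forall>k<summands D j. \<forall>x\<in>topspace (base D j k). norm (sec j (conn D i j g) k x) < norm (\<psi> i g) + d)"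
      if "g \<in> rel" for g
      by (rule eventually_norm_sec_conn_less[OF relA[OF that]]) (use d in simp)
    define good where "good j \<longleftrightarrow> (\<forall>g\<in>rel. i < j \<and> (\<forall>k<summands D j. \<forall>x\<in>topspace (base D j k).
        norm (sec j (conn D i j g) k x) < norm (\<psi> i g) + d))" for j
    define gapped where "gapped j \<longleftrightarrow> (\<forall>k<summands D j. \<forall>x\<in>topspace (base D j k).
        d * rk D j k \<le> Re (tr (msize D j k) (sec j (conn D i1 j a1) k x)) - Re (tr (msize D j k) (sec j (conn D i1 j b1) k x)))" for j
    have "eventually good sequentially"
      unfolding good_def[abs_def] by (intro eventually_ball_finite[OF finrel] ballI ev)
    moreover have "\<not> eventually gapped sequentially" using bad unfolding gapped_def[abs_def] .
    ultimately obtain j where j: "good j" "\<not> gapped j" using eventually_mono[of good sequentially gapped] by blast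
    then obtain k x where k: "k < summands D j" and x: "x \<in> topspace (base D j k)"
      and less: "Re (tr (msize D j k) (sec j (conn D i1 j a1) k x)) - Re (tr (msize D j k) (sec j (conn D i1 j b1) k x)) < d * rk D j k"
      unfolding gapped_def by (auto simp: not_le)
    have good: "i < j" "norm (sec j (conn D i j g) k x) < norm (\<psi> i g) + d" if "g \<in> rel" for g
      using j(1) that k x by (auto simp: good_def)
    have "y p \<in> rel" using Hpq by (auto simp: rel_def)
    then have ij: "i \<le> j" using good(1) by fastforce
    \<comment> \<open>The normalized trace at the point \<open>x\<close> is the candidate for an almost tracial functional.\<close>
    define t where "t g = tr (msize D j k) (sec j (conn D i j g) k x) / of_nat (rk D j k)" for g
    have n: "0 < rk D j k" by (rule base_props(5)[OF k])
    note un = un_projection[OF k x]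
    have tle: "cmod (t g) \<le> norm (sec j (conn D i j g) k x)" if g: "g \<in> A i" for g
    proof -
      have "un j k x * sec j (conn D i j g) k x = sec j (conn D i j g) k x"
        by (rule carrier_stageD(5)[OF conn_closed[OF ij g] k x])
      then have "cmod (tr (msize D j k) (sec j (conn D i j g) k x)) \<le> rk D j k * norm (sec j (conn D i j g) k x)"
        using norm_tr_corner_le[OF un(1), of "msize D j k" "sec j (conn D i j g) k x"] un(2) by simp
      then show ?thesis using n by (simp add: t_def norm_divide field_simps)
    qed
    have tsub: "t (stage_diff i g g') = t g - t g'" if "g \<in> A i" "g' \<in> A i" for g g'
      using sec_conn_sub[OF ij that k x] by (simp add: t_def tr_diff diff_divide_distrib)
    have tplus: "t (sa_plus (stage D i) g g') = t g + t g'" if "g \<in> A i" "g' \<in> A i" for g g'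
      using sec_conn_ops(1)[OF ij that(1) k x that(2)] by (simp add: t_def tr_add add_divide_distrib)
    have tcomm: "t (sa_times (stage D i) g g') = t (sa_times (stage D i) g' g)" if "g \<in> A i" "g' \<in> A i" for g g'
      using sec_conn_ops(2)[OF ij that(1) k x that(2)] sec_conn_ops(2)[OF ij that(2) k x that(1)] by (simp add: t_def tr_comm)
    have tscale: "t (sa_scale (stage D i) c g) = c * t g" if "g \<in> A i" for g c
      using sec_conn_ops(3)[OF ij that k x] by (simp add: t_def tr_scaleC)
    have tone: "t (sa_one (stage D i)) = 1"
      using sec_conn_ops(5)[OF ij ab'(1) k x] un(2) n by (simp add: t_def)
    have tpos: "0 \<le> Re (t (sa_times (stage D i) (sa_star (stage D i) g) g))" "Im (t (sa_times (stage D i) (sa_star (stage D i) g) g)) = 0"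
      if "g \<in> A i" for g
      using sec_conn_ops(2)[OF ij stage_closed(4)[OF that] k x that] sec_conn_ops(4)[OF ij that k x]
        tr_star_mult_ge_0[of "msize D j k" "sec j (conn D i j g) k x"]
      by (auto simp: t_def Re_divide_of_nat Im_divide_of_nat tr_star_mult)
    have trel: "cmod (t g) \<le> norm (\<psi> i g) + d" if "g \<in> rel" for g
      using tle[OF relA[OF that]] good(2)[OF that] by linarith
    have close: "cmod (t g - t g') \<le> norm (\<psi> i g - \<psi> i g') + d" if "stage_diff i g g' \<in> rel" "g \<in> A i" "g' \<in> A i" for g g'
      using trel[OF that(1)] tsub[OF that(2,3)] psi_sub[OF that(2,3)] by simp
    have psi1: "\<psi> i (sa_one (stage D i)) = 1" by (rule psi_ops(5)[OF ab'(1)])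
    have ny: "norm (\<psi> i (y h)) \<le> norm h + d" if "h \<in> H" for h
      using norm_triangle_ineq[of "\<psi> i (y h) - h" h] y(2)[OF that] by simp
    define \<tau> where "\<tau> h = (if h \<in> H then t (y h) else 0)" for h
    have \<tau>H: "\<tau> h = t (y h)" if "h \<in> H" for h using that by (simp add: \<tau>_def)
    have yrel: "y h \<in> rel" if "h \<in> H" for h using that by (auto simp: rel_def)
    have b1: "cmod (\<tau> h) \<le> norm h + 1" for h
    proof (cases "h \<in> H")
      case True
      then show ?thesis using trel[OF yrel[OF True]] ny[OF True] d(2) by (simp add: \<tau>H)
    qed (simp add: \<tau>_def)
    have b2: "almost_tracial a b c e \<tau>" if z: "(a, b, c) \<in> Z" for a b c
    proof -
      note h = HZ[OF z]
      note r = RZ[OF z]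
      have relz: "stage_diff i (y (a + b)) (sa_plus (stage D i) (y a) (y b)) \<in> rel"
        "stage_diff i (y (a * b)) (sa_times (stage D i) (y a) (y b)) \<in> rel" "stage_diff i (y (b * a)) (sa_times (stage D i) (y b) (y a)) \<in> rel"
        "stage_diff i (y (scaleC c a)) (sa_scale (stage D i) c (y a)) \<in> rel"
        "stage_diff i (y (star a * a)) (sa_times (stage D i) (sa_star (stage D i) (y a)) (y a)) \<in> rel"
        "stage_diff i (y 1) (sa_one (stage D i)) \<in> rel"
        using z by (force simp: rel_def)+
      have prod: "norm (u * v - u' * v') \<le> 3 * (d * R)"
        if "norm (u - u') < d" "norm (v - v') < d" "norm u' \<le> R" "norm v' \<le> R - 1" for u v u' v' :: 'a
      proof -
        have "u * v - u' * v' = (u - u') * v + u' * (v - v')" by (simp add: algebra_simps)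
        then have "norm (u * v - u' * v') \<le> norm (u - u') * norm v + norm u' * norm (v - v')"
          using norm_triangle_ineq[of "(u - u') * v" "u' * (v - v')"] norm_mult_ineq[of "u - u'" v] norm_mult_ineq[of u' "v - v'"] by simp
        also have "\<dots> \<le> d * R + R * d"
        proof (intro add_mono mult_mono)
          show "norm v \<le> R" using norm_triangle_ineq[of "v - v'" v'] that(2,4) d(2) by simp
        qed (use that d R in auto)
        also have "\<dots> \<le> 3 * (d * R)" using d(1) R by (simp add: mult.commute)
        finally show ?thesis .
      qed
      have Ra: "norm a \<le> R - 1" "norm b \<le> R - 1" "cmod c \<le> R" using r by (smt (verit) norm_ge_zero)+
      have yab: "norm (\<psi> i (y a) - a) < d" "norm (\<psi> i (y b) - b) < d" using y(2) h by auto
      have m1: "norm (\<psi> i (y a) * \<psi> i (y b) - a * b) \<le> 3 * (d * R)" by (rule prod[OF yab]) (use Ra in auto)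
      have m2: "norm (\<psi> i (y b) * \<psi> i (y a) - b * a) \<le> 3 * (d * R)" by (rule prod[OF yab(2,1)]) (use Ra in auto)
      have m3: "norm (star (\<psi> i (y a)) * \<psi> i (y a) - star a * a) \<le> 3 * (d * R)"
        by (rule prod[OF _ yab(1)]) (use Ra yab(1) in \<open>auto simp: star_diff[symmetric]\<close>)
      have m4: "norm (scaleC c (\<psi> i (y a)) - scaleC c a) \<le> d * R"
      proof -
        have "scaleC c (\<psi> i (y a)) - scaleC c a = scaleC c (\<psi> i (y a) - a)"
          using scaleC_add_right[of c "\<psi> i (y a) - a" a] by simp
        then have "norm (scaleC c (\<psi> i (y a)) - scaleC c a) = cmod c * norm (\<psi> i (y a) - a)" by (simp add: norm_scaleC)
        also have "\<dots> \<le> R * d" using Ra yab R by (intro mult_mono) auto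
        finally show ?thesis by (simp add: mult.commute)
      qed
      have tri: "norm (u - w) \<le> norm (u - v) + norm (w - v)" for u v w :: 'a
        using norm_triangle_ineq4[of "u - v" "w - v"] by simp
      have c1: "cmod (t (y (a + b)) - (t (y a) + t (y b))) \<le> e"
      proof -
        have "norm (\<psi> i (y (a + b)) - (\<psi> i (y a) + \<psi> i (y b))) \<le> 3 * d"
          using norm_triangle_ineq4[of "\<psi> i (y (a + b)) - (a + b)" "(\<psi> i (y a) - a) + (\<psi> i (y b) - b)"]
            norm_triangle_ineq[of "\<psi> i (y a) - a" "\<psi> i (y b) - b"] yab y(2)[OF h(3)] by (simp add: algebra_simps)
        then show ?thesis
          using close[OF relz(1) y(1)[OF h(3)] stage_closed(1)[OF y(1)[OF h(1)] y(1)[OF h(2)]]] d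
          by (simp add: psi_ops(1)[OF y(1)[OF h(1)] y(1)[OF h(2)]] tplus[OF y(1)[OF h(1)] y(1)[OF h(2)]])
      qed
      have c2: "cmod (t (y (a * b)) - t (y (b * a))) \<le> e"
      proof -
        have "cmod (t (y (a * b)) - t (sa_times (stage D i) (y a) (y b))) \<le> (d + 3 * (d * R)) + d"
          using close[OF relz(2) y(1)[OF h(4)] stage_closed(2)[OF y(1)[OF h(1)] y(1)[OF h(2)]]]
            tri[of "\<psi> i (y (a * b))" "\<psi> i (y a) * \<psi> i (y b)" "a * b"] m1 y(2)[OF h(4)]
          by (simp add: psi_ops(2)[OF y(1)[OF h(1)] y(1)[OF h(2)]])
        moreover have "cmod (t (y (b * a)) - t (sa_times (stage D i) (y b) (y a))) \<le> (d + 3 * (d * R)) + d"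
          using close[OF relz(3) y(1)[OF h(5)] stage_closed(2)[OF y(1)[OF h(2)] y(1)[OF h(1)]]]
            tri[of "\<psi> i (y (b * a))" "\<psi> i (y b) * \<psi> i (y a)" "b * a"] m2 y(2)[OF h(5)]
          by (simp add: psi_ops(2)[OF y(1)[OF h(2)] y(1)[OF h(1)]])
        moreover have "t (sa_times (stage D i) (y a) (y b)) = t (sa_times (stage D i) (y b) (y a))"
          by (rule tcomm[OF y(1)[OF h(1)] y(1)[OF h(2)]])
        ultimately show ?thesis
          using norm_triangle_ineq4[of "t (y (a * b)) - t (sa_times (stage D i) (y a) (y b))" "t (y (b * a)) - t (sa_times (stage D i) (y a) (y b))"] d
          by simp
      qed
      have c3: "cmod (t (y (scaleC c a)) - c * t (y a)) \<le> e"
        using close[OF relz(4) y(1)[OF h(6)] stage_closed(3)[OF y(1)[OF h(1)]]] d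
          tri[of "\<psi> i (y (scaleC c a))" "scaleC c (\<psi> i (y a))" "scaleC c a"] m4 y(2)[OF h(6)]
        by (simp add: psi_ops(3)[OF y(1)[OF h(1)]] tscale[OF y(1)[OF h(1)]])
      have c4: "cmod (t (y (star a * a)) - t (sa_times (stage D i) (sa_star (stage D i) (y a)) (y a))) \<le> e"
        using close[OF relz(5) y(1)[OF h(7)] stage_closed(2)[OF stage_closed(4)[OF y(1)[OF h(1)]] y(1)[OF h(1)]]] d
          tri[of "\<psi> i (y (star a * a))" "star (\<psi> i (y a)) * \<psi> i (y a)" "star a * a"] m3 y(2)[OF h(7)]
        by (simp add: psi_ops(2)[OF stage_closed(4)[OF y(1)[OF h(1)]] y(1)[OF h(1)]] psi_ops(4)[OF y(1)[OF h(1)]])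
      have c5: "cmod (t (y 1) - 1) \<le> e"
        using close[OF relz(6) y(1)[OF Hpq(3)] stage_closed(5)[OF ab'(1)]] y(2)[OF Hpq(3)] d by (simp add: psi1 tone)
      have c6: "- e \<le> Re (t (y (star a * a)))" "\<bar>Im (t (y (star a * a)))\<bar> \<le> e"
        using abs_Re_le_cmod[of "t (y (star a * a)) - t (sa_times (stage D i) (sa_star (stage D i) (y a)) (y a))"]
          abs_Im_le_cmod[of "t (y (star a * a)) - t (sa_times (stage D i) (sa_star (stage D i) (y a)) (y a))"]
          c4 tpos[OF y(1)[OF h(1)]] by simp_all
      show ?thesis unfolding almost_tracial_def
        using c1 c2 c3 c5 c6 h Hpq by (simp add: \<tau>H)
    qed
    have b3: "Re (\<tau> p) - Re (\<tau> q) \<le> e"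
    proof -
      have "stage_diff i (y p) a' \<in> rel" "stage_diff i (y q) b' \<in> rel" by (auto simp: rel_def)
      then have "cmod (t (y p) - t a') \<le> norm (\<psi> i (y p) - \<psi> i a') + d" "cmod (t (y q) - t b') \<le> norm (\<psi> i (y q) - \<psi> i b') + d"
        using close y(1) Hpq ab' by auto
      moreover have "norm (\<psi> i (y p) - \<psi> i a') \<le> 2 * d" "norm (\<psi> i (y q) - \<psi> i b') \<le> 2 * d"
        using norm_triangle_ineq4[of "\<psi> i (y p) - p" "\<psi> i a' - p"] norm_triangle_ineq4[of "\<psi> i (y q) - q" "\<psi> i b' - q"]
          y(2)[OF Hpq(1)] y(2)[OF Hpq(2)] ab1 psi_conn[OF i1] by (simp_all add: a'_def b'_def)
      moreover have "Re (t a') - Re (t b') \<le> d"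
        using less n conn_conn[OF i1 ij] ab1 by (simp add: t_def a'_def b'_def Re_divide_of_nat field_simps)
      ultimately have "Re (t (y p)) - Re (t (y q)) \<le> 7 * d"
        using abs_Re_le_cmod[of "t (y p) - t a'"] abs_Re_le_cmod[of "t (y q) - t b'"] by simp
      then show ?thesis using d(4) e Hpq by (simp add: \<tau>H)
    qed
    show "\<exists>\<tau>. (\<forall>a. cmod (\<tau> a) \<le> norm a + 1) \<and> (\<forall>(a, b, c)\<in>Z. almost_tracial a b c e \<tau>) \<and> Re (\<tau> p) - Re (\<tau> q) \<le> e"
      using b1 b2 b3 by (intro exI[of _ \<tau>]) auto
  qed
  then show False using tr by (meson not_le)
qed

end

context diag_ah
begin

section \<open>Comparison of projections\<close>

text \<open>
  The self-adjoint part of any approximant is at least as close to the self-adjoint element \<open>p\<close>.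
\<close>

lemma selfadjoint_approximant:
  assumes p: "star p = p" and d: "0 < d"
  shows "\<exists>i. \<exists>a\<in>A i. sa_star (stage D i) a = a \<and> norm (\<psi> i a - p) < d"
proof -
  obtain i y where y: "y \<in> A i" "norm (\<psi> i y - p) < d" using approximants[of "{p}" d "{}"] d by auto
  define a where "a = sa_scale (stage D i) (1/2) (sa_plus (stage D i) y (sa_star (stage D i) y))"
  note ys = stage_closed(4)[OF y(1)]
  note pl = stage_closed(1)[OF y(1) ys]
  have aA: "a \<in> A i" unfolding a_def by (rule stage_closed(3)[OF pl])
  have "sa_star (stage D i) a = a"
  proof (rule sec_inject[OF stage_closed(4)[OF aA] aA])
    fix k x assume kx: "k < summands D i" "x \<in> topspace (base D i k)"
    have "sec i a k x = scaleC (1/2) (sec i y k x + star (sec i y k x))"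
      by (simp add: a_def sec_stage_ops(3)[OF pl kx] sec_stage_ops(1)[OF y(1) kx ys] sec_stage_ops(4)[OF y(1) kx])
    then show "sec i (sa_star (stage D i) a) k x = sec i a k x"
      by (simp add: sec_stage_ops(4)[OF aA kx] star_scaleC star_add star_star add.commute)
  qed
  moreover have "norm (\<psi> i a - p) < d"
  proof -
    have half: "scaleC (1/2) z = (1/2) *\<^sub>R z" for z :: 'a using scaleC_of_real[of "1/2" z] by simp
    have "\<psi> i a = (1/2) *\<^sub>R (\<psi> i y + star (\<psi> i y))"
      by (simp add: a_def psi_ops(3)[OF pl] psi_ops(1)[OF y(1) ys] psi_ops(4)[OF y(1)] half)
    then have "\<psi> i a - p = (1/2) *\<^sub>R (\<psi> i y + star (\<psi> i y) - (p + p))"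
      by (simp only: scaleR_diff_right scaleR_half_double)
    also have "\<psi> i y + star (\<psi> i y) - (p + p) = (\<psi> i y - p) + star (\<psi> i y - p)"
      by (simp add: star_diff p)
    finally have "norm (\<psi> i a - p) \<le> 1/2 * (norm (\<psi> i y - p) + norm (\<psi> i y - p))"
      using norm_triangle_ineq[of "\<psi> i y - p" "star (\<psi> i y - p)"] by simp
    then show ?thesis using y(2) by simp
  qed
  ultimately show ?thesis using aA by blast
qed

text \<open>
  In each summand of stage \<open>j\<close> the conjugated images \<open>tw\<close> of \<open>a\<close> and \<open>b\<close> vary by at most \<open>\<epsilon>\<close> on the members of the
  pushed forward cover: each of the diagonal blocks coming from one summand of stage \<open>i\<close> varies by at most
  \<open>\<epsilon> / summands D i\<close>.  So \<open>comparison_over_cover\<close> applies in each summand.  The resulting functions are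
  conjugated back, which also cuts them down to the corner, and assembled to one element of stage \<open>j\<close>.
\<close>

lemma comparison_at_stage:
  fixes \<eta> :: real
  assumes ij: "i < j" and a: "a \<in> A i" "sa_star (stage D i) a = a" and b: "b \<in> A i" "sa_star (stage D i) b = b"
    and \<epsilon>: "0 < \<epsilon>" "\<epsilon> \<le> 1/2000" "300 * \<epsilon> \<le> \<eta>"
    and \<alpha>: "\<And>l. l < summands D i \<Longrightarrow> finite_open_cover (base D i l) (induced_cover \<alpha> l)"
      "\<And>l V x y. l < summands D i \<Longrightarrow> V \<in> induced_cover \<alpha> l \<Longrightarrow> x \<in> V \<Longrightarrow> y \<in> V \<Longrightarrow>
        norm (sec i a l x - sec i a l y) \<le> \<epsilon> / summands D i \<and> norm (sec i b l x - sec i b l y) \<le> \<epsilon> / summands D i"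
    and dim: "\<And>k. k < summands D j \<Longrightarrow> real (cover_dim (base D j k) (push_cover D i j k \<alpha>)) \<le> \<eta> / 4 * rk D j k"
    and ea: "\<And>k x. k < summands D j \<Longrightarrow> x \<in> topspace (base D j k) \<Longrightarrow>
        norm (sec j (conn D i j a) k x - sec j (conn D i j a) k x * sec j (conn D i j a) k x) \<le> \<epsilon>"
    and eb: "\<And>k x. k < summands D j \<Longrightarrow> x \<in> topspace (base D j k) \<Longrightarrow>
        norm (sec j (conn D i j b) k x - sec j (conn D i j b) k x * sec j (conn D i j b) k x) \<le> \<epsilon>"
    and gap: "\<And>k x. k < summands D j \<Longrightarrow> x \<in> topspace (base D j k) \<Longrightarrow>
        \<eta> * rk D j k \<le> Re (tr (msize D j k) (sec j (conn D i j a) k x)) - Re (tr (msize D j k) (sec j (conn D i j b) k x))"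
  shows "\<exists>w. norm w \<le> 2 \<and> norm (\<psi> i b - \<psi> i b * star w * \<psi> i a * w * \<psi> i b) \<le> 1/2"
proof -
  let ?a = "conn D i j a" and ?b = "conn D i j b"
  have ij': "i \<le> j" using ij by simp
  have aA: "?a \<in> A j" and bA: "?b \<in> A j" using conn_closed[OF ij'] a b by auto
  from diagonal_form[OF ij] obtain u s t where
    cu: "\<forall>k<summands D j. continuous_map (base D j k) euclidean (u k)" and
    u0: "\<forall>k<summands D j. \<forall>x\<in>topspace (base D j k). star (u k x) * u k x = un j k x \<and> u k x * star (u k x) = un j k x \<and>
       un j k x * u k x = u k x \<and> u k x * un j k x = u k x" and
    f0: "\<forall>k<summands D j. \<forall>x\<in>topspace (base D j k). \<forall>a\<in>A i.
       (\<forall>l<summands D i. eig_block i j l k (s l k) (t l k) (a l) x \<in> carrier_mat (msize D j k) (msize D j k)) \<and>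
       u k x * sec j (conn D i j a) k x * star (u k x) =
         (\<Sum>l<summands D i. emb (msize D j k) (eig_block i j l k (s l k) (t l k) (a l) x))"
    by (elim exE conjE) (rule that)
  define tw where "tw g k x = u k x * sec j g k x * star (u k x)" for g k x
  have uu: "star (u k x) * u k x = un j k x" "u k x * star (u k x) = un j k x" "un j k x * u k x = u k x" "u k x * un j k x = u k x"
    "star (u k x) * un j k x = star (u k x)" "un j k x * star (u k x) = star (u k x)" "norm (u k x) \<le> 1"
    if k: "k < summands D j" and x: "x \<in> topspace (base D j k)" for k x
  proof -
    note u1 = u0[rule_format, OF k x]
    note un = is_projectionD[OF un_projection(1)[OF k x]]
    show "star (u k x) * u k x = un j k x" "u k x * star (u k x) = un j k x" "un j k x * u k x = u k x" "u k x * un j k x = u k x"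
      using u1 by auto
    have "star (un j k x * u k x) = star (u k x)" "star (u k x * un j k x) = star (u k x)" using u1 by simp_all
    then show "star (u k x) * un j k x = star (u k x)" "un j k x * star (u k x) = star (u k x)"
      unfolding star_mult un(2) by simp_all
    have "(norm (u k x))\<^sup>2 = norm (un j k x)" using cstar_identity[of "u k x"] u1 by simp
    also have "\<dots> \<le> 1\<^sup>2" using norm_projection_le[OF un_projection(1)[OF k x]] by simp
    finally show "norm (u k x) \<le> 1" by (rule power2_le_imp_le) simp
  qed
  have norm_uxu: "norm (u k x * z * star (u k x)) \<le> norm z" "norm (star (u k x) * z * u k x) \<le> norm z"
    if k: "k < summands D j" and x: "x \<in> topspace (base D j k)" for k x z
  proof -
    have "norm (u k x) * norm z * norm (u k x) \<le> 1 * norm z * 1" using uu(7)[OF k x] by (intro mult_mono) auto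
    then show "norm (u k x * z * star (u k x)) \<le> norm z" "norm (star (u k x) * z * u k x) \<le> norm z"
      using norm_mult3_le[of "u k x" z "star (u k x)"] norm_mult3_le[of "star (u k x)" z "u k x"] by simp_all
  qed
  have near: "norm (tw (conn D i j g) k x - tw (conn D i j g) k y) \<le> \<epsilon>"
    if g: "g \<in> A i" and osc: "\<And>l V x y. l < summands D i \<Longrightarrow> V \<in> induced_cover \<alpha> l \<Longrightarrow> x \<in> V \<Longrightarrow> y \<in> V \<Longrightarrow>
        norm (sec i g l x - sec i g l y) \<le> \<epsilon> / summands D i"
      and k: "k < summands D j" and W: "W \<in> push_cover D i j k \<alpha>" and x: "x \<in> W" and y: "y \<in> W" for g k W x y
  proof -
    have "W \<subseteq> topspace (base D j k)"
      using push_cover_props(1)[OF ij k \<alpha>(1)] W openin_subset unfolding finite_open_cover_def by blast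
    then have xy: "x \<in> topspace (base D j k)" "y \<in> topspace (base D j k)" using x y by auto
    note fx = f0[rule_format, OF k xy(1) g] and fy = f0[rule_format, OF k xy(2) g]
    let ?e = "\<lambda>l x. emb (msize D j k) (eig_block i j l k (s l k) (t l k) (g l) x)"
    have diff: "tw (conn D i j g) k x - tw (conn D i j g) k y = (\<Sum>l<summands D i. ?e l x - ?e l y)"
      unfolding tw_def using fx fy by (simp add: sum_subtractf)
    have "norm (\<Sum>l<summands D i. ?e l x - ?e l y) \<le> (\<Sum>l<summands D i. \<epsilon> / summands D i)"
    proof (rule sum_norm_le)
      fix l assume "l \<in> {..<summands D i}"
      then have l: "l < summands D i" by simp
      show "norm (?e l x - ?e l y) \<le> \<epsilon> / summands D i"
      proof (rule norm_eig_block_diff[OF ij g k l xy])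
        show "eig_block i j l k (s l k) (t l k) (g l) x \<in> carrier_mat (msize D j k) (msize D j k)"
          "eig_block i j l k (s l k) (t l k) (g l) y \<in> carrier_mat (msize D j k) (msize D j k)" using fx fy l by auto
        show "0 \<le> \<epsilon> / real (summands D i)" using \<epsilon> by simp
        fix m assume m: "m < eigs D i j l k"
        obtain V where "V \<in> induced_cover \<alpha> l" "eig D i j l k m ` W \<subseteq> V"
          using push_cover_props(2)[OF ij k \<alpha>(1) W l m] by blast
        then show "norm (sec i g l (eig D i j l k m x) - sec i g l (eig D i j l k m y)) \<le> \<epsilon> / real (summands D i)"
          using osc[OF l] x y by blast
      qed
    qed
    then show ?thesis unfolding diff using summands_pos[of i] by simp
  qed
  have tw_mult: "tw g k x * tw g k x = u k x * (sec j g k x * sec j g k x) * star (u k x)"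
    if g: "g \<in> A j" and k: "k < summands D j" and x: "x \<in> topspace (base D j k)" for g k x
  proof -
    have "tw g k x * tw g k x = u k x * sec j g k x * ((star (u k x) * u k x) * sec j g k x) * star (u k x)"
      by (simp add: tw_def mult.assoc)
    then show ?thesis using uu(1)[OF k x] carrier_stageD(5)[OF g k x] by (simp add: mult.assoc)
  qed
  have tr_tw: "tr (msize D j k) (tw g k x) = tr (msize D j k) (sec j g k x)"
    if g: "g \<in> A j" and k: "k < summands D j" and x: "x \<in> topspace (base D j k)" for g k x
  proof -
    have "tr (msize D j k) (tw g k x) = tr (msize D j k) (star (u k x) * (u k x * sec j g k x))"
      unfolding tw_def by (rule tr_comm)
    also have "star (u k x) * (u k x * sec j g k x) = sec j g k x"
      using uu(1)[OF k x] carrier_stageD(5)[OF g k x] by (simp add: mult.assoc[symmetric])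
    finally show ?thesis .
  qed
  have star_tw: "star (tw (conn D i j g) k x) = tw (conn D i j g) k x"
    if g: "g \<in> A i" "sa_star (stage D i) g = g" and k: "k < summands D j" and x: "x \<in> topspace (base D j k)" for g k x
    using sec_conn_ops(4)[OF ij' g(1) k x] g(2) by (simp add: tw_def star_mult star_star mult.assoc)
  have un_tw: "un j k x * tw g k x = tw g k x" if "k < summands D j" "x \<in> topspace (base D j k)" for g k x
    using uu(3)[OF that] by (simp add: tw_def mult.assoc[symmetric])
  have r_tw: "emb (msize D j k) (1\<^sub>m (msize D j k)) * tw g k x = tw g k x"
    if k: "k < summands D j" and x: "x \<in> topspace (base D j k)" for g k x
  proof -
    have "emb (msize D j k) (1\<^sub>m (msize D j k)) * tw g k x = (emb (msize D j k) (1\<^sub>m (msize D j k)) * un j k x) * tw g k x"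
      by (simp only: mult.assoc un_tw[OF k x])
    then show ?thesis by (simp only: un_projection(3)[OF k x] un_tw[OF k x])
  qed
  have unt: "sec j g k x = star (u k x) * tw g k x * u k x"
    if g: "g \<in> A j" and k: "k < summands D j" and x: "x \<in> topspace (base D j k)" for g k x
  proof -
    have "star (u k x) * tw g k x * u k x = (star (u k x) * u k x) * sec j g k x * (star (u k x) * u k x)"
      by (simp add: tw_def mult.assoc)
    then show ?thesis using uu(1)[OF k x] carrier_stageD(4)[OF g k x] by simp
  qed
  define solves where "solves k V \<longleftrightarrow> continuous_map (base D j k) euclidean V \<and> (\<forall>x\<in>topspace (base D j k). norm (V x) \<le> 2 \<and>
      emb (msize D j k) (1\<^sub>m (msize D j k)) * V x = V x \<and>
      norm (tw ?b k x - tw ?b k x * star (V x) * tw ?a k x * V x * tw ?b k x) \<le> 1/2)" for k V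
  have "\<exists>V. solves k V" if k: "k < summands D j" for k
  proof -
    let ?T = "base D j k" and ?dim = "cover_dim (base D j k) (push_cover D i j k \<alpha>)"
    obtain \<beta> where \<beta>: "finite_open_cover ?T \<beta>" "refines \<beta> (push_cover D i j k \<alpha>)"
      "\<forall>x\<in>topspace ?T. card {U \<in> \<beta>. x \<in> U} \<le> ?dim + 1"
      using cover_dim_attained[OF base_props(1)[OF k] push_cover_props(1)[OF ij k \<alpha>(1)]] by blast
    have small: "norm (tw (conn D i j g) k x - tw (conn D i j g) k x * tw (conn D i j g) k x) \<le> \<epsilon>"
      if g: "g \<in> A i" and e: "norm (sec j (conn D i j g) k x - sec j (conn D i j g) k x * sec j (conn D i j g) k x) \<le> \<epsilon>"
        and x: "x \<in> topspace ?T" for g x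
    proof -
      have eq: "tw (conn D i j g) k x - tw (conn D i j g) k x * tw (conn D i j g) k x =
        u k x * (sec j (conn D i j g) k x - sec j (conn D i j g) k x * sec j (conn D i j g) k x) * star (u k x)"
        unfolding tw_mult[OF conn_closed[OF ij' g] k x] by (simp add: tw_def left_diff_distrib right_diff_distrib)
      show ?thesis unfolding eq by (rule order_trans[OF norm_uxu(1)[OF k x] e])
    qed
    have ref: "\<exists>W\<in>push_cover D i j k \<alpha>. U \<subseteq> W" if "U \<in> \<beta>" for U using \<beta>(2) that by (auto simp: refines_def)
    show ?thesis unfolding solves_def
    proof (rule comparison_over_cover[OF base_props(3)[OF k] base_props(4)[OF k] \<beta>(1), where d = ?dim and \<epsilon> = \<epsilon> and \<delta> = \<eta>
          and n = "rk D j k" and c = "un j k"])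
      show "card {U \<in> \<beta>. x \<in> U} \<le> ?dim + 1" if "x \<in> topspace ?T" for x using \<beta>(3) that by blast
      show "star (tw ?a k x) = tw ?a k x" if "x \<in> topspace ?T" for x by (rule star_tw[OF a k that])
      show "star (tw ?b k x) = tw ?b k x" if "x \<in> topspace ?T" for x by (rule star_tw[OF b k that])
      show "norm (tw ?a k x - tw ?a k x * tw ?a k x) \<le> \<epsilon>" if "x \<in> topspace ?T" for x by (rule small[OF a(1) ea[OF k that] that])
      show "norm (tw ?b k x - tw ?b k x * tw ?b k x) \<le> \<epsilon>" if "x \<in> topspace ?T" for x by (rule small[OF b(1) eb[OF k that] that])
      show "norm (tw ?a k x - tw ?a k y) \<le> \<epsilon>" if U: "U \<in> \<beta>" and x: "x \<in> U" and y: "y \<in> U" for U x y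
      proof -
        obtain W where W: "W \<in> push_cover D i j k \<alpha>" "U \<subseteq> W" using ref[OF U] by blast
        show ?thesis by (rule near[OF a(1) _ k W(1)]) (use \<alpha>(2) x y W(2) in auto)
      qed
      show "norm (tw ?b k x - tw ?b k y) \<le> \<epsilon>" if U: "U \<in> \<beta>" and x: "x \<in> U" and y: "y \<in> U" for U x y
      proof -
        obtain W where W: "W \<in> push_cover D i j k \<alpha>" "U \<subseteq> W" using ref[OF U] by blast
        show ?thesis by (rule near[OF b(1) _ k W(1)]) (use \<alpha>(2) x y W(2) in auto)
      qed
      show "emb (msize D j k) (1\<^sub>m (msize D j k)) * tw ?a k x = tw ?a k x" if "x \<in> topspace ?T" for x by (rule r_tw[OF k that])
      show "emb (msize D j k) (1\<^sub>m (msize D j k)) * tw ?b k x = tw ?b k x" if "x \<in> topspace ?T" for x by (rule r_tw[OF k that])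
      show "is_projection (un j k x) \<and> un j k x * tw ?a k x = tw ?a k x \<and> un j k x * tw ?b k x = tw ?b k x \<and>
          tr (msize D j k) (un j k x) = of_nat (rk D j k)" if "x \<in> topspace ?T" for x
        using un_projection[OF k that] un_tw[OF k that] by simp
      show "\<eta> * rk D j k \<le> Re (tr (msize D j k) (tw ?a k x)) - Re (tr (msize D j k) (tw ?b k x))" if "x \<in> topspace ?T" for x
        unfolding tr_tw[OF aA k that] tr_tw[OF bA k that] by (rule gap[OF k that])
      show "0 < rk D j k" by (rule base_props(5)[OF k])
      show "real ?dim \<le> \<eta> / 4 * real (rk D j k)" by (rule dim[OF k])
    qed (rule \<epsilon>)+
  qed
  then have "\<forall>k. \<exists>V. k < summands D j \<longrightarrow> solves k V" by blast
  from choice[OF this] obtain V where V0: "\<And>k. k < summands D j \<Longrightarrow> solves k (V k)" by blast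
  have V: "\<And>k. k < summands D j \<Longrightarrow> continuous_map (base D j k) euclidean (V k)"
    "\<And>k x. k < summands D j \<Longrightarrow> x \<in> topspace (base D j k) \<Longrightarrow> norm (V k x) \<le> 2"
    "\<And>k x. k < summands D j \<Longrightarrow> x \<in> topspace (base D j k) \<Longrightarrow>
      norm (tw ?b k x - tw ?b k x * star (V k x) * tw ?a k x * V k x * tw ?b k x) \<le> 1/2"
    using V0 unfolding solves_def by blast+
  define W where "W k x = star (u k x) * V k x * u k x" for k x
  define w where "w = of_sections j W"
  have W1: "un j k x * W k x * un j k x = W k x" if "k < summands D j" "x \<in> topspace (base D j k)" for k x
    using uu(4,6)[OF that] by (simp add: W_def mult.assoc) (simp add: mult.assoc[symmetric])
  have "continuous_map (base D j k) euclidean (W k)" if k: "k < summands D j" for k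
    unfolding W_def[abs_def] using cu k by (intro continuous_map_bmat_mult continuous_map_bmat_star V(1)) auto
  then have wA: "w \<in> A j" and sw: "\<And>k x. k < summands D j \<Longrightarrow> x \<in> topspace (base D j k) \<Longrightarrow> sec j w k x = W k x"
    unfolding w_def using of_sections_props[of j W] W1 by auto
  have "norm (sec j w k x) \<le> 2" if k: "k < summands D j" and x: "x \<in> topspace (base D j k)" for k x
    unfolding sw[OF k x] W_def by (rule order_trans[OF norm_uxu(2)[OF k x] V(2)[OF k x]])
  then have "norm (\<psi> j w) \<le> 2" by (intro norm_psi_le[OF wA]) simp_all
  moreover have "norm (\<psi> i b - \<psi> i b * star (\<psi> j w) * \<psi> i a * \<psi> j w * \<psi> i b) \<le> 1/2"
  proof -
    let ?S = "stage D j"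
    define g1 where "g1 = sa_times ?S ?b (sa_star ?S w)"
    define g2 where "g2 = sa_times ?S g1 ?a"
    define g3 where "g3 = sa_times ?S g2 w"
    define g4 where "g4 = sa_times ?S g3 ?b"
    have gA: "sa_star ?S w \<in> A j" "g1 \<in> A j" "g2 \<in> A j" "g3 \<in> A j" "g4 \<in> A j"
      unfolding g1_def g2_def g3_def g4_def by (intro stage_closed(2,4) aA bA wA)+
    have psi: "\<psi> j (stage_diff j ?b g4) = \<psi> i b - \<psi> i b * star (\<psi> j w) * \<psi> i a * \<psi> j w * \<psi> i b"
      by (simp add: psi_sub[OF bA gA(5)] psi_ops(2)[OF gA(4) bA, folded g4_def] psi_ops(2)[OF gA(3) wA, folded g3_def]
          psi_ops(2)[OF gA(2) aA, folded g2_def] psi_ops(2)[OF bA gA(1), folded g1_def] psi_ops(4)[OF wA]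
          psi_conn[OF ij' a(1)] psi_conn[OF ij' b(1)])
    have sec: "norm (sec j (stage_diff j ?b g4) k x) \<le> 1/2" if k: "k < summands D j" and x: "x \<in> topspace (base D j k)" for k x
    proof -
      have "sec j (stage_diff j ?b g4) k x = sec j ?b k x - sec j g4 k x"
        unfolding stage_diff_def
        by (simp add: sec_stage_ops(1)[OF bA k x stage_closed(3)[OF gA(5)]] sec_stage_ops(3)[OF gA(5) k x] scaleC_minus_one)
      also have "sec j g4 k x = sec j ?b k x * star (W k x) * sec j ?a k x * W k x * sec j ?b k x"
        by (simp add: sec_stage_ops(2)[OF gA(4) k x bA, folded g4_def] sec_stage_ops(2)[OF gA(3) k x wA, folded g3_def]
          sec_stage_ops(2)[OF gA(2) k x aA, folded g2_def] sec_stage_ops(2)[OF bA k x gA(1), folded g1_def]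
          sec_stage_ops(4)[OF wA k x] sw[OF k x])
      also have "sec j ?b k x - sec j ?b k x * star (W k x) * sec j ?a k x * W k x * sec j ?b k x =
        star (u k x) * (tw ?b k x - tw ?b k x * star (V k x) * tw ?a k x * V k x * tw ?b k x) * u k x"
      proof -
        have twu: "tw g k x * (u k x * (star (u k x) * z)) = tw g k x * z" for g z
        proof -
          have "tw g k x * (u k x * (star (u k x) * z)) = (tw g k x * un j k x) * z"
            using uu(2)[OF k x] by (simp add: mult.assoc[symmetric])
          also have "tw g k x * un j k x = tw g k x" using uu(5)[OF k x] by (simp add: tw_def mult.assoc)
          finally show ?thesis .
        qed
        have uut: "u k x * (star (u k x) * (tw g k x * z)) = tw g k x * z" for g z
        proof -
          have "u k x * (star (u k x) * (tw g k x * z)) = (un j k x * tw g k x) * z"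
            using uu(2)[OF k x] by (simp add: mult.assoc[symmetric])
          then show ?thesis by (simp add: un_tw[OF k x])
        qed
        show ?thesis
          unfolding unt[OF aA k x] unt[OF bA k x] W_def
          by (simp add: star_mult star_star mult.assoc left_diff_distrib right_diff_distrib twu uut)
      qed
      also have "norm \<dots> \<le> 1/2" by (rule order_trans[OF norm_uxu(2)[OF k x] V(3)[OF k x]])
      finally show ?thesis .
    qed
    show ?thesis unfolding psi[symmetric]
      by (rule norm_psi_le[OF sub_closed[OF bA gA(5)]]) (use sec in auto)
  qed
  ultimately show ?thesis by blast
qed

text \<open>
  The order of the choices matters.  The gap \<open>\<eta>\<close> comes first, since it does not depend on the approximants; then
  the tolerance \<open>\<epsilon>\<close>; then a stage \<open>i\<close> at which \<open>p\<close> and \<open>q\<close> are approximated and the supremum over all covers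
  is below \<open>\<eta> / 4\<close>; then a cover adapted to the approximants; and finally the stage \<open>j\<close>, late enough for this cover.
\<close>

lemma comparison_of_projections:
  assumes md: "has_mean_dimension D 0" and p: "is_projection p" and q: "is_projection q"
    and tr: "\<And>\<tau> :: 'a \<Rightarrow> complex. tracial_state \<tau> \<Longrightarrow> Re (\<tau> p) > Re (\<tau> q)"
  shows "\<exists>e. subprojection e p \<and> mvn_equivalent q e"
proof -
  have "\<exists>\<eta>>0. \<forall>i. \<forall>a\<in>A i. \<forall>b\<in>A i. norm (\<psi> i a - p) < \<eta> \<longrightarrow> norm (\<psi> i b - q) < \<eta> \<longrightarrow>
    (\<forall>\<^sub>F j in sequentially. \<forall>k<summands D j. \<forall>x\<in>topspace (base D j k).
      \<eta> * rk D j k \<le> Re (tr (msize D j k) (sec j (conn D i j a) k x)) - Re (tr (msize D j k) (sec j (conn D i j b) k x)))"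
    by (rule trace_gap) (rule tr)
  then obtain \<eta> where \<eta>: "0 < \<eta>" and gap: "\<And>i a b. a \<in> A i \<Longrightarrow> b \<in> A i \<Longrightarrow> norm (\<psi> i a - p) < \<eta> \<Longrightarrow> norm (\<psi> i b - q) < \<eta> \<Longrightarrow>
    \<forall>\<^sub>F j in sequentially. \<forall>k<summands D j. \<forall>x\<in>topspace (base D j k).
      \<eta> * rk D j k \<le> Re (tr (msize D j k) (sec j (conn D i j a) k x)) - Re (tr (msize D j k) (sec j (conn D i j b) k x))"
    by blast
  define \<epsilon> where "\<epsilon> = min (1/2000) (\<eta> / 300)"
  have \<epsilon>: "0 < \<epsilon>" "\<epsilon> \<le> 1/2000" "300 * \<epsilon> \<le> \<eta>" using \<eta> by (auto simp: \<epsilon>_def)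
  \<comment> \<open>An element within \<open>d\<close> of a projection has norm at most 2, so it is idempotent up to \<open>4 d\<close>, which leaves room below \<open>\<epsilon>\<close>.\<close>
  define d where "d = \<epsilon> / 10"
  have d: "0 < d" "d \<le> 1/20000" "10 * d = \<epsilon>" "d < \<eta>" using \<epsilon> \<eta> by (auto simp: d_def)
  obtain i1 a1 where a1: "a1 \<in> A i1" "sa_star (stage D i1) a1 = a1" "norm (\<psi> i1 a1 - p) < d"
    using selfadjoint_approximant[OF is_projectionD(2)[OF p] d(1)] by blast
  obtain i2 b1 where b1: "b1 \<in> A i2" "sa_star (stage D i2) b1 = b1" "norm (\<psi> i2 b1 - q) < d"
    using selfadjoint_approximant[OF is_projectionD(2)[OF q] d(1)] by blast
  obtain c g where c: "\<And>i \<alpha>. \<alpha> \<in> component_covers D i \<Longrightarrow> cover_ratio D i \<alpha> \<longlonglongrightarrow> c i \<alpha>"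
    and g: "\<And>i. g i = (SUP \<alpha>\<in>component_covers D i. ereal (c i \<alpha>))" "g \<longlonglongrightarrow> 0"
    using md unfolding has_mean_dimension_def by auto
  have "\<forall>\<^sub>F i in sequentially. g i < ereal (\<eta> / 4)" using order_tendstoD(2)[OF g(2), of "ereal (\<eta> / 4)"] \<eta> by simp
  then have "\<forall>\<^sub>F i in sequentially. g i < ereal (\<eta> / 4) \<and> i1 \<le> i \<and> i2 \<le> i"
    by (intro eventually_conj eventually_ge_at_top)
  then obtain i where i: "g i < ereal (\<eta> / 4)" "i1 \<le> i" "i2 \<le> i" using eventually_happens by force
  define a where "a = conn D i1 i a1"
  define b where "b = conn D i2 i b1"
  have a: "a \<in> A i" "sa_star (stage D i) a = a" "norm (\<psi> i a - p) < d"
    using conn_closed[OF i(2) a1(1)] conn_ops(4)[OF i(2) a1(1)] a1(2,3) psi_conn[OF i(2) a1(1)] by (auto simp: a_def)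
  have b: "b \<in> A i" "sa_star (stage D i) b = b" "norm (\<psi> i b - q) < d"
    using conn_closed[OF i(3) b1(1)] conn_ops(4)[OF i(3) b1(1)] b1(2,3) psi_conn[OF i(3) b1(1)] by (auto simp: b_def)
  have "0 < \<epsilon> / summands D i" using \<epsilon> summands_pos[of i] by simp
  from fine_component_cover[OF a(1) b(1) this] obtain \<alpha> where \<alpha>: "\<alpha> \<in> component_covers D i"
    "\<And>l. l < summands D i \<Longrightarrow> finite_open_cover (base D i l) (induced_cover \<alpha> l)"
    "\<And>l V x y. l < summands D i \<Longrightarrow> V \<in> induced_cover \<alpha> l \<Longrightarrow> x \<in> V \<Longrightarrow> y \<in> V \<Longrightarrow>
        norm (sec i a l x - sec i a l y) \<le> \<epsilon> / summands D i \<and> norm (sec i b l x - sec i b l y) \<le> \<epsilon> / summands D i"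
    by blast
  have "ereal (c i \<alpha>) \<le> g i" unfolding g(1) by (rule SUP_upper[OF \<alpha>(1)])
  then have "c i \<alpha> < \<eta> / 4" using i(1) by (metis ereal_less_eq(3) le_less_trans less_ereal.simps(1))
  then have ev1: "\<forall>\<^sub>F j in sequentially. cover_ratio D i \<alpha> j < \<eta> / 4" by (rule order_tendstoD(2)[OF c[OF \<alpha>(1)]])
  have almost: "\<forall>\<^sub>F j in sequentially. i < j \<and> (\<forall>k<summands D j. \<forall>x\<in>topspace (base D j k).
      norm (sec j (conn D i j h) k x - sec j (conn D i j h) k x * sec j (conn D i j h) k x) \<le> \<epsilon>)"
    if h: "h \<in> A i" and r: "is_projection r" and close: "norm (\<psi> i h - r) < d" for h and r :: 'a
  proof -
    note rr = is_projectionD[OF r] and nr = norm_projection_le[OF r]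
    have nh: "norm (\<psi> i h) \<le> 2" using norm_triangle_ineq[of "\<psi> i h - r" r] close nr d(2) by simp
    have hh: "sa_times (stage D i) h h \<in> A i" by (rule stage_closed(2)[OF h h])
    have split: "\<psi> i h - \<psi> i h * \<psi> i h = (\<psi> i h - r) - (\<psi> i h * (\<psi> i h - r) + (\<psi> i h - r) * r)"
      using rr by (simp add: algebra_simps)
    have "norm (\<psi> i h - \<psi> i h * \<psi> i h) \<le> norm (\<psi> i h - r) + (norm (\<psi> i h * (\<psi> i h - r)) + norm ((\<psi> i h - r) * r))"
      unfolding split using norm_triangle_ineq4[of "\<psi> i h - r" "\<psi> i h * (\<psi> i h - r) + (\<psi> i h - r) * r"]
        norm_triangle_ineq[of "\<psi> i h * (\<psi> i h - r)" "(\<psi> i h - r) * r"] by linarith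
    moreover have "norm (\<psi> i h * (\<psi> i h - r)) \<le> 2 * d"
      by (rule order_trans[OF norm_mult_ineq]) (use nh close in \<open>intro mult_mono; simp\<close>)
    moreover have "norm ((\<psi> i h - r) * r) \<le> d * 1"
      by (rule order_trans[OF norm_mult_ineq]) (use nr close d in \<open>intro mult_mono; simp\<close>)
    ultimately have "norm (\<psi> i (stage_diff i h (sa_times (stage D i) h h))) < \<epsilon>"
      using close d(1,3) by (simp add: psi_sub[OF h hh] psi_ops(2)[OF h h])
    from eventually_norm_sec_conn_less[OF sub_closed[OF h hh] this] show ?thesis
    proof eventually_elim
      case (elim j)
      then show ?case
        using sec_conn_sub[OF _ h hh] sec_conn_ops(2)[OF _ h _ _ h] by (auto intro: less_imp_le)
    qed
  qed
  have "\<forall>\<^sub>F j in sequentially. cover_ratio D i \<alpha> j < \<eta> / 4 \<and>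
      (i < j \<and> (\<forall>k<summands D j. \<forall>x\<in>topspace (base D j k).
        norm (sec j (conn D i j a) k x - sec j (conn D i j a) k x * sec j (conn D i j a) k x) \<le> \<epsilon>)) \<and>
      (i < j \<and> (\<forall>k<summands D j. \<forall>x\<in>topspace (base D j k).
        norm (sec j (conn D i j b) k x - sec j (conn D i j b) k x * sec j (conn D i j b) k x) \<le> \<epsilon>)) \<and>
      (\<forall>k<summands D j. \<forall>x\<in>topspace (base D j k).
      \<eta> * rk D j k \<le> Re (tr (msize D j k) (sec j (conn D i j a) k x)) - Re (tr (msize D j k) (sec j (conn D i j b) k x)))"
    by (intro eventually_conj ev1 almost[OF a(1) p a(3)] almost[OF b(1) q b(3)] gap[OF a(1) b(1)])
       (use a(3) b(3) d(4) in auto)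
  from eventually_happens'[OF sequentially_bot this] obtain j where j0: "cover_ratio D i \<alpha> j < \<eta> / 4 \<and>
      (i < j \<and> (\<forall>k<summands D j. \<forall>x\<in>topspace (base D j k).
        norm (sec j (conn D i j a) k x - sec j (conn D i j a) k x * sec j (conn D i j a) k x) \<le> \<epsilon>)) \<and>
      (i < j \<and> (\<forall>k<summands D j. \<forall>x\<in>topspace (base D j k).
        norm (sec j (conn D i j b) k x - sec j (conn D i j b) k x * sec j (conn D i j b) k x) \<le> \<epsilon>)) \<and>
      (\<forall>k<summands D j. \<forall>x\<in>topspace (base D j k).
      \<eta> * rk D j k \<le> Re (tr (msize D j k) (sec j (conn D i j a) k x)) - Re (tr (msize D j k) (sec j (conn D i j b) k x)))"
    by (rule exE)
  have j: "cover_ratio D i \<alpha> j < \<eta> / 4" "i < j"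
      "\<And>k x. k < summands D j \<Longrightarrow> x \<in> topspace (base D j k) \<Longrightarrow>
        norm (sec j (conn D i j a) k x - sec j (conn D i j a) k x * sec j (conn D i j a) k x) \<le> \<epsilon>"
      "\<And>k x. k < summands D j \<Longrightarrow> x \<in> topspace (base D j k) \<Longrightarrow>
        norm (sec j (conn D i j b) k x - sec j (conn D i j b) k x * sec j (conn D i j b) k x) \<le> \<epsilon>"
      "\<And>k x. k < summands D j \<Longrightarrow> x \<in> topspace (base D j k) \<Longrightarrow>
      \<eta> * rk D j k \<le> Re (tr (msize D j k) (sec j (conn D i j a) k x)) - Re (tr (msize D j k) (sec j (conn D i j b) k x))"
    using j0 by blast+
  have dim: "real (cover_dim (base D j k) (push_cover D i j k \<alpha>)) \<le> \<eta> / 4 * rk D j k" if k: "k < summands D j" for k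
  proof -
    have "real (cover_dim (base D j k) (push_cover D i j k \<alpha>)) / real (rk D j k) \<le> cover_ratio D i \<alpha> j"
      unfolding cover_ratio_def by (rule Max_ge) (use k in auto)
    from order_trans[OF this less_imp_le[OF j(1)]] have "real (cover_dim (base D j k) (push_cover D i j k \<alpha>)) / real (rk D j k) \<le> \<eta> / 4" .
    then show ?thesis using base_props(5)[OF k] by (simp only: pos_divide_le_eq of_nat_0_less_iff)
  qed
  have "\<exists>w. norm w \<le> 2 \<and> norm (\<psi> i b - \<psi> i b * star w * \<psi> i a * w * \<psi> i b) \<le> 1/2"
  proof (rule comparison_at_stage[where \<alpha> = \<alpha>, OF j(2) a(1,2) b(1,2) \<epsilon>])
    show "norm (sec i a l x - sec i a l y) \<le> \<epsilon> / summands D i \<and> norm (sec i b l x - sec i b l y) \<le> \<epsilon> / summands D i"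
      if "l < summands D i" "V \<in> induced_cover \<alpha> l" "x \<in> V" "y \<in> V" for l V x y by (rule \<alpha>(3)[OF that])
  qed (use \<alpha>(2) dim j(3-5) in simp_all)
  then obtain w where w: "norm w \<le> 2" "norm (\<psi> i b - \<psi> i b * star w * \<psi> i a * w * \<psi> i b) \<le> 1/2" by blast
  have nb: "norm (\<psi> i b) \<le> 2" using norm_triangle_ineq[of "\<psi> i b - q" q] b(3) norm_projection_le[OF q] d(2) by simp
  have na: "norm (\<psi> i a) \<le> 2" using norm_triangle_ineq[of "\<psi> i a - p" p] a(3) norm_projection_le[OF p] d(2) by simp
  have norm_add5: "norm (x1 + x2 + (x3 + x4 + x5)) \<le> norm x1 + norm x2 + (norm x3 + norm x4 + norm x5)" for x1 x2 x3 x4 x5 :: 'a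
    using norm_triangle_ineq[of "x1 + x2" "x3 + x4 + x5"] norm_triangle_ineq[of x1 x2]
      norm_triangle_ineq[of "x3 + x4" x5] norm_triangle_ineq[of x3 x4] by linarith
  have norm_mult5: "norm (x1 * x2 * x3 * x4 * x5) \<le> c1 * c2 * c3 * c4 * c5"
    if "norm x1 \<le> c1" "norm x2 \<le> c2" "norm x3 \<le> c3" "norm x4 \<le> c4" "norm x5 \<le> c5" for x1 x2 x3 x4 x5 :: 'a and c1 c2 c3 c4 c5
  proof -
    have c0: "0 \<le> c1" "0 \<le> c2" "0 \<le> c3" "0 \<le> c4" "0 \<le> c5" using that norm_ge_zero order_trans by blast+
    show ?thesis
      by (intro order_trans[OF norm_mult_ineq] mult_mono that c0 mult_nonneg_nonneg norm_ge_zero)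
  qed
  have dec: "q - q * star w * p * w * q = (q - \<psi> i b) + (\<psi> i b - \<psi> i b * star w * \<psi> i a * w * \<psi> i b)
      + ((\<psi> i b - q) * star w * p * w * q + \<psi> i b * star w * (\<psi> i a - p) * w * q + \<psi> i b * star w * \<psi> i a * w * (\<psi> i b - q))"
    by (simp add: left_diff_distrib right_diff_distrib)
  have "norm (q - q * star w * p * w * q) \<le> norm (q - \<psi> i b) + norm (\<psi> i b - \<psi> i b * star w * \<psi> i a * w * \<psi> i b)
      + (norm ((\<psi> i b - q) * star w * p * w * q) + norm (\<psi> i b * star w * (\<psi> i a - p) * w * q) + norm (\<psi> i b * star w * \<psi> i a * w * (\<psi> i b - q)))"
    unfolding dec by (rule norm_add5)
  moreover have "norm ((\<psi> i b - q) * star w * p * w * q) \<le> d * 2 * 1 * 2 * 1"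
    by (rule norm_mult5) (use b(3) w(1) norm_projection_le[OF p] norm_projection_le[OF q] in auto)
  moreover have "norm (\<psi> i b * star w * (\<psi> i a - p) * w * q) \<le> 2 * 2 * d * 2 * 1"
    by (rule norm_mult5) (use a(3) nb w(1) norm_projection_le[OF q] in auto)
  moreover have "norm (\<psi> i b * star w * \<psi> i a * w * (\<psi> i b - q)) \<le> 2 * 2 * 2 * 2 * d"
    by (rule norm_mult5) (use b(3) na nb w(1) in auto)
  moreover have "norm (q - \<psi> i b) < d" using b(3) by (simp add: norm_minus_commute)
  ultimately have "norm (q - q * star w * p * w * q) < 1" using w(2) d(2) by linarith
  then show ?thesis by (rule subequivalent_if_almost[OF p q])
qed

end

theorem theorem4p4:
  fixes D :: "'x ah_data"
    and \<psi> :: "nat \<Rightarrow> 'x dsum \<Rightarrow> 'a::unital_cstar_algebra"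
    and p q :: 'a
  assumes "diagonal_ah_algebra D \<psi>"
    and "simple_cstar_algebra TYPE('a)"
    and "has_mean_dimension D 0"
    and "is_projection p" and "is_projection q"
    and "\<And>\<tau> :: 'a \<Rightarrow> complex. tracial_state \<tau> \<Longrightarrow> Re (\<tau> p) > Re (\<tau> q)"
  shows "\<exists>e. subprojection e p \<and> mvn_equivalent q e"
proof -
  interpret diag_ah D \<psi>
    by unfold_locales (use assms(1) in \<open>simp_all add: diagonal_ah_algebra_def\<close>)
  show ?thesis using assms(3-6) by (rule comparison_of_projections)
qed

end
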